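(* Let $f=f(X,T)$ be a solution of $$2\partial_2 f=-\tfrac16\partial_1(f^3)+\tfrac1{12}\partial_1^3 f$$ with $f\in C_b(\mathbb R,\mathcal X^6(\mathbb R))$, where $f(\cdot,T)$ has fixed limits $f_\pm$ at $X\to\pm\infty$ (independent of $T$). Set $\delta=\sup_{\tau\in\mathbb R}\|f(\cdot,\tau)\|_{\mathcal X^6}$. Fix $r\in(0,1/2)$. Then there exist positive constants $\epsilon_0$, $C$ and $K$ such that for all $\epsilon\in(0,\epsilon_0)$ the following holds. Let $F_\pm=f_\pm-\frac{\epsilon^2}{12}f_\pm^3$. Suppose the initial data $(u(0),\dot u(0))$ satisfy $$\sum_{n=-\infty}^{\infty}\dot u_n(0)=\epsilon F_+-\epsilon F_-,$$ $$\|u(0)-\epsilon f(\epsilon\cdot,0)\|_{\ell^2}+\|\dot u(0)-\epsilon^2\partial_1 f(\epsilon\cdot,0)\|_{\ell^2_2}\le\epsilon^{5/2},$$ and $f(\cdot,0)\in\mathcal X^6_2$. Then the unique solution $(u,q)$ of the FPUT system $$\dot u_n=q_{n+1}-q_n,\qquad \dot q_n=u_n-u_{n-1}-\tfrac16(u_n^3-u_{n-1}^3),\qquad n\in\mathbb Z,$$ with these initial data (and $q_n(0)=\sum_{k=-\infty}^{n-1}\dot u_k(0)$) belongs to $C^1([-t_0(\epsilon),t_0(\epsilon)],\ell^\infty(\mathbb Z))$ with $t_0(\epsilon):=rK^{-1}\epsilon^{-3}|\log(\epsilon)|$, and satisfies, for all $t\in[-t_0(\epsilon),t_0(\epsilon)]$,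 $$\|u(t)-\epsilon f(\epsilon(\cdot+t),\epsilon^3t)\|_{\ell^2}+\|\dot u(t)-\epsilon^2\partial_1 f(\epsilon(\cdot+t),\epsilon^3t)\|_{\ell^2}\le C\epsilon^{5/2-r}.$$
   Context: $\partial_1,\partial_2$ denote derivatives with respect to the first (space) and second (time) argument. $\langle x\rangle=\sqrt{1+x^2}$. $\langle\cdot\rangle_+$ is a fixed smooth function with $\langle x\rangle_+=\langle x\rangle$ for $x>1$, $=1$ for $x<0$, $\ge1$ everywhere; $\langle\cdot\rangle_-$ analogously with $\langle x\rangle_-=\langle x\rangle$ for $x<-1$, $=1$ for $x>0$. For $k\in\mathbb N$, $\mathcal X^k(\mathbb R)=\{f\in L^\infty: f'\in H^{k-1}\}$ with norm $\|f\|_{L^\infty}+\|f'\|_{H^{k-1}}$. $\mathcal X^k_{n^\pm}$ is the set of $f\in\mathcal X^k$ with $\lim_{x\to\pm\infty}f=f_\pm$ and $(f-f_\pm)\langle\cdot\rangle_\pm^n\in\mathcal X^k$, normed by $|f_\pm|+\|(f-f_\pm)\langle\cdot\rangle_\pm^n\|_{\mathcal X^k}$; $\mathcal X^k_n=\mathcal X^k_{n^+}\cap\mathcal X^k_{n^-}$ with the sum of norms. $\|a\|_{\ell^2_2}=\|(\langle n\rangle^2a_n)_n\|_{\ell^2}$. $f(\epsilon\cdot,0)$ denotes the sequence $n\mapsto f(\epsilon n,0)$. *)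

theory Defs
  imports "HOL-Analysis.Analysis"
begin

definition jbr :: "real \<Rightarrow> real" where
  "jbr x = sqrt (1 + x^2)"

definition smooth_fun :: "(real \<Rightarrow> real) \<Rightarrow> bool" where
  "smooth_fun w \<longleftrightarrow> (\<forall>j x. ((deriv ^^ j) w has_real_derivative (deriv ^^ Suc j) w x) (at x))"

definition weight_plus :: "(real \<Rightarrow> real) \<Rightarrow> bool" where
  "weight_plus w \<longleftrightarrow> smooth_fun w \<and> (\<forall>x>1. w x = jbr x) \<and> (\<forall>x<0. w x = 1) \<and> (\<forall>x. w x \<ge> 1)"

definition weight_minus :: "(real \<Rightarrow> real) \<Rightarrow> bool" where
  "weight_minus w \<longleftrightarrow> smooth_fun w \<and> (\<forall>x< -1. w x = jbr x) \<and> (\<forall>x>0. w x = 1) \<and> (\<forall>x. w x \<ge> 1)"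

text \<open>\<open>h\<close> is the (square integrable) weak derivative of the \<open>(k-1)\<close>-th derivative of \<open>g\<close>
  (so \<open>(k-1)\<close>-th derivative is locally absolutely continuous).\<close>
definition weak_top :: "nat \<Rightarrow> (real \<Rightarrow> real) \<Rightarrow> (real \<Rightarrow> real) \<Rightarrow> bool" where
  "weak_top k g h \<longleftrightarrow> h \<in> borel_measurable lborel \<and> integrable lborel (\<lambda>x. (h x)^2) \<and>
     (\<forall>a b. a \<le> b \<longrightarrow> set_integrable lborel {a..b} h \<and>
        (deriv ^^ (k - 1)) g b - (deriv ^^ (k - 1)) g a = (LINT x:{a..b}|lborel. h x))"

text \<open>The space \<open>\<X>^k(\<real>) = {f \<in> L^\<infinity> : f' \<in> H^{k-1}}\<close> (continuous representatives).\<close>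
definition Xspace :: "nat \<Rightarrow> (real \<Rightarrow> real) \<Rightarrow> bool" where
  "Xspace k g \<longleftrightarrow> k \<ge> 1 \<and> bounded (range g) \<and>
     (\<forall>j x. j + 1 < k \<longrightarrow> ((deriv ^^ j) g has_real_derivative (deriv ^^ Suc j) g x) (at x)) \<and>
     (\<forall>j\<in>{1..<k}. integrable lborel (\<lambda>x. ((deriv ^^ j) g x)^2)) \<and>
     (\<exists>h. weak_top k g h)"

definition Xnorm :: "nat \<Rightarrow> (real \<Rightarrow> real) \<Rightarrow> real" where
  "Xnorm k g = (SUP x. \<bar>g x\<bar>) +
     sqrt ((\<Sum>j\<in>{1..<k}. LINT x|lborel. ((deriv ^^ j) g x)^2) +
           (LINT x|lborel. ((SOME h. weak_top k g h) x)^2))"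

definition Xspace_plus :: "(real \<Rightarrow> real) \<Rightarrow> nat \<Rightarrow> nat \<Rightarrow> (real \<Rightarrow> real) \<Rightarrow> bool" where
  "Xspace_plus w k n g \<longleftrightarrow> Xspace k g \<and> (\<exists>L. (g \<longlongrightarrow> L) at_top \<and> Xspace k (\<lambda>x. (g x - L) * (w x)^n))"

definition Xspace_minus :: "(real \<Rightarrow> real) \<Rightarrow> nat \<Rightarrow> nat \<Rightarrow> (real \<Rightarrow> real) \<Rightarrow> bool" where
  "Xspace_minus w k n g \<longleftrightarrow> Xspace k g \<and> (\<exists>L. (g \<longlongrightarrow> L) at_bot \<and> Xspace k (\<lambda>x. (g x - L) * (w x)^n))"

definition Xspace_w :: "(real \<Rightarrow> real) \<Rightarrow> (real \<Rightarrow> real) \<Rightarrow> nat \<Rightarrow> nat \<Rightarrow> (real \<Rightarrow> real) \<Rightarrow> bool" where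
  "Xspace_w wp wm k n g \<longleftrightarrow> Xspace_plus wp k n g \<and> Xspace_minus wm k n g"

definition Cb_X :: "nat \<Rightarrow> (real \<Rightarrow> real \<Rightarrow> real) \<Rightarrow> bool" where
  "Cb_X k f \<longleftrightarrow> (\<forall>T. Xspace k (\<lambda>x. f x T)) \<and>
     (\<exists>B. \<forall>T. Xnorm k (\<lambda>x. f x T) \<le> B) \<and>
     (\<forall>T. ((\<lambda>S. Xnorm k (\<lambda>x. f x S - f x T)) \<longlongrightarrow> 0) (at T))"

definition mkdv_sol :: "(real \<Rightarrow> real \<Rightarrow> real) \<Rightarrow> bool" where
  "mkdv_sol f \<longleftrightarrow> (\<forall>X T.
     ((\<lambda>x. (f x T)^3) differentiable (at X)) \<and>
     ((\<lambda>t. f X t) has_real_derivative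
        ((- (1/6) * deriv (\<lambda>x. (f x T)^3) X + (1/12) * (deriv ^^ 3) (\<lambda>x. f x T) X) / 2)) (at T))"

definition d1 :: "(real \<Rightarrow> real \<Rightarrow> real) \<Rightarrow> real \<Rightarrow> real \<Rightarrow> real" where
  "d1 f X T = deriv (\<lambda>x. f x T) X"

definition in_l2 :: "(int \<Rightarrow> real) \<Rightarrow> bool" where
  "in_l2 a \<longleftrightarrow> (\<lambda>n. (a n)^2) summable_on UNIV"

definition l2norm :: "(int \<Rightarrow> real) \<Rightarrow> real" where
  "l2norm a = sqrt (\<Sum>\<^sub>\<infinity>n. (a n)^2)"

definition l22weight :: "(int \<Rightarrow> real) \<Rightarrow> int \<Rightarrow> real" where
  "l22weight a n = (jbr (real_of_int n))^2 * a n"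

definition in_l22 :: "(int \<Rightarrow> real) \<Rightarrow> bool" where
  "in_l22 a \<longleftrightarrow> in_l2 (l22weight a)"

definition l22norm :: "(int \<Rightarrow> real) \<Rightarrow> real" where
  "l22norm a = l2norm (l22weight a)"

text \<open>\<open>(u,q) \<in> C^1([-t0,t0], \<ell>^\<infinity>(\<int>))\<close> solves FPUT with data \<open>u(0) = u0\<close>, \<open>q(0) = q0\<close>;
  \<open>du, dq\<close> are the time derivatives.  \<open>\<ell>^\<infinity>(\<int>)\<close> is \<open>int \<Rightarrow>\<^sub>C real\<close> (\<int> discrete).\<close>
definition FPUT_sol :: "real \<Rightarrow> (int \<Rightarrow> real) \<Rightarrow> (int \<Rightarrow> real) \<Rightarrow>
    (real \<Rightarrow> (int \<Rightarrow>\<^sub>C real)) \<Rightarrow> (real \<Rightarrow> (int \<Rightarrow>\<^sub>C real)) \<Rightarrow>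
    (real \<Rightarrow> (int \<Rightarrow>\<^sub>C real)) \<Rightarrow> (real \<Rightarrow> (int \<Rightarrow>\<^sub>C real)) \<Rightarrow> bool" where
  "FPUT_sol t0 u0 q0 u q du dq \<longleftrightarrow>
     (\<forall>t\<in>{-t0..t0}. (u has_vector_derivative du t) (at t within {-t0..t0}) \<and>
                    (q has_vector_derivative dq t) (at t within {-t0..t0})) \<and>
     continuous_on {-t0..t0} du \<and> continuous_on {-t0..t0} dq \<and>
     (\<forall>t\<in>{-t0..t0}. \<forall>n.
        apply_bcontfun (du t) n = apply_bcontfun (q t) (n + 1) - apply_bcontfun (q t) n \<and>
        apply_bcontfun (dq t) n = apply_bcontfun (u t) n - apply_bcontfun (u t) (n - 1)
           - (1/6) * ((apply_bcontfun (u t) n)^3 - (apply_bcontfun (u t) (n - 1))^3)) \<and>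
     (\<forall>n. apply_bcontfun (u 0) n = u0 n \<and> apply_bcontfun (q 0) n = q0 n)"

end

theory Submission
  imports Defs
begin

text \<open>Put \<open>X = \<epsilon> (n + t)\<close>, \<open>T = \<epsilon>\<^sup>3 t\<close>, and compare \<open>(u, q)\<close> with \<open>U\<^sub>n = \<epsilon> f (X, T)\<close> and
  \<open>Q\<^sub>n = \<epsilon> (f - \<epsilon>\<^sup>2 f\<^sup>3 / 12) (X - \<epsilon> / 2, T) - \<epsilon> F\<^sub>-\<close>.  The half-cell shift makes both lattice
  differences centred, so by the mKdV equation the residuals are \<open>O(\<epsilon>\<^sup>6)\<close> pointwise and
  \<open>O(\<epsilon>\<^bsup>11/2\<^esup>)\<close> in \<open>\<ell>\<^sup>2\<close>.  The weights on the initial data and the condition on the sum of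
  \<open>du(0)/dt\<close> give an \<open>\<ell>\<^sup>2\<close> bound of order \<open>\<epsilon>\<^bsup>5/2\<^esup>\<close> for \<open>q(0) - Q(0)\<close>.
  For the errors \<open>\<eta> = u - U\<close>, \<open>\<xi> = q - Q\<close> the energy \<open>\<Sum> \<xi>\<^sup>2 + (1 - U\<^sup>2 / 2) \<eta>\<^sup>2\<close> grows at rate
  \<open>O(\<epsilon>\<^sup>3)\<close> as long as \<open>\<bar>\<eta>\<bar> \<le> \<epsilon>\<^sup>2\<close>, and Gronwall's lemma yields \<open>\<epsilon>\<^bsup>5/2 - r\<^esup>\<close> on the time
  scale \<open>\<epsilon>\<^sup>-\<^sup>3 \<bar>ln \<epsilon>\<bar>\<close>.  No continuation argument is needed: the higher order terms in \<open>\<eta>\<close> are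
  truncated at size \<open>\<epsilon>\<^sup>2\<close>, which makes the system globally Lipschitz in \<open>\<ell>\<^sup>\<infinity>\<close>, and the estimate shows
  afterwards that the truncation was never active.  Solutions are only known to be bounded, so the
  energy is first computed on finite windows with geometric weights, which are then removed.\<close>

section \<open>Lipschitz differential equations in Banach spaces\<close>

text \<open>The coefficient 1/12 in Q comes from the first equation. The centred difference of
  \<epsilon> f is \<epsilon>^2 f' + \<epsilon>^4 f'''/24 up to higher order, while the mKdV equation
  puts \<epsilon>^4 (f'''/24 - f^2 f'/4) into the time derivative of U; the term -\<epsilon>^3
  f^3/12 supplies the difference. In the second equation the force produces -\<epsilon>^4 f^2 f'/2:
  one half is matched by the mKdV equation, the other by the time derivative of the same cubic term.
  The rate \<epsilon>^3 is shared by the drift of the coefficient 1 - U^2/2, of size U U', and by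
  the truncated nonlinearity, of size U \<epsilon>^2 times the error. Squared residuals of order
  \<epsilon>^11 divided by the squared rate \<epsilon>^6 give \<epsilon>^5, the order of the squared
  initial error, so the residuals cost only a constant. At the final time the squared error is of
  order \<epsilon>^(5-r), which lies below \<epsilon>^4 for small \<epsilon>: this is the margin
  that keeps the truncation inactive.\<close>

lemma norm_le_exp_of_derivative_le_exp:
  fixes D :: "real \<Rightarrow> 'a::real_normed_vector"
  assumes der: "\<And>t. t \<in> {-T..T} \<Longrightarrow> (D has_vector_derivative D' t) (at t within {-T..T})"
    and bnd: "\<And>t. t \<in> {-T..T} \<Longrightarrow> norm (D' t) \<le> c * exp (K * \<bar>t\<bar>)"
    and D0: "D 0 = 0" and K: "K > 0" and t: "t \<in> {-T..T}"
  shows "norm (D t) \<le> c / K * exp (K * \<bar>t\<bar>)"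
proof -
  have T: "0 \<in> {-T..T}" using t by auto
  have c0: "c \<ge> 0"
  proof -
    have "0 \<le> c * exp (K * \<bar>0::real\<bar>)"
      using bnd[OF T] norm_ge_zero[of "D' 0"] by linarith
    then show ?thesis by simp
  qed
  have cont: "continuous_on {-T..T} D"
    using der by (rule continuous_on_vector_derivative)
  have der': "(D has_vector_derivative D' s) (at s)" if "-T < s" "s < T" for s
    using der[of s] that by (simp add: at_within_Icc_at)
  consider "t = 0" | "t > 0" | "t < 0" by linarith
  then show ?thesis
  proof cases
    case 1
    then show ?thesis using D0 c0 K by simp
  next
    case 2
    have "norm (D t - D 0) \<le> c / K * exp (K * t) - c / K * exp (K * 0)"
    proof (rule differentiable_bound_general[OF 2, where \<phi> = "\<lambda>s. c / K * exp (K * s)"])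
      show "continuous_on {0..t} D" using cont t by (auto intro: continuous_on_subset)
      show "continuous_on {0..t} (\<lambda>s. c / K * exp (K * s))" by (intro continuous_intros)
      fix s assume s: "0 < s" "s < t"
      show "(D has_vector_derivative D' s) (at s)" using der' s t by auto
      show "((\<lambda>s. c / K * exp (K * s)) has_vector_derivative c * exp (K * s)) (at s)"
        unfolding has_real_derivative_iff_has_vector_derivative[symmetric]
        using K by (auto intro!: derivative_eq_intros)
      show "norm (D' s) \<le> c * exp (K * s)" using bnd[of s] s t by auto
    qed
    also have "\<dots> \<le> c / K * exp (K * \<bar>t\<bar>)" using 2 c0 K by simp
    finally show ?thesis using D0 by simp
  next
    case 3
    have "norm (D 0 - D t) \<le> - (c / K) * exp (- K * 0) - (- (c / K) * exp (- K * t))"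
    proof (rule differentiable_bound_general[OF 3, where \<phi> = "\<lambda>s. - (c / K) * exp (- K * s)"])
      show "continuous_on {t..0} D" using cont t by (auto intro: continuous_on_subset)
      show "continuous_on {t..0} (\<lambda>s. - (c / K) * exp (- K * s))" by (intro continuous_intros)
      fix s assume s: "t < s" "s < 0"
      show "(D has_vector_derivative D' s) (at s)" using der' s t by auto
      show "((\<lambda>s. - (c / K) * exp (- K * s)) has_vector_derivative c * exp (- K * s)) (at s)"
        unfolding has_real_derivative_iff_has_vector_derivative[symmetric]
        using K by (auto intro!: derivative_eq_intros)
      show "norm (D' s) \<le> c * exp (- K * s)" using bnd[of s] s t by auto
    qed
    also have "\<dots> \<le> c / K * exp (K * \<bar>t\<bar>)" using 3 c0 K by simp
    finally show ?thesis using D0 by simp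
  qed
qed

text \<open>The weighted size exp (-2 L |s|) |D s| attains its maximum \<open>M\<close> at some
  \<open>t1\<close>. Integrating the derivative bound from 0 against this weight gains a factor L /
  (2 L), so \<open>M\<close> is at most half of itself. The weight treats both time directions and
  any interval length in one step.\<close>

lemma eq_zero_of_derivative_le:
  fixes D :: "real \<Rightarrow> 'a::real_normed_vector"
  assumes der: "\<And>t. t \<in> {-T..T} \<Longrightarrow> (D has_vector_derivative D' t) (at t within {-T..T})"
    and bnd: "\<And>t. t \<in> {-T..T} \<Longrightarrow> norm (D' t) \<le> L * norm (D t)"
    and D0: "D 0 = 0" and L: "L > 0" and t: "t \<in> {-T..T}"
  shows "D t = 0"
proof -
  define K where "K = 2 * L"
  have K: "K > 0" using L by (simp add: K_def)
  have cont: "continuous_on {-T..T} D"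
    using der by (rule continuous_on_vector_derivative)
  have "\<exists>x\<in>{-T..T}. \<forall>y\<in>{-T..T}. exp (- K * \<bar>y\<bar>) * norm (D y) \<le> exp (- K * \<bar>x\<bar>) * norm (D x)"
    by (rule continuous_attains_sup) (use t cont in \<open>auto intro!: continuous_intros\<close>)
  then obtain t1 where t1: "t1 \<in> {-T..T}"
    and max: "\<And>s. s \<in> {-T..T} \<Longrightarrow> exp (- K * \<bar>s\<bar>) * norm (D s) \<le> exp (- K * \<bar>t1\<bar>) * norm (D t1)"
    by blast
  define M where "M = exp (- K * \<bar>t1\<bar>) * norm (D t1)"
  have le: "norm (D s) \<le> M * exp (K * \<bar>s\<bar>)" if "s \<in> {-T..T}" for s
    using max[OF that] by (simp add: M_def exp_minus field_simps)
  have "norm (D t1) \<le> (L * M) / K * exp (K * \<bar>t1\<bar>)"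
  proof (rule norm_le_exp_of_derivative_le_exp[OF der _ D0 K t1])
    fix s assume s: "s \<in> {-T..T}"
    have "norm (D' s) \<le> L * norm (D s)" using bnd s by auto
    also have "\<dots> \<le> L * (M * exp (K * \<bar>s\<bar>))" using le[OF s] L by (intro mult_left_mono) auto
    finally show "norm (D' s) \<le> L * M * exp (K * \<bar>s\<bar>)" by (simp add: mult.assoc)
  qed
  then have "M \<le> M / 2" using L by (simp add: M_def K_def exp_minus field_simps)
  moreover have "M \<ge> 0" by (simp add: M_def)
  ultimately have "M = 0" by simp
  then show ?thesis using le[OF t] by simp
qed

text \<open>Picard iteration in the exponentially weighted (Bielecki) norm: with weight rate 2 L the
  integral operator contracts by 1/2 on all of {-T..T}, so one fixed point is the solution on the
  whole interval and no short-time solutions have to be glued.\<close>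

lemma lipschitz_ode_exists:
  fixes F :: "real \<Rightarrow> 'a::banach \<Rightarrow> 'a"
  assumes cont: "\<And>y. continuous_on UNIV (\<lambda>t. F t y)"
    and lip: "\<And>t y z. norm (F t y - F t z) \<le> L * norm (y - z)"
    and L: "L > 0" and T: "T \<ge> 0"
  obtains y where "y 0 = y0"
    and "\<And>t. t \<in> {-T..T} \<Longrightarrow> (y has_vector_derivative F t (y t)) (at t within {-T..T})"
proof -
  define K where "K = 2 * L"
  have K: "K > 0" using L by (simp add: K_def)
  have Fcont: "continuous_on A (\<lambda>t. F t (g t))" if g: "continuous_on A g" for A and g :: "real \<Rightarrow> 'a"
    unfolding continuous_on_def
  proof
    fix x assume x: "x \<in> A"
    have "((\<lambda>t. F t (g t) - F t (g x)) \<longlongrightarrow> 0) (at x within A)"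
    proof (rule Lim_null_comparison)
      show "eventually (\<lambda>t. norm (F t (g t) - F t (g x)) \<le> L * norm (g t - g x)) (at x within A)"
        using lip by simp
      have "(g \<longlongrightarrow> g x) (at x within A)" using g x by (auto simp: continuous_on_def)
      then have "((\<lambda>t. L * norm (g t - g x)) \<longlongrightarrow> L * norm (g x - g x)) (at x within A)"
        by (intro tendsto_intros)
      then show "((\<lambda>t. L * norm (g t - g x)) \<longlongrightarrow> 0) (at x within A)" by simp
    qed
    moreover have "((\<lambda>t. F t (g x)) \<longlongrightarrow> F x (g x)) (at x within A)"
      using continuous_on_subset[OF cont subset_UNIV] x unfolding continuous_on_def by blast
    ultimately have "((\<lambda>t. (F t (g t) - F t (g x)) + F t (g x)) \<longlongrightarrow> 0 + F x (g x)) (at x within A)"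
      by (rule tendsto_add)
    then show "((\<lambda>t. F t (g t)) \<longlongrightarrow> F x (g x)) (at x within A)" by simp
  qed
  \<comment> \<open>The unknown \<open>z\<close> stands for the rescaled solution exp (-K |t|) y t,
    so the plain sup norm of \<open>z\<close> is the weighted norm of y. The integral starts at -T;
    subtracting \<open>I z 0\<close> later moves the base point to time 0.\<close>
  define I where "I z t = integral {-T..t} (\<lambda>s. F s (exp (K * \<bar>s\<bar>) *\<^sub>R apply_bcontfun z s))"
    for z :: "real \<Rightarrow>\<^sub>C 'a" and t
  have Icont: "continuous_on A (\<lambda>s. F s (exp (K * \<bar>s\<bar>) *\<^sub>R apply_bcontfun z s))" for A and z :: "real \<Rightarrow>\<^sub>C 'a"
    by (intro Fcont continuous_intros) auto
  have Ider: "((I z) has_vector_derivative F t (exp (K * \<bar>t\<bar>) *\<^sub>R apply_bcontfun z t)) (at t within {-T..T})"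
    if "t \<in> {-T..T}" for z t
    unfolding I_def using integral_has_vector_derivative[OF Icont that] .
  \<comment> \<open>The contraction acts on bounded continuous functions on the whole line. Clamping
    the time extends each candidate beyond {-T..T} by constants.\<close>
  define p where "p t = max (-T) (min T t)" for t
  have p: "p t \<in> {-T..T}" for t using T by (auto simp: p_def)
  have p_id: "t \<in> {-T..T} \<Longrightarrow> p t = t" for t by (auto simp: p_def)
  have p_cont: "continuous_on UNIV p" unfolding p_def by (intro continuous_intros)
  define J where "J z t = exp (- K * \<bar>p t\<bar>) *\<^sub>R (y0 + (I z (p t) - I z 0))" for z t
  have J: "J z \<in> bcontfun" for z
  proof -
    have c: "continuous_on {-T..T} (\<lambda>t. exp (- K * \<bar>t\<bar>) *\<^sub>R (y0 + (I z t - I z 0)))"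
      using continuous_on_vector_derivative[OF Ider] by (intro continuous_intros) auto
    have "continuous_on UNIV (J z)"
      unfolding J_def by (rule continuous_on_compose2[OF c p_cont]) (use p in auto)
    moreover have "bounded ((\<lambda>t. exp (- K * \<bar>t\<bar>) *\<^sub>R (y0 + (I z t - I z 0))) ` {-T..T})"
      using compact_continuous_image[OF c] compact_imp_bounded by blast
    then have "bounded (range (J z))"
      by (rule bounded_subset) (use p in \<open>auto simp: J_def\<close>)
    ultimately show ?thesis by (simp add: bcontfun_def)
  qed
  define \<Phi> where "\<Phi> z = Bcontfun (J z)" for z
  have \<Phi>: "apply_bcontfun (\<Phi> z) = J z" for z
    unfolding \<Phi>_def by (rule Bcontfun_inverse[OF J])
  have "dist (\<Phi> z) (\<Phi> w) \<le> 1/2 * dist z w" for z w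
  proof (rule dist_bound)
    fix x
    let ?t = "p x"
    let ?D = "\<lambda>t. (I z t - I w t) - (I z 0 - I w 0)"
    have "norm (?D ?t) \<le> (L * dist z w) / K * exp (K * \<bar>?t\<bar>)"
    proof (rule norm_le_exp_of_derivative_le_exp[OF _ _ _ K p])
      fix t assume t: "t \<in> {-T..T}"
      show "(?D has_vector_derivative F t (exp (K * \<bar>t\<bar>) *\<^sub>R apply_bcontfun z t)
          - F t (exp (K * \<bar>t\<bar>) *\<^sub>R apply_bcontfun w t)) (at t within {-T..T})"
        using Ider[OF t, of z] Ider[OF t, of w]
        by (auto intro!: derivative_eq_intros)
      have "norm (F t (exp (K * \<bar>t\<bar>) *\<^sub>R apply_bcontfun z t) - F t (exp (K * \<bar>t\<bar>) *\<^sub>R apply_bcontfun w t))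
        \<le> L * norm (exp (K * \<bar>t\<bar>) *\<^sub>R apply_bcontfun z t - exp (K * \<bar>t\<bar>) *\<^sub>R apply_bcontfun w t)"
        by (rule lip)
      also have "\<dots> = L * (exp (K * \<bar>t\<bar>) * dist (apply_bcontfun z t) (apply_bcontfun w t))"
        by (simp add: dist_norm flip: scaleR_diff_right)
      also have "\<dots> \<le> L * (exp (K * \<bar>t\<bar>) * dist z w)"
        using L dist_bounded[of z t w] by (intro mult_left_mono) auto
      finally show "norm (F t (exp (K * \<bar>t\<bar>) *\<^sub>R apply_bcontfun z t) - F t (exp (K * \<bar>t\<bar>) *\<^sub>R apply_bcontfun w t))
        \<le> L * dist z w * exp (K * \<bar>t\<bar>)" by (simp add: mult_ac)
    qed simp
    also have "\<dots> = 1/2 * dist z w * exp (K * \<bar>?t\<bar>)" using L by (simp add: K_def)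
    finally have *: "norm (?D ?t) \<le> 1/2 * dist z w * exp (K * \<bar>?t\<bar>)" .
    have "J z x - J w x = exp (- K * \<bar>?t\<bar>) *\<^sub>R ?D ?t"
      by (simp add: J_def algebra_simps)
    then have "dist (J z x) (J w x) = exp (- K * \<bar>?t\<bar>) * norm (?D ?t)"
      by (simp add: dist_norm)
    also have "\<dots> \<le> exp (- K * \<bar>?t\<bar>) * (1/2 * dist z w * exp (K * \<bar>?t\<bar>))"
      using * by (intro mult_left_mono) auto
    also have "\<dots> = 1/2 * dist z w" by (simp add: exp_minus)
    finally show "dist (apply_bcontfun (\<Phi> z) x) (apply_bcontfun (\<Phi> w) x) \<le> 1/2 * dist z w"
      by (simp add: \<Phi>)
  qed
  then obtain z where z: "\<Phi> z = z"
    using banach_fix_type[of "1/2" \<Phi>] by auto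
  define y where "y t = y0 + (I z t - I z 0)" for t
  have zt: "exp (K * \<bar>t\<bar>) *\<^sub>R apply_bcontfun z t = y t" if "t \<in> {-T..T}" for t
  proof -
    have "apply_bcontfun z t = exp (- K * \<bar>t\<bar>) *\<^sub>R y t"
      using \<Phi>[of z] p_id[OF that] by (simp add: z J_def y_def)
    then show ?thesis by (simp add: exp_minus)
  qed
  show thesis
  proof
    show "y 0 = y0" by (simp add: y_def)
    fix t assume t: "t \<in> {-T..T}"
    have "(y has_vector_derivative F t (exp (K * \<bar>t\<bar>) *\<^sub>R apply_bcontfun z t)) (at t within {-T..T})"
      unfolding y_def using Ider[OF t, of z] by (auto intro!: derivative_eq_intros)
    then show "(y has_vector_derivative F t (y t)) (at t within {-T..T})"
      by (simp add: zt[OF t])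
  qed
qed

section \<open>Weighted energy estimate on the lattice\<close>

text \<open>Shifting E by b / c absorbs the constant term; the shifted function times exp (-c t) is
  then nonincreasing.\<close>

lemma gronwall_affine:
  fixes E :: "real \<Rightarrow> real"
  assumes der: "\<And>t. t \<in> {0..T} \<Longrightarrow> (E has_real_derivative E' t) (at t within {0..T})"
    and bnd: "\<And>t. t \<in> {0..T} \<Longrightarrow> E' t \<le> c * E t + b"
    and c: "c > 0" and t: "t \<in> {0..T}"
  shows "E t \<le> (E 0 + b / c) * exp (c * t) - b / c"
proof (cases "t = 0")
  case False
  then have t0: "0 < t" using t by auto
  define \<phi> where "\<phi> s = (E s + b / c) * exp (- c * s)" for s
  have der\<phi>: "(\<phi> has_real_derivative (E' s - c * E s - b) * exp (- c * s)) (at s within {0..T})"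
    if "s \<in> {0..T}" for s
    unfolding \<phi>_def using c
    by (auto intro!: derivative_eq_intros der[OF that] simp: field_simps)
  have "\<phi> t \<le> \<phi> 0"
  proof (rule DERIV_nonpos_imp_decreasing_open[of 0 t \<phi>])
    show "continuous_on {0..t} \<phi>"
      using DERIV_continuous_on[OF der\<phi>] t by (auto intro: continuous_on_subset)
    fix s assume s: "0 < s" "s < t"
    have "(\<phi> has_real_derivative (E' s - c * E s - b) * exp (- c * s)) (at s)"
      using der\<phi>[of s] s t by (simp add: at_within_Icc_at)
    moreover have "(E' s - c * E s - b) * exp (- c * s) \<le> 0"
      using bnd[of s] s t by (intro mult_nonpos_nonneg) auto
    ultimately show "\<exists>y. (\<phi> has_real_derivative y) (at s) \<and> y \<le> 0" by blast
  qed (use t0 in auto)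
  then show ?thesis by (simp add: \<phi>_def exp_minus field_simps)
qed simp

lemma sum_int_telescope:
  fixes P :: "int \<Rightarrow> 'a::ab_group_add"
  assumes "a \<le> b + 1"
  shows "(\<Sum>n\<in>{a..b}. P (n + 1) - P n) = P (b + 1) - P a"
proof -
  have "(\<Sum>n\<in>{a..b - 1}. P (n + 1) - P n) = P b - P a" if "a \<le> b" for b
    using that
  proof (induction b rule: int_ge_induct)
    case (step i)
    then have "{a..i + 1 - 1} = insert i {a..i - 1}" by auto
    then show ?case using step by (simp add: algebra_simps)
  qed simp
  from this[of "b + 1"] assms show ?thesis by simp
qed

text \<open>The fluxes between neighbouring sites telescope up to the variation of the weight.\<close>

lemma weighted_lattice_energy:
  fixes \<eta> \<xi> a a' m R1 R2 :: "real \<Rightarrow> int \<Rightarrow> real" and w :: "int \<Rightarrow> real"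
  assumes d\<eta>: "\<And>t n. t \<in> {0..T} \<Longrightarrow>
      ((\<lambda>t. \<eta> t n) has_real_derivative s * (\<xi> t (n + 1) - \<xi> t n) + R1 t n) (at t within {0..T})"
    and d\<xi>: "\<And>t n. t \<in> {0..T} \<Longrightarrow>
      ((\<lambda>t. \<xi> t n) has_real_derivative s * ((a t n * \<eta> t n - m t n)
         - (a t (n - 1) * \<eta> t (n - 1) - m t (n - 1))) + R2 t n) (at t within {0..T})"
    and da: "\<And>t n. t \<in> {0..T} \<Longrightarrow> ((\<lambda>t. a t n) has_real_derivative a' t n) (at t within {0..T})"
    and s: "\<bar>s\<bar> \<le> 1" and \<kappa>: "0 < \<kappa>" "\<kappa> \<le> 1"
    and a: "\<And>t n. t \<in> {0..T} \<Longrightarrow> 1/2 \<le> a t n \<and> a t n \<le> 1"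
    and a': "\<And>t n. t \<in> {0..T} \<Longrightarrow> \<bar>a' t n\<bar> \<le> \<kappa>"
    and m: "\<And>t n. t \<in> {0..T} \<Longrightarrow> \<bar>m t n\<bar> \<le> \<kappa> * \<bar>\<eta> t n\<bar>"
    and R: "\<And>t F. t \<in> {0..T} \<Longrightarrow> finite F \<Longrightarrow> (\<Sum>n\<in>F. (R1 t n)\<^sup>2 + (R2 t n)\<^sup>2) \<le> \<rho>"
    and M: "\<And>t n. t \<in> {0..T} \<Longrightarrow> \<bar>\<eta> t n\<bar> \<le> M \<and> \<bar>\<xi> t n\<bar> \<le> M"
    and init: "\<And>F. finite F \<Longrightarrow> (\<Sum>n\<in>F. (\<eta> 0 n)\<^sup>2 + (\<xi> 0 n)\<^sup>2) \<le> A"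
    and w: "\<And>n. 0 \<le> w n" "\<And>n. w n \<le> 1" "\<And>n. \<bar>w (n - 1) - w n\<bar> \<le> \<kappa> * w n" "\<And>n. w n \<le> 2 * w (n - 1)"
    and t: "t \<in> {0..T}" and N: "0 \<le> N"
  defines "\<beta> \<equiv> 2 * w N * M\<^sup>2 + 6 * w (- N - 1) * M\<^sup>2"
  shows "(\<Sum>n\<in>{-N..N}. w n * ((\<eta> t n)\<^sup>2 + (\<xi> t n)\<^sup>2)) \<le> 2 * (A + (\<rho> / \<kappa> + \<beta>) / (18 * \<kappa>)) * exp (18 * \<kappa> * t)"
proof -
  \<comment> \<open>The factor \<open>a\<close> on the square of \<eta> is the coefficient that
    multiplies \<eta> in the equation for \<xi>. With it the mixed products a \<eta> \<xi> from both
    equations combine into a difference of fluxes.\<close>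
  define E where "E t = (\<Sum>n\<in>{-N..N}. w n * ((\<xi> t n)\<^sup>2 + a t n * (\<eta> t n)\<^sup>2))" for t
  define \<eta>' where "\<eta>' t n = s * (\<xi> t (n + 1) - \<xi> t n) + R1 t n" for t n
  define \<xi>' where "\<xi>' t n = s * ((a t n * \<eta> t n - m t n) - (a t (n - 1) * \<eta> t (n - 1) - m t (n - 1))) + R2 t n" for t n
  define E' where "E' t = (\<Sum>n\<in>{-N..N}. w n * (2 * \<xi> t n * \<xi>' t n + (a' t n * (\<eta> t n)\<^sup>2 + a t n * (2 * \<eta> t n * \<eta>' t n))))" for t
  have derE: "(E has_real_derivative E' t) (at t within {0..T})" if t: "t \<in> {0..T}" for t
    unfolding E_def E'_def
    by (rule derivative_eq_intros refl d\<eta>[OF t, folded \<eta>'_def] d\<xi>[OF t, folded \<xi>'_def] da[OF t])+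
       (simp add: algebra_simps)
  have S: "(\<Sum>n\<in>{-N..N}. w n * ((\<eta> t n)\<^sup>2 + (\<xi> t n)\<^sup>2)) \<le> 2 * E t" if t: "t \<in> {0..T}" for t
    unfolding E_def sum_distrib_left
  proof (rule sum_mono)
    fix n
    have "(\<eta> t n)\<^sup>2 + (\<xi> t n)\<^sup>2 \<le> 2 * ((\<xi> t n)\<^sup>2 + a t n * (\<eta> t n)\<^sup>2)"
    proof -
      have "1/2 * (\<eta> t n)\<^sup>2 \<le> a t n * (\<eta> t n)\<^sup>2" using a[OF t, of n] by (intro mult_right_mono) auto
      then show ?thesis using zero_le_power2[of "\<xi> t n"] unfolding distrib_left by linarith
    qed
    from mult_left_mono[OF this w(1)[of n]]
    show "w n * ((\<eta> t n)\<^sup>2 + (\<xi> t n)\<^sup>2) \<le> 2 * (w n * ((\<xi> t n)\<^sup>2 + a t n * (\<eta> t n)\<^sup>2))"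
      by (simp add: algebra_simps)
  qed
  have E0: "E 0 \<le> A"
  proof -
    have "E 0 \<le> (\<Sum>n\<in>{-N..N}. (\<eta> 0 n)\<^sup>2 + (\<xi> 0 n)\<^sup>2)"
      unfolding E_def
    proof (rule sum_mono)
      fix n
      have "a 0 n * (\<eta> 0 n)\<^sup>2 \<le> 1 * (\<eta> 0 n)\<^sup>2"
        using a[of 0 n] t by (intro mult_right_mono) auto
      moreover have "0 \<le> a 0 n * (\<eta> 0 n)\<^sup>2" using a[of 0 n] t by auto
      ultimately have "w n * ((\<xi> 0 n)\<^sup>2 + a 0 n * (\<eta> 0 n)\<^sup>2) \<le> 1 * ((\<xi> 0 n)\<^sup>2 + a 0 n * (\<eta> 0 n)\<^sup>2)"
        using w(2)[of n] by (intro mult_right_mono) auto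
      then show "w n * ((\<xi> 0 n)\<^sup>2 + a 0 n * (\<eta> 0 n)\<^sup>2) \<le> (\<eta> 0 n)\<^sup>2 + (\<xi> 0 n)\<^sup>2"
        using \<open>a 0 n * (\<eta> 0 n)\<^sup>2 \<le> 1 * (\<eta> 0 n)\<^sup>2\<close> by simp
    qed
    also have "\<dots> \<le> A" by (rule init) simp
    finally show ?thesis .
  qed
  have bndE: "E' t \<le> (18 * \<kappa>) * E t + (\<rho> / \<kappa> + \<beta>)" if t: "t \<in> {0..T}" for t
  proof -
    \<comment> \<open>\<open>p n\<close> is the energy flux between the sites n - 1 and n. Attaching
      the weight of the left site makes \<open>P (n + 1) - P n\<close> telescope, and what remains
      is \<open>(w (n - 1) - w n) * p n\<close>, controlled by the slow variation of the
      weight.\<close>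
    define p where "p n = a t (n - 1) * \<eta> t (n - 1) * \<xi> t n" for n
    define P where "P n = w (n - 1) * p n" for n
    have p: "\<bar>p n\<bar> \<le> \<bar>\<eta> t (n - 1)\<bar> * \<bar>\<xi> t n\<bar>" for n
    proof -
      have "\<bar>p n\<bar> = a t (n - 1) * (\<bar>\<eta> t (n - 1)\<bar> * \<bar>\<xi> t n\<bar>)"
        using a[OF t, of "n - 1"] by (simp add: p_def abs_mult)
      also have "\<dots> \<le> 1 * (\<bar>\<eta> t (n - 1)\<bar> * \<bar>\<xi> t n\<bar>)"
        using a[OF t, of "n - 1"] by (intro mult_right_mono) auto
      finally show ?thesis by simp
    qed
    have PM: "\<bar>P n\<bar> \<le> w (n - 1) * M\<^sup>2" for n
    proof -
      have "\<bar>\<eta> t (n - 1)\<bar> * \<bar>\<xi> t n\<bar> \<le> M * M"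
        using M[OF t, of "n - 1"] M[OF t, of n] by (intro mult_mono) auto
      then have "\<bar>p n\<bar> \<le> M\<^sup>2" using p[of n] by (simp add: power2_eq_square)
      then show ?thesis using w(1)[of "n - 1"] by (simp add: P_def abs_mult mult_left_mono)
    qed
    have key: "w n * (2 * \<xi> t n * \<xi>' t n + (a' t n * (\<eta> t n)\<^sup>2 + a t n * (2 * \<eta> t n * \<eta>' t n)))
       \<le> 2 * s * (P (n + 1) - P n)
         + \<kappa> * (5 * (w n * (\<xi> t n)\<^sup>2) + 3 * (w n * (\<eta> t n)\<^sup>2) + 4 * (w (n - 1) * (\<eta> t (n - 1))\<^sup>2))
         + ((R1 t n)\<^sup>2 + (R2 t n)\<^sup>2) / \<kappa>" for n
    proof -
      let ?x = "\<xi> t n" and ?h = "\<eta> t n" and ?g = "\<eta> t (n - 1)"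
      have w': "w n * ?g\<^sup>2 \<le> 2 * (w (n - 1) * ?g\<^sup>2)"
        using mult_right_mono[OF w(4)[of n], of "?g\<^sup>2"] by simp
      have am: "2 * (\<bar>x\<bar> * \<bar>y\<bar>) \<le> x\<^sup>2 + y\<^sup>2" for x y :: real
        using sum_squares_bound[of "\<bar>x\<bar>" "\<bar>y\<bar>"] by simp
      \<comment> \<open>Young's inequality with parameter \<kappa>: a residual costs as much energy
        growth as the other terms plus its square divided by \<kappa>. Gronwall divides by \<kappa>
        once more, hence the \<rho> / \<kappa>^2 in the final bound.\<close>
      have amk: "2 * x * y \<le> \<kappa> * x\<^sup>2 + y\<^sup>2 / \<kappa>" for x y :: real
      proof -
        have "0 \<le> (\<kappa> * x - y)\<^sup>2 / \<kappa>" using \<kappa> by simp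
        also have "\<dots> = \<kappa> * x\<^sup>2 + y\<^sup>2 / \<kappa> - 2 * x * y"
          using \<kappa> by (simp add: power2_eq_square field_simps)
        finally show ?thesis by simp
      qed
      have eq: "w n * (2 * ?x * \<xi>' t n + (a' t n * ?h\<^sup>2 + a t n * (2 * ?h * \<eta>' t n)))
        = 2 * s * (P (n + 1) - P n) + 2 * (s * (w (n - 1) - w n) * p n)
          + w n * (s * (2 * ?x * (m t (n - 1) - m t n)))
          + w n * (2 * ?x * R2 t n) + w n * (a t n * (2 * ?h * R1 t n)) + w n * (a' t n * ?h\<^sup>2)"
        unfolding \<xi>'_def \<eta>'_def P_def p_def by (simp add: algebra_simps)
      have b1: "2 * (s * (w (n - 1) - w n) * p n) \<le> \<kappa> * (2 * (w (n - 1) * ?g\<^sup>2) + w n * ?x\<^sup>2)"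
      proof -
        have "s * (w (n - 1) - w n) * p n \<le> \<bar>s\<bar> * \<bar>w (n - 1) - w n\<bar> * \<bar>p n\<bar>"
          by (metis abs_ge_self abs_mult)
        also have "\<dots> \<le> 1 * (\<kappa> * w n) * (\<bar>?g\<bar> * \<bar>?x\<bar>)"
          using s w(3)[of n] p[of n] w(1)[of n] \<kappa> by (intro mult_mono) auto
        finally have "2 * (s * (w (n - 1) - w n) * p n) \<le> \<kappa> * (w n * (2 * (\<bar>?g\<bar> * \<bar>?x\<bar>)))" by simp
        also have "\<dots> \<le> \<kappa> * (w n * (?g\<^sup>2 + ?x\<^sup>2))"
          using am[of ?g ?x] w(1)[of n] \<kappa> by (intro mult_left_mono) auto
        also have "\<dots> \<le> \<kappa> * (2 * (w (n - 1) * ?g\<^sup>2) + w n * ?x\<^sup>2)"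
          using w' \<kappa> by (intro mult_left_mono) (auto simp: algebra_simps)
        finally show ?thesis .
      qed
      have b2: "w n * (s * (2 * ?x * (m t (n - 1) - m t n)))
          \<le> \<kappa> * (2 * (w n * ?x\<^sup>2) + 2 * (w (n - 1) * ?g\<^sup>2) + w n * ?h\<^sup>2)"
      proof -
        have "s * (2 * ?x * (m t (n - 1) - m t n)) \<le> \<bar>s\<bar> * (2 * \<bar>?x\<bar> * \<bar>m t (n - 1) - m t n\<bar>)"
          by (rule order_trans[OF abs_ge_self]) (simp add: abs_mult)
        also have "\<dots> \<le> 1 * (2 * \<bar>?x\<bar> * (\<kappa> * \<bar>?g\<bar> + \<kappa> * \<bar>?h\<bar>))"
          using s m[OF t, of n] m[OF t, of "n - 1"] by (intro mult_mono) auto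
        also have "\<dots> = \<kappa> * (2 * (\<bar>?x\<bar> * \<bar>?g\<bar>) + 2 * (\<bar>?x\<bar> * \<bar>?h\<bar>))" by (simp add: algebra_simps)
        also have "\<dots> \<le> \<kappa> * ((?x\<^sup>2 + ?g\<^sup>2) + (?x\<^sup>2 + ?h\<^sup>2))"
          using am[of ?x ?g] am[of ?x ?h] \<kappa> by (intro mult_left_mono add_mono) auto
        finally have "w n * (s * (2 * ?x * (m t (n - 1) - m t n))) \<le> w n * (\<kappa> * ((?x\<^sup>2 + ?g\<^sup>2) + (?x\<^sup>2 + ?h\<^sup>2)))"
          using w(1)[of n] by (intro mult_left_mono) auto
        also have "\<dots> = \<kappa> * (2 * (w n * ?x\<^sup>2) + w n * ?g\<^sup>2 + w n * ?h\<^sup>2)" by (simp add: algebra_simps)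
        also have "\<dots> \<le> \<kappa> * (2 * (w n * ?x\<^sup>2) + 2 * (w (n - 1) * ?g\<^sup>2) + w n * ?h\<^sup>2)"
          using w' \<kappa> by (intro mult_left_mono) auto
        finally show ?thesis .
      qed
      have b3: "w n * (2 * ?x * R2 t n) \<le> \<kappa> * (w n * ?x\<^sup>2) + (R2 t n)\<^sup>2 / \<kappa>"
      proof -
        have "w n * (2 * ?x * R2 t n) \<le> w n * (\<kappa> * ?x\<^sup>2 + (R2 t n)\<^sup>2 / \<kappa>)"
          using amk[of ?x "R2 t n"] w(1)[of n] by (intro mult_left_mono) auto
        moreover have "w n * ((R2 t n)\<^sup>2 / \<kappa>) \<le> 1 * ((R2 t n)\<^sup>2 / \<kappa>)"
          using w(2)[of n] \<kappa> by (intro mult_right_mono) auto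
        ultimately show ?thesis by (simp add: algebra_simps)
      qed
      have b4: "w n * (a t n * (2 * ?h * R1 t n)) \<le> \<kappa> * (w n * ?h\<^sup>2) + (R1 t n)\<^sup>2 / \<kappa>"
      proof -
        have "a t n * (2 * ?h * R1 t n) = 2 * ?h * (a t n * R1 t n)" by simp
        also have "\<dots> \<le> \<kappa> * ?h\<^sup>2 + (a t n * R1 t n)\<^sup>2 / \<kappa>" by (rule amk)
        also have "(a t n * R1 t n)\<^sup>2 \<le> (R1 t n)\<^sup>2"
          using a[OF t, of n] power_le_one[of "a t n" 2] by (simp add: power_mult_distrib mult_left_le_one_le)
        finally have "w n * (a t n * (2 * ?h * R1 t n)) \<le> w n * (\<kappa> * ?h\<^sup>2 + (R1 t n)\<^sup>2 / \<kappa>)"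
          using w(1)[of n] \<kappa> by (intro mult_left_mono) (auto simp: divide_right_mono)
        moreover have "w n * ((R1 t n)\<^sup>2 / \<kappa>) \<le> 1 * ((R1 t n)\<^sup>2 / \<kappa>)"
          using w(2)[of n] \<kappa> by (intro mult_right_mono) auto
        ultimately show ?thesis by (simp add: algebra_simps)
      qed
      have b5: "w n * (a' t n * ?h\<^sup>2) \<le> \<kappa> * (w n * ?h\<^sup>2)"
      proof -
        have "a' t n * ?h\<^sup>2 \<le> \<kappa> * ?h\<^sup>2" using a'[OF t, of n] by (intro mult_right_mono) auto
        from mult_left_mono[OF this w(1)[of n]] show ?thesis by (simp add: algebra_simps)
      qed
      define A1 where "A1 = \<kappa> * (w n * ?x\<^sup>2)"
      define A2 where "A2 = \<kappa> * (w n * ?h\<^sup>2)"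
      define A3 where "A3 = \<kappa> * (w (n - 1) * ?g\<^sup>2)"
      have A1: "0 \<le> A1" using \<kappa> w(1)[of n] by (simp add: A1_def)
      have e1: "\<kappa> * (2 * (w (n - 1) * ?g\<^sup>2) + w n * ?x\<^sup>2) = 2 * A3 + A1"
        and e2: "\<kappa> * (2 * (w n * ?x\<^sup>2) + 2 * (w (n - 1) * ?g\<^sup>2) + w n * ?h\<^sup>2) = 2 * A1 + 2 * A3 + A2"
        and e3: "\<kappa> * (5 * (w n * ?x\<^sup>2) + 3 * (w n * ?h\<^sup>2) + 4 * (w (n - 1) * ?g\<^sup>2)) = 5 * A1 + 3 * A2 + 4 * A3"
        by (simp_all add: A1_def A2_def A3_def distrib_left mult.left_commute)
      show ?thesis
        unfolding eq e3 add_divide_distrib using b1[unfolded e1] b2[unfolded e2] b3[folded A1_def] b4[folded A2_def] b5[folded A2_def] A1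
        by linarith
    qed
    have "E' t \<le> (\<Sum>n\<in>{-N..N}. 2 * s * (P (n + 1) - P n)
         + \<kappa> * (5 * (w n * (\<xi> t n)\<^sup>2) + 3 * (w n * (\<eta> t n)\<^sup>2) + 4 * (w (n - 1) * (\<eta> t (n - 1))\<^sup>2))
         + ((R1 t n)\<^sup>2 + (R2 t n)\<^sup>2) / \<kappa>)"
      unfolding E'_def by (rule sum_mono) (rule key)
    also have "\<dots> = 2 * s * (\<Sum>n\<in>{-N..N}. P (n + 1) - P n)
         + \<kappa> * (5 * (\<Sum>n\<in>{-N..N}. w n * (\<xi> t n)\<^sup>2) + 3 * (\<Sum>n\<in>{-N..N}. w n * (\<eta> t n)\<^sup>2)
               + 4 * (\<Sum>n\<in>{-N..N}. w (n - 1) * (\<eta> t (n - 1))\<^sup>2))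
         + (\<Sum>n\<in>{-N..N}. (R1 t n)\<^sup>2 + (R2 t n)\<^sup>2) / \<kappa>"
      by (simp add: sum.distrib flip: sum_distrib_left sum_divide_distrib)
    also have "\<dots> \<le> (2 * w N * M\<^sup>2 + 2 * w (- N - 1) * M\<^sup>2)
         + (\<kappa> * (5 * (\<Sum>n\<in>{-N..N}. w n * (\<xi> t n)\<^sup>2) + 7 * (\<Sum>n\<in>{-N..N}. w n * (\<eta> t n)\<^sup>2))
            + 4 * w (- N - 1) * M\<^sup>2)
         + \<rho> / \<kappa>"
    proof (intro add_mono)
      have "\<bar>P (N + 1)\<bar> \<le> w N * M\<^sup>2" "\<bar>P (-N)\<bar> \<le> w (- N - 1) * M\<^sup>2"
        using PM[of "N + 1"] PM[of "- N"] by simp_all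
      then have "\<bar>P (N + 1) - P (- N)\<bar> \<le> w N * M\<^sup>2 + w (- N - 1) * M\<^sup>2" by linarith
      then have "\<bar>s\<bar> * \<bar>P (N + 1) - P (- N)\<bar> \<le> 1 * (w N * M\<^sup>2 + w (- N - 1) * M\<^sup>2)"
        using s by (intro mult_mono) auto
      moreover have "s * (P (N + 1) - P (- N)) \<le> \<bar>s\<bar> * \<bar>P (N + 1) - P (- N)\<bar>"
        by (metis abs_ge_self abs_mult)
      moreover have "(\<Sum>n\<in>{-N..N}. P (n + 1) - P n) = P (N + 1) - P (- N)"
        by (rule sum_int_telescope) (use N in simp)
      ultimately show "2 * s * (\<Sum>n\<in>{-N..N}. P (n + 1) - P n) \<le> 2 * w N * M\<^sup>2 + 2 * w (- N - 1) * M\<^sup>2"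
        by simp
    next
      \<comment> \<open>The shifted sum reaches one site outside the window. Its contribution 4 and
        the flux 2 through the left end make up the 6 in \<open>\<beta>\<close>.\<close>
      have "(\<Sum>n\<in>{-N..N}. w (n - 1) * (\<eta> t (n - 1))\<^sup>2) = (\<Sum>n\<in>{-N-1..N-1}. w n * (\<eta> t n)\<^sup>2)"
        by (rule sum.reindex_bij_witness[of _ "\<lambda>n. n + 1" "\<lambda>n. n - 1"]) auto
      also have "\<dots> \<le> (\<Sum>n\<in>insert (-N-1) {-N..N}. w n * (\<eta> t n)\<^sup>2)"
        by (rule sum_mono2) (use w(1) in auto)
      also have "\<dots> = w (-N-1) * (\<eta> t (-N-1))\<^sup>2 + (\<Sum>n\<in>{-N..N}. w n * (\<eta> t n)\<^sup>2)"
        by (subst sum.insert) auto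
      also have "w (-N-1) * (\<eta> t (-N-1))\<^sup>2 \<le> w (-N-1) * M\<^sup>2"
      proof -
        have "\<bar>\<eta> t (-N-1)\<bar>\<^sup>2 \<le> M\<^sup>2" using M[OF t, of "-N-1"] by (intro power_mono) auto
        then show ?thesis using w(1)[of "-N-1"] by (intro mult_left_mono) auto
      qed
      finally have *: "(\<Sum>n\<in>{-N..N}. w (n - 1) * (\<eta> t (n - 1))\<^sup>2)
          \<le> w (-N-1) * M\<^sup>2 + (\<Sum>n\<in>{-N..N}. w n * (\<eta> t n)\<^sup>2)" by simp
      have "\<kappa> * (w (-N-1) * M\<^sup>2) \<le> 1 * (w (-N-1) * M\<^sup>2)"
        using \<kappa> w(1)[of "-N-1"] by (intro mult_right_mono) auto
      with mult_left_mono[OF *, of \<kappa>] \<kappa>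
      show "\<kappa> * (5 * (\<Sum>n\<in>{-N..N}. w n * (\<xi> t n)\<^sup>2) + 3 * (\<Sum>n\<in>{-N..N}. w n * (\<eta> t n)\<^sup>2)
               + 4 * (\<Sum>n\<in>{-N..N}. w (n - 1) * (\<eta> t (n - 1))\<^sup>2))
        \<le> \<kappa> * (5 * (\<Sum>n\<in>{-N..N}. w n * (\<xi> t n)\<^sup>2) + 7 * (\<Sum>n\<in>{-N..N}. w n * (\<eta> t n)\<^sup>2))
            + 4 * w (- N - 1) * M\<^sup>2"
        by (simp add: algebra_simps)
    next
      show "(\<Sum>n\<in>{-N..N}. (R1 t n)\<^sup>2 + (R2 t n)\<^sup>2) / \<kappa> \<le> \<rho> / \<kappa>"
        using R[OF t, of "{-N..N}"] \<kappa> by (intro divide_right_mono) auto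
    qed
    also have "\<dots> = \<kappa> * (5 * (\<Sum>n\<in>{-N..N}. w n * (\<xi> t n)\<^sup>2) + 7 * (\<Sum>n\<in>{-N..N}. w n * (\<eta> t n)\<^sup>2)) + (\<rho> / \<kappa> + \<beta>)"
      by (simp add: \<beta>_def)
    \<comment> \<open>Both coefficients are majorised by 9, and a \<ge> 1/2 bounds the plain square
      sum by 2 E; this is the origin of the rate 18 \<kappa>.\<close>
    also have "\<kappa> * (5 * (\<Sum>n\<in>{-N..N}. w n * (\<xi> t n)\<^sup>2) + 7 * (\<Sum>n\<in>{-N..N}. w n * (\<eta> t n)\<^sup>2))
       \<le> \<kappa> * (9 * (\<Sum>n\<in>{-N..N}. w n * ((\<eta> t n)\<^sup>2 + (\<xi> t n)\<^sup>2)))"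
    proof -
      have "0 \<le> (\<Sum>n\<in>{-N..N}. w n * (\<xi> t n)\<^sup>2)" "0 \<le> (\<Sum>n\<in>{-N..N}. w n * (\<eta> t n)\<^sup>2)"
        by (intro sum_nonneg mult_nonneg_nonneg w(1) zero_le_power2)+
      then show ?thesis using \<kappa> by (intro mult_left_mono) (auto simp: distrib_left sum.distrib)
    qed
    also have "\<dots> \<le> \<kappa> * (9 * (2 * E t))"
      using S[OF t] \<kappa> by (intro mult_left_mono) auto
    finally show ?thesis by simp
  qed
  have "E t \<le> (E 0 + (\<rho> / \<kappa> + \<beta>) / (18 * \<kappa>)) * exp (18 * \<kappa> * t) - (\<rho> / \<kappa> + \<beta>) / (18 * \<kappa>)"
    by (rule gronwall_affine[OF derE bndE _ t]) (use \<kappa> in auto)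
  also have "\<dots> \<le> (A + (\<rho> / \<kappa> + \<beta>) / (18 * \<kappa>)) * exp (18 * \<kappa> * t)"
  proof -
    have "0 \<le> \<rho>" using R[OF t, of "{}"] by simp
    then have "0 \<le> \<rho> / \<kappa> + \<beta>" unfolding \<beta>_def using \<kappa> w(1) by simp
    then have "0 \<le> (\<rho> / \<kappa> + \<beta>) / (18 * \<kappa>)" using \<kappa> by simp
    moreover have "(E 0 + (\<rho> / \<kappa> + \<beta>) / (18 * \<kappa>)) * exp (18 * \<kappa> * t) \<le> (A + (\<rho> / \<kappa> + \<beta>) / (18 * \<kappa>)) * exp (18 * \<kappa> * t)"
      using E0 by (intro mult_right_mono) auto
    ultimately show ?thesis by linarith
  qed
  finally show ?thesis using S[OF t] unfolding mult.assoc[of 2] by linarith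
qed

text \<open>Boundedness by M is all that is known about the size of the errors at infinity. In the
  weighted window estimate the boundary terms are M^2 times the weights at the two ends, and these
  vanish for a geometric weight when the window grows. Only afterwards is the weight sent to one.
  The order of the two limits matters: for the constant weight the boundary terms would not
  disappear.\<close>

lemma lattice_energy:
  fixes \<eta> \<xi> a a' m R1 R2 :: "real \<Rightarrow> int \<Rightarrow> real"
  assumes d\<eta>: "\<And>t n. t \<in> {0..T} \<Longrightarrow>
      ((\<lambda>t. \<eta> t n) has_real_derivative s * (\<xi> t (n + 1) - \<xi> t n) + R1 t n) (at t within {0..T})"
    and d\<xi>: "\<And>t n. t \<in> {0..T} \<Longrightarrow>
      ((\<lambda>t. \<xi> t n) has_real_derivative s * ((a t n * \<eta> t n - m t n)
         - (a t (n - 1) * \<eta> t (n - 1) - m t (n - 1))) + R2 t n) (at t within {0..T})"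
    and da: "\<And>t n. t \<in> {0..T} \<Longrightarrow> ((\<lambda>t. a t n) has_real_derivative a' t n) (at t within {0..T})"
    and s: "\<bar>s\<bar> \<le> 1" and \<kappa>: "0 < \<kappa>" "\<kappa> \<le> 1"
    and a: "\<And>t n. t \<in> {0..T} \<Longrightarrow> 1/2 \<le> a t n \<and> a t n \<le> 1"
    and a': "\<And>t n. t \<in> {0..T} \<Longrightarrow> \<bar>a' t n\<bar> \<le> \<kappa>"
    and m: "\<And>t n. t \<in> {0..T} \<Longrightarrow> \<bar>m t n\<bar> \<le> \<kappa> * \<bar>\<eta> t n\<bar>"
    and R: "\<And>t F. t \<in> {0..T} \<Longrightarrow> finite F \<Longrightarrow> (\<Sum>n\<in>F. (R1 t n)\<^sup>2 + (R2 t n)\<^sup>2) \<le> \<rho>"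
    and M: "\<And>t n. t \<in> {0..T} \<Longrightarrow> \<bar>\<eta> t n\<bar> \<le> M \<and> \<bar>\<xi> t n\<bar> \<le> M"
    and init: "\<And>F. finite F \<Longrightarrow> (\<Sum>n\<in>F. (\<eta> 0 n)\<^sup>2 + (\<xi> 0 n)\<^sup>2) \<le> A"
    and t: "t \<in> {0..T}" and F: "finite F"
  shows "(\<Sum>n\<in>F. (\<eta> t n)\<^sup>2 + (\<xi> t n)\<^sup>2) \<le> 2 * (A + \<rho> / (18 * \<kappa>\<^sup>2)) * exp (18 * \<kappa> * t)"
proof -
  define Z where "Z = (\<lambda>n. (\<eta> t n)\<^sup>2 + (\<xi> t n)\<^sup>2)"
  have Z0: "0 \<le> Z n" for n by (simp add: Z_def)
  obtain N0 :: int where N0: "0 \<le> N0" "F \<subseteq> {-N0..N0}"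
  proof -
    have "bdd_above (abs ` F)" using F by simp
    then obtain b where "\<And>n. n \<in> F \<Longrightarrow> \<bar>n\<bar> \<le> b" by (auto simp: bdd_above_def)
    then have "F \<subseteq> {-max 0 b..max 0 b}" by fastforce
    then show thesis using that[of "max 0 b"] by auto
  qed
  have \<theta>_bound: "(\<Sum>n\<in>F. \<theta> ^ nat \<bar>n\<bar> * Z n) \<le> 2 * (A + \<rho> / (18 * \<kappa>\<^sup>2)) * exp (18 * \<kappa> * t)"
    if \<theta>: "1 / (1 + \<kappa>) \<le> \<theta>" "\<theta> < 1" for \<theta>
  proof -
    \<comment> \<open>The lower bound 1 / (1 + \<kappa>) on \<theta> lets neighbouring weights
      differ by a factor of at most 1 + \<kappa>, so that the variation of the weight is no worse
      than the other terms of the estimate.\<close>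
    define w where "w n = \<theta> ^ nat \<bar>n\<bar>" for n :: int
    have pos: "0 < \<theta>" using \<theta>(1) \<kappa> by (smt (verit) divide_pos_pos)
    have kk: "1 \<le> \<theta> * (1 + \<kappa>)" using \<theta>(1) \<kappa> by (simp add: field_simps)
    have w0: "0 \<le> w n" for n using pos by (simp add: w_def)
    have w1: "w n \<le> 1" for n using pos \<theta>(2) by (simp add: w_def power_le_one)
    have step: "w n \<le> (1 + \<kappa>) * w k" "w k \<le> (1 + \<kappa>) * w n" if "k = n - 1" for n k
    proof -
      have aux: "\<theta> ^ Suc j \<le> (1 + \<kappa>) * \<theta> ^ j" "\<theta> ^ j \<le> (1 + \<kappa>) * \<theta> ^ Suc j" for j
      proof -
        have "\<theta> * \<theta> ^ j \<le> (1 + \<kappa>) * \<theta> ^ j" using \<theta>(2) pos \<kappa> by (intro mult_right_mono) auto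
        then show "\<theta> ^ Suc j \<le> (1 + \<kappa>) * \<theta> ^ j" by simp
        show "\<theta> ^ j \<le> (1 + \<kappa>) * \<theta> ^ Suc j"
          using mult_right_mono[OF kk, of "\<theta> ^ j"] pos by (simp add: mult_ac)
      qed
      consider "n \<ge> 1" "nat \<bar>n\<bar> = Suc (nat \<bar>k\<bar>)" | "n < 1" "nat \<bar>k\<bar> = Suc (nat \<bar>n\<bar>)"
        using \<open>k = n - 1\<close> by (cases "n \<ge> 1") auto
      then show "w n \<le> (1 + \<kappa>) * w k" "w k \<le> (1 + \<kappa>) * w n"
        unfolding w_def using aux by (cases; simp)+
    qed
    have wd: "\<bar>w (n - 1) - w n\<bar> \<le> \<kappa> * w n" for n
    proof -
      have "w n \<le> (1 + \<kappa>) * w (n - 1)" "w (n - 1) \<le> (1 + \<kappa>) * w n"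
        by (rule step; simp)+
      moreover have "\<kappa> * w (n - 1) \<le> \<kappa> * w n" if "w (n - 1) \<le> w n"
        using that \<kappa> by (intro mult_left_mono) auto
      moreover have "0 \<le> \<kappa> * w n" using \<kappa> w0 by simp
      ultimately show ?thesis by (auto simp: abs_if algebra_simps)
    qed
    have w2: "w n \<le> 2 * w (n - 1)" for n
    proof -
      have "w n \<le> (1 + \<kappa>) * w (n - 1)" by (rule step) simp
      also have "\<dots> \<le> 2 * w (n - 1)" using w0 \<kappa> by (intro mult_right_mono) auto
      finally show ?thesis .
    qed
    define \<beta> where "\<beta> N = 2 * w (int N) * M\<^sup>2 + 6 * w (- int N - 1) * M\<^sup>2" for N :: nat
    have "(\<Sum>n\<in>F. w n * Z n) \<le> 2 * (A + (\<rho> / \<kappa> + \<beta> N) / (18 * \<kappa>)) * exp (18 * \<kappa> * t)"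
      if N: "N \<ge> nat N0" for N
    proof -
      have "(\<Sum>n\<in>F. w n * Z n) \<le> (\<Sum>n\<in>{- int N..int N}. w n * Z n)"
        by (rule sum_mono2) (use N0 N w0 Z0 in \<open>force+\<close>)
      also have "\<dots> \<le> 2 * (A + (\<rho> / \<kappa> + \<beta> N) / (18 * \<kappa>)) * exp (18 * \<kappa> * t)"
        unfolding Z_def \<beta>_def
        by (rule weighted_lattice_energy[where \<eta> = \<eta> and \<xi> = \<xi> and w = w and a = a and a' = a' and m = m and s = s and ?R1.0 = R1 and ?R2.0 = R2,
              OF d\<eta> d\<xi> da s \<kappa> a a' m R M init w0 w1 wd w2 t]) auto
      finally show ?thesis .
    qed
    then have "eventually (\<lambda>N. (\<Sum>n\<in>F. w n * Z n) \<le> 2 * (A + (\<rho> / \<kappa> + \<beta> N) / (18 * \<kappa>)) * exp (18 * \<kappa> * t)) sequentially"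
      using eventually_sequentially by blast
    moreover have "(\<lambda>N. 2 * (A + (\<rho> / \<kappa> + \<beta> N) / (18 * \<kappa>)) * exp (18 * \<kappa> * t))
        \<longlonglongrightarrow> 2 * (A + (\<rho> / \<kappa> + 0) / (18 * \<kappa>)) * exp (18 * \<kappa> * t)"
    proof -
      have p: "(\<lambda>N. \<theta> ^ N) \<longlonglongrightarrow> 0" using pos \<theta>(2) by (intro LIMSEQ_realpow_zero) auto
      have [simp]: "w (int N) = \<theta> ^ N" for N by (simp add: w_def)
      have [simp]: "w (- int N - 1) = \<theta> ^ Suc N" for N
      proof -
        have "nat \<bar>- int N - 1\<bar> = Suc N" by simp
        then show ?thesis by (simp only: w_def)
      qed
      have "(\<lambda>N. 2 * \<theta> ^ N * M\<^sup>2 + 6 * \<theta> ^ Suc N * M\<^sup>2) \<longlonglongrightarrow> 2 * 0 * M\<^sup>2 + 6 * 0 * M\<^sup>2"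
        by (intro tendsto_add tendsto_mult tendsto_const p LIMSEQ_Suc[OF p])
      then have "\<beta> \<longlonglongrightarrow> 0" unfolding \<beta>_def by simp
      then show ?thesis by (intro tendsto_intros) (use \<kappa> in auto)
    qed
    ultimately have "(\<Sum>n\<in>F. w n * Z n) \<le> 2 * (A + (\<rho> / \<kappa> + 0) / (18 * \<kappa>)) * exp (18 * \<kappa> * t)"
      by (intro tendsto_lowerbound) auto
    then show ?thesis by (simp add: w_def power2_eq_square field_simps)
  qed
  \<comment> \<open>The right-hand side is free of \<theta> and F is finite, so the bound passes to
    \<theta> = 1.\<close>
  have "((\<lambda>\<theta>. \<Sum>n\<in>F. \<theta> ^ nat \<bar>n\<bar> * Z n) \<longlongrightarrow> (\<Sum>n\<in>F. 1 ^ nat \<bar>n\<bar> * Z n)) (at_left 1)"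
    by (intro tendsto_intros)
  moreover have "eventually (\<lambda>\<theta>. (\<Sum>n\<in>F. \<theta> ^ nat \<bar>n\<bar> * Z n) \<le> 2 * (A + \<rho> / (18 * \<kappa>\<^sup>2)) * exp (18 * \<kappa> * t)) (at_left 1)"
  proof -
    have "1 / (1 + \<kappa>) < 1" using \<kappa> by simp
    then have "eventually (\<lambda>\<theta>. \<theta> \<in> {1 / (1 + \<kappa>)<..<1}) (at_left 1)"
      by (rule eventually_at_left_real)
    then show ?thesis by eventually_elim (use \<theta>_bound in auto)
  qed
  ultimately show ?thesis unfolding Z_def[symmetric]
    by (intro tendsto_upperbound[where F = "at_left (1::real)"]) (auto simp: Z_def)
qed

section \<open>Functions with square integrable derivatives\<close>

text \<open>The working form of \<open>weak_top\<close>: \<phi> is a primitive of the square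
  integrable function h. All estimates are proved for such a pair and then applied to each
  derivative of a function in X^k.\<close>

lemma weak_top_1:
  "weak_top (Suc 0) \<phi> h \<longleftrightarrow> h \<in> borel_measurable lborel \<and> integrable lborel (\<lambda>x. (h x)\<^sup>2) \<and>
     (\<forall>a b. a \<le> b \<longrightarrow> set_integrable lborel {a..b} h \<and> \<phi> b - \<phi> a = (LINT x:{a..b}|lborel. h x))"
  by (simp add: weak_top_def)

lemma weak_top_iff: "weak_top (Suc k) g h \<longleftrightarrow> weak_top (Suc 0) ((deriv ^^ k) g) h"
  by (simp add: weak_top_def)

lemma integrable_imp_set_integrable_Icc:
  fixes \<psi> :: "real \<Rightarrow> real"
  assumes "integrable lborel \<psi>"
  shows "set_integrable lborel {a..b} \<psi>"
  unfolding set_integrable_def using assms by (intro integrable_mult_indicator) auto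

lemma set_integrable_const_Icc: "set_integrable lborel {a..b::real} (\<lambda>x. c::real)"
  by (rule borel_integrable_atLeastAtMost') (rule continuous_on_const)

text \<open>Cauchy-Schwarz against the constant function, obtained from the nonnegativity of the
  variance: c is the mean of h over the interval.\<close>

lemma set_integral_square_le:
  fixes h :: "real \<Rightarrow> real"
  assumes ab: "a < b" and h: "set_integrable lborel {a..b} h"
    and h2: "set_integrable lborel {a..b} (\<lambda>x. (h x)\<^sup>2)"
  shows "(LINT x:{a..b}|lborel. h x)\<^sup>2 \<le> (b - a) * (LINT x:{a..b}|lborel. (h x)\<^sup>2)"
proof -
  define J where "J = (LINT x:{a..b}|lborel. h x)"
  define c where "c = J / (b - a)"
  have c1: "set_integrable lborel {a..b} (\<lambda>x. c\<^sup>2)"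
    by (rule set_integrable_const_Icc)
  have i: "(LINT x:{a..b}|lborel. c\<^sup>2) = c\<^sup>2 * (b - a)"
    using ab by (simp add: set_lebesgue_integral_def)
  have "0 \<le> (LINT x:{a..b}|lborel. (h x - c)\<^sup>2)"
    unfolding set_lebesgue_integral_def by (intro integral_nonneg_AE) auto
  also have "\<dots> = (LINT x:{a..b}|lborel. ((h x)\<^sup>2 - 2 * c * h x) + c\<^sup>2)"
    by (simp add: power2_diff algebra_simps)
  also have "\<dots> = (LINT x:{a..b}|lborel. (h x)\<^sup>2) - 2 * c * J + c\<^sup>2 * (b - a)"
    using h h2 c1 by (simp add: i set_integral_add set_integral_diff J_def)
  finally have "0 \<le> (b - a) * ((LINT x:{a..b}|lborel. (h x)\<^sup>2) - 2 * c * J + c\<^sup>2 * (b - a))"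
    using ab by simp
  also have "\<dots> = (b - a) * (LINT x:{a..b}|lborel. (h x)\<^sup>2) - 2 * (c * (b - a)) * J + (c * (b - a))\<^sup>2"
    by (simp add: algebra_simps power2_eq_square)
  also have "c * (b - a) = J" using ab by (simp add: c_def)
  finally show ?thesis by (simp add: J_def power2_eq_square)
qed

lemma set_integral_mono_set_Icc:
  fixes \<psi> :: "real \<Rightarrow> real"
  assumes "integrable lborel \<psi>" "\<And>x. 0 \<le> \<psi> x" "a \<le> x" "y \<le> b"
  shows "(LINT x:{x..y}|lborel. \<psi> x) \<le> (LINT x:{a..b}|lborel. \<psi> x)"
  using integrable_imp_set_integrable_Icc[OF assms(1), of x y] integrable_imp_set_integrable_Icc[OF assms(1), of a b] assms
  unfolding set_lebesgue_integral_def set_integrable_def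
  by (intro integral_mono) (auto split: split_indicator)

lemma weak_top_holder:
  assumes wt: "weak_top (Suc 0) \<phi> h" and xy: "x \<in> {a..b}" "y \<in> {a..b}"
  shows "(\<phi> y - \<phi> x)\<^sup>2 \<le> (b - a) * (LINT x:{a..b}|lborel. (h x)\<^sup>2)"
proof -
  have h2: "integrable lborel (\<lambda>x. (h x)\<^sup>2)" using wt by (simp add: weak_top_1)
  have *: "(\<phi> y - \<phi> x)\<^sup>2 \<le> (b - a) * (LINT x:{a..b}|lborel. (h x)\<^sup>2)"
    if "a \<le> x" "x < y" "y \<le> b" for x y
  proof -
    have "(\<phi> y - \<phi> x)\<^sup>2 = (LINT x:{x..y}|lborel. h x)\<^sup>2"
      using wt that by (simp add: weak_top_1)
    also have "\<dots> \<le> (y - x) * (LINT x:{x..y}|lborel. (h x)\<^sup>2)"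
      using wt that by (intro set_integral_square_le integrable_imp_set_integrable_Icc[OF h2]) (auto simp: weak_top_1)
    also have "\<dots> \<le> (b - a) * (LINT x:{a..b}|lborel. (h x)\<^sup>2)"
    proof (intro mult_mono set_integral_mono_set_Icc[OF h2])
      show "0 \<le> (LINT x:{x..y}|lborel. (h x)\<^sup>2)"
        unfolding set_lebesgue_integral_def by (intro integral_nonneg_AE) auto
    qed (use that in auto)
    finally show ?thesis .
  qed
  show ?thesis
  proof (cases x y rule: linorder_cases)
    case equal
    have "0 \<le> (LINT x:{a..b}|lborel. (h x)\<^sup>2)"
      unfolding set_lebesgue_integral_def by (intro integral_nonneg_AE) auto
    then show ?thesis using equal xy by simp
  qed (use *[of x y] *[of y x] xy in \<open>auto simp: power2_commute\<close>)
qed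

text \<open>The one-dimensional Sobolev inequality with explicit dependence on the length of the
  interval. The inequality (\<phi> y)^2 \<le> 2 (\<phi> x)^2 + 2 (\<phi> y - \<phi> x)^2 is averaged
  over x, and the last term is bounded by the Hoelder estimate.\<close>

lemma weak_top_cell_bound:
  assumes wt: "weak_top (Suc 0) \<phi> h" and \<phi>2: "integrable lborel (\<lambda>x. (\<phi> x)\<^sup>2)"
    and ab: "a < b" and y: "y \<in> {a..b}"
  shows "(\<phi> y)\<^sup>2 \<le> 2 / (b - a) * (LINT x:{a..b}|lborel. (\<phi> x)\<^sup>2) + 2 * (b - a) * (LINT x:{a..b}|lborel. (h x)\<^sup>2)"
proof -
  let ?H = "LINT x:{a..b}|lborel. (h x)\<^sup>2" and ?P = "LINT x:{a..b}|lborel. (\<phi> x)\<^sup>2"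
  have "(\<phi> y)\<^sup>2 * (b - a) = (LINT x:{a..b}|lborel. (\<phi> y)\<^sup>2)"
    using ab by (simp add: set_lebesgue_integral_def)
  also have "\<dots> \<le> (LINT x:{a..b}|lborel. 2 * (\<phi> x)\<^sup>2 + 2 * (b - a) * ?H)"
  proof (rule set_integral_mono)
    show "set_integrable lborel {a..b} (\<lambda>x. (\<phi> y)\<^sup>2)" by (rule set_integrable_const_Icc)
    show "set_integrable lborel {a..b} (\<lambda>x. 2 * (\<phi> x)\<^sup>2 + 2 * (b - a) * ?H)"
      by (intro set_integral_add set_integrable_const_Icc set_integrable_mult_right
          integrable_imp_set_integrable_Icc \<phi>2)
    fix x assume x: "x \<in> {a..b}"
    have "(\<phi> y)\<^sup>2 \<le> 2 * (\<phi> x)\<^sup>2 + 2 * (\<phi> y - \<phi> x)\<^sup>2"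
      using zero_le_power2[of "\<phi> y - 2 * \<phi> x"] by (simp add: power2_eq_square algebra_simps)
    then show "(\<phi> y)\<^sup>2 \<le> 2 * (\<phi> x)\<^sup>2 + 2 * (b - a) * ?H"
      using weak_top_holder[OF wt x y] by linarith
  qed
  also have "\<dots> = 2 * ?P + (2 * (b - a) * ?H) * (b - a)"
    using ab by (subst set_integral_add)
      (auto intro!: set_integrable_const_Icc set_integrable_mult_right integrable_imp_set_integrable_Icc \<phi>2
        simp: set_integral_const)
  finally show ?thesis using ab by (simp add: field_simps)
qed

lemma weak_top_sup_bound:
  assumes wt: "weak_top (Suc 0) \<phi> h" and \<phi>2: "integrable lborel (\<lambda>x. (\<phi> x)\<^sup>2)"
    and le: "(LINT x|lborel. (\<phi> x)\<^sup>2) \<le> A\<^sup>2" "(LINT x|lborel. (h x)\<^sup>2) \<le> A\<^sup>2" and A: "0 \<le> A"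
  shows "\<bar>\<phi> y\<bar> \<le> 2 * A"
proof -
  have h2: "integrable lborel (\<lambda>x. (h x)\<^sup>2)" using wt by (simp add: weak_top_1)
  have *: "(LINT x:{y..y+1}|lborel. \<psi> x) \<le> (LINT x|lborel. \<psi> x)"
    if "integrable lborel \<psi>" "\<And>x. 0 \<le> \<psi> x" for \<psi> :: "real \<Rightarrow> real"
    using integrable_imp_set_integrable_Icc[OF that(1)] that unfolding set_lebesgue_integral_def set_integrable_def
    by (intro integral_mono) (auto split: split_indicator)
  have "(\<phi> y)\<^sup>2 \<le> 2 * (LINT x:{y..y+1}|lborel. (\<phi> x)\<^sup>2) + 2 * (LINT x:{y..y+1}|lborel. (h x)\<^sup>2)"
    using weak_top_cell_bound[OF wt \<phi>2, of y "y + 1" y] by simp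
  also have "\<dots> \<le> 2 * A\<^sup>2 + 2 * A\<^sup>2"
    using *[OF \<phi>2] *[OF h2] le by simp
  also have "\<dots> = (2 * A)\<^sup>2" by (simp add: power2_eq_square)
  finally have "\<bar>\<phi> y\<bar> \<le> \<bar>2 * A\<bar>" by (simp only: abs_le_square_iff)
  then show ?thesis using A by simp
qed

text \<open>The majorant \<open>s n\<close> controls \<phi> on the whole cell around the n-th
  lattice point, since Taylor remainders are evaluated at unknown intermediate points. Its square is
  2 / \<epsilon> times the integral of \<phi>^2 + h^2 over the cell, and the cells cover each point
  at most twice; this gives the factor 4 / \<epsilon>.\<close>

lemma weak_top_sampling:
  assumes wt: "weak_top (Suc 0) \<phi> h" and \<phi>2: "integrable lborel (\<lambda>x. (\<phi> x)\<^sup>2)"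
    and \<epsilon>: "0 < \<epsilon>" "\<epsilon> \<le> 1"
  obtains s where "\<And>n. 0 \<le> s n"
    and "\<And>F. finite F \<Longrightarrow> (\<Sum>n\<in>F. (s n)\<^sup>2) \<le> 4 / \<epsilon> * ((LINT x|lborel. (\<phi> x)\<^sup>2) + (LINT x|lborel. (h x)\<^sup>2))"
    and "\<And>n y. \<bar>y - (b + \<epsilon> * of_int n)\<bar> \<le> \<epsilon> / 2 \<Longrightarrow> \<bar>\<phi> y\<bar> \<le> s n"
proof -
  define I where "I n = {b + \<epsilon> * of_int n - \<epsilon> / 2..b + \<epsilon> * of_int n + \<epsilon> / 2}" for n :: int
  define \<psi> where "\<psi> x = (\<phi> x)\<^sup>2 + (h x)\<^sup>2" for x
  have h2: "integrable lborel (\<lambda>x. (h x)\<^sup>2)" using wt by (simp add: weak_top_1)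
  have \<psi>: "integrable lborel \<psi>" unfolding \<psi>_def using \<phi>2 h2 by simp
  define e where "e n = (LINT x:I n|lborel. \<psi> x)" for n
  define s where "s n = sqrt (2 / \<epsilon> * e n)" for n
  have e0: "0 \<le> e n" for n
    unfolding e_def set_lebesgue_integral_def by (intro integral_nonneg_AE) (auto simp: \<psi>_def)
  have s2: "(s n)\<^sup>2 = 2 / \<epsilon> * e n" for n using e0[of n] \<epsilon> by (simp add: s_def)
  show thesis
  proof
    show "0 \<le> s n" for n using e0[of n] \<epsilon> by (simp add: s_def)
    fix F :: "int set" assume F: "finite F"
    have I_int: "set_integrable lborel (I n) \<psi>" for n
      unfolding I_def by (rule integrable_imp_set_integrable_Icc[OF \<psi>])
    have "(\<Sum>n\<in>F. e n) = (LINT x|lborel. (\<Sum>n\<in>F. indicator (I n) x * \<psi> x))"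
      unfolding e_def set_lebesgue_integral_def using I_int
      by (subst Bochner_Integration.integral_sum) (auto simp: set_integrable_def)
    also have "\<dots> \<le> (LINT x|lborel. 2 * \<psi> x)"
    proof (rule integral_mono)
      show "integrable lborel (\<lambda>x. \<Sum>n\<in>F. indicator (I n) x * \<psi> x)"
        using I_int by (intro Bochner_Integration.integrable_sum) (auto simp: set_integrable_def)
      show "integrable lborel (\<lambda>x. 2 * \<psi> x)" using \<psi> by simp
      fix x
      \<comment> \<open>The cells are closed, so a common endpoint lies in two of them, those with
        index k and k - 1.\<close>
      define k where "k = \<lfloor>(x - b) / \<epsilon> + 1/2\<rfloor>"
      have "{n \<in> F. x \<in> I n} \<subseteq> {k, k - 1}"
      proof
        fix n assume "n \<in> {n \<in> F. x \<in> I n}"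
        then have "of_int n \<le> (x - b) / \<epsilon> + 1/2" "(x - b) / \<epsilon> + 1/2 \<le> of_int n + 1"
          using \<epsilon> by (auto simp: I_def field_simps)
        then have "n \<le> k" "k \<le> n + 1" unfolding k_def by linarith+
        then show "n \<in> {k, k - 1}" by auto
      qed
      then have c: "card {n \<in> F. x \<in> I n} \<le> 2"
        using card_mono[of "{k, k - 1}" "{n \<in> F. x \<in> I n}"] by simp
      have "(\<Sum>n\<in>F. indicator (I n) x * \<psi> x) = of_nat (card {n \<in> F. x \<in> I n}) * \<psi> x"
        using F by (simp add: indicator_def sum.If_cases Int_def flip: sum_distrib_right)
      also have "\<dots> \<le> 2 * \<psi> x" using c by (intro mult_right_mono) (auto simp: \<psi>_def)
      finally show "(\<Sum>n\<in>F. indicator (I n) x * \<psi> x) \<le> 2 * \<psi> x" .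
    qed
    also have "\<dots> = 2 * ((LINT x|lborel. (\<phi> x)\<^sup>2) + (LINT x|lborel. (h x)\<^sup>2))"
      unfolding \<psi>_def using \<phi>2 h2 by simp
    finally have "(\<Sum>n\<in>F. e n) \<le> 2 * ((LINT x|lborel. (\<phi> x)\<^sup>2) + (LINT x|lborel. (h x)\<^sup>2))" .
    then have "2 / \<epsilon> * (\<Sum>n\<in>F. e n) \<le> 2 / \<epsilon> * (2 * ((LINT x|lborel. (\<phi> x)\<^sup>2) + (LINT x|lborel. (h x)\<^sup>2)))"
      using \<epsilon> by (intro mult_left_mono) auto
    then show "(\<Sum>n\<in>F. (s n)\<^sup>2) \<le> 4 / \<epsilon> * ((LINT x|lborel. (\<phi> x)\<^sup>2) + (LINT x|lborel. (h x)\<^sup>2))"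
      unfolding s2 sum_distrib_left[symmetric] by simp
  next
    fix n y assume y: "\<bar>y - (b + \<epsilon> * of_int n)\<bar> \<le> \<epsilon> / 2"
    then have y': "y \<in> I n" unfolding I_def atLeastAtMost_iff by linarith
    have "(\<phi> y)\<^sup>2 \<le> 2 / \<epsilon> * (LINT x:I n|lborel. (\<phi> x)\<^sup>2) + 2 * \<epsilon> * (LINT x:I n|lborel. (h x)\<^sup>2)"
      using weak_top_cell_bound[OF wt \<phi>2, of "b + \<epsilon> * of_int n - \<epsilon> / 2" "b + \<epsilon> * of_int n + \<epsilon> / 2" y] y' \<epsilon>
      by (simp add: I_def)
    also have "2 * \<epsilon> * (LINT x:I n|lborel. (h x)\<^sup>2) \<le> 2 / \<epsilon> * (LINT x:I n|lborel. (h x)\<^sup>2)"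
    proof (rule mult_right_mono)
      have "\<epsilon> * \<epsilon> \<le> 1 * 1" using \<epsilon> by (intro mult_mono) auto
      then show "2 * \<epsilon> \<le> 2 / \<epsilon>" using \<epsilon> by (simp add: field_simps)
      show "0 \<le> (LINT x:I n|lborel. (h x)\<^sup>2)"
        unfolding set_lebesgue_integral_def by (intro integral_nonneg_AE) auto
    qed
    also have "2 / \<epsilon> * (LINT x:I n|lborel. (\<phi> x)\<^sup>2) + 2 / \<epsilon> * (LINT x:I n|lborel. (h x)\<^sup>2) = (s n)\<^sup>2"
      unfolding s2 e_def \<psi>_def I_def
      using integrable_imp_set_integrable_Icc[OF \<phi>2] integrable_imp_set_integrable_Icc[OF h2]
      by (simp add: set_integral_add distrib_left)
    finally have "\<bar>\<phi> y\<bar> \<le> \<bar>s n\<bar>" by (simp add: abs_le_square_iff)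
    moreover have "0 \<le> s n" using e0[of n] \<epsilon> by (simp add: s_def)
    ultimately show "\<bar>\<phi> y\<bar> \<le> s n" by simp
  qed
qed

lemma weak_top_imp_continuous:
  assumes wt: "weak_top (Suc 0) \<phi> h"
  shows "continuous_on UNIV \<phi>"
proof -
  let ?H = "LINT x|lborel. (h x)\<^sup>2"
  have h2: "integrable lborel (\<lambda>x. (h x)\<^sup>2)" using wt by (simp add: weak_top_1)
  have "(\<phi> \<longlongrightarrow> \<phi> x) (at x)" for x
  proof -
    have b: "\<bar>\<phi> y - \<phi> x\<bar> \<le> sqrt (\<bar>y - x\<bar> * ?H)" for y
    proof (rule real_le_rsqrt)
      let ?a = "min x y" and ?b = "max x y"
      have "(\<phi> y - \<phi> x)\<^sup>2 \<le> (?b - ?a) * (LINT x:{?a..?b}|lborel. (h x)\<^sup>2)"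
        by (rule weak_top_holder[OF wt]) auto
      also have "\<dots> \<le> \<bar>y - x\<bar> * ?H"
      proof (rule mult_mono)
        show "(LINT x:{?a..?b}|lborel. (h x)\<^sup>2) \<le> ?H"
          using integrable_imp_set_integrable_Icc[OF h2] h2 unfolding set_lebesgue_integral_def set_integrable_def
          by (intro integral_mono) (auto split: split_indicator)
        show "0 \<le> (LINT x:{?a..?b}|lborel. (h x)\<^sup>2)"
          unfolding set_lebesgue_integral_def by (intro integral_nonneg_AE) auto
      qed auto
      finally show "\<bar>\<phi> y - \<phi> x\<bar>\<^sup>2 \<le> \<bar>y - x\<bar> * ?H" by simp
    qed
    have "((\<lambda>y. sqrt (\<bar>y - x\<bar> * ?H)) \<longlongrightarrow> sqrt (\<bar>x - x\<bar> * ?H)) (at x)"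
      by (intro tendsto_intros)
    then have "((\<lambda>y. sqrt (\<bar>y - x\<bar> * ?H)) \<longlongrightarrow> 0) (at x)" by simp
    then have "((\<lambda>y. \<phi> y - \<phi> x) \<longlongrightarrow> 0) (at x)"
      by (rule Lim_null_comparison[rotated]) (use b in auto)
    then show ?thesis using LIM_zero_iff by blast
  qed
  then show ?thesis by (simp add: continuous_on_def)
qed

lemma weak_top_of_derivative:
  assumes der: "\<And>x. (\<phi> has_real_derivative \<phi>' x) (at x)" and cont: "continuous_on UNIV \<phi>'"
    and int: "integrable lborel (\<lambda>x. (\<phi>' x)\<^sup>2)"
  shows "weak_top (Suc 0) \<phi> \<phi>'"
  unfolding weak_top_1
proof (intro conjI allI impI)
  show "\<phi>' \<in> borel_measurable lborel"
    using borel_measurable_continuous_onI[OF cont] by simp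
  fix a b :: real assume ab: "a \<le> b"
  have c: "continuous_on {a..b} \<phi>'" using cont continuous_on_subset by blast
  show "set_integrable lborel {a..b} \<phi>'"
    using borel_integrable_atLeastAtMost'[OF c] .
  show "\<phi> b - \<phi> a = (LINT x:{a..b}|lborel. \<phi>' x)"
    unfolding set_lebesgue_integral_def
  proof (rule integral_FTC_Icc[symmetric, OF ab _ c])
    fix x
    show "(\<phi> has_vector_derivative \<phi>' x) (at x within {a..b})"
      using der[of x] by (simp add: has_real_derivative_iff_has_vector_derivative has_vector_derivative_at_within)
  qed
qed (rule int)


section \<open>Pointwise and lattice bounds in terms of the X^k norm\<close>

lemma Xnorm_bounds:
  assumes b: "bounded (range g)"
  shows "0 \<le> Xnorm k g" and "\<bar>g x\<bar> \<le> Xnorm k g"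
    and "j \<in> {1..<k} \<Longrightarrow> (LINT x|lborel. ((deriv ^^ j) g x)\<^sup>2) \<le> (Xnorm k g)\<^sup>2"
    and "(LINT x|lborel. ((SOME h. weak_top k g h) x)\<^sup>2) \<le> (Xnorm k g)\<^sup>2"
proof -
  define S where "S = (SUP x. \<bar>g x\<bar>)"
  define P where "P = (\<Sum>j\<in>{1..<k}. LINT x|lborel. ((deriv ^^ j) g x)\<^sup>2)"
  define Q where "Q = (LINT x|lborel. ((SOME h. weak_top k g h) x)\<^sup>2)"
  have X: "Xnorm k g = S + sqrt (P + Q)" by (simp add: Xnorm_def S_def P_def Q_def)
  have int0: "0 \<le> (LINT x|lborel. (\<psi> x)\<^sup>2)" for \<psi> :: "real \<Rightarrow> real"
    by (intro integral_nonneg_AE) auto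
  have P0: "0 \<le> P" unfolding P_def by (intro sum_nonneg int0)
  have Q0: "0 \<le> Q" unfolding Q_def by (rule int0)
  have S: "\<bar>g x\<bar> \<le> S" for x
    unfolding S_def
  proof (rule cSUP_upper)
    obtain c where "\<forall>x\<in>range g. norm x \<le> c" using b by (auto simp: bounded_iff)
    then show "bdd_above (range (\<lambda>x. \<bar>g x\<bar>))" by (intro bdd_aboveI[of _ c]) auto
  qed simp
  have S0: "0 \<le> S" using S[of 0] by linarith
  show "0 \<le> Xnorm k g" unfolding X using S0 P0 Q0 by simp
  show "\<bar>g x\<bar> \<le> Xnorm k g" unfolding X using S[of x] P0 Q0 by (simp add: add_increasing2)
  have PQ: "P + Q \<le> (Xnorm k g)\<^sup>2"
  proof -
    have "P + Q = (sqrt (P + Q))\<^sup>2" using P0 Q0 by simp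
    also have "\<dots> \<le> (Xnorm k g)\<^sup>2" unfolding X using S0 P0 Q0 by (intro power_mono) auto
    finally show ?thesis .
  qed
  show "(LINT x|lborel. ((deriv ^^ j) g x)\<^sup>2) \<le> (Xnorm k g)\<^sup>2" if j: "j \<in> {1..<k}"
  proof -
    have "(LINT x|lborel. ((deriv ^^ j) g x)\<^sup>2) \<le> P"
      unfolding P_def using j by (intro member_le_sum int0) auto
    then show ?thesis using PQ Q0 by linarith
  qed
  show "(LINT x|lborel. ((SOME h. weak_top k g h) x)\<^sup>2) \<le> (Xnorm k g)\<^sup>2"
    using PQ P0 unfolding Q_def by linarith
qed

lemma Xspace_has_derivative:
  "Xspace k g \<Longrightarrow> j + 1 < k \<Longrightarrow> ((deriv ^^ j) g has_real_derivative (deriv ^^ Suc j) g x) (at x)"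
  unfolding Xspace_def by blast

lemma Xspace_continuous:
  assumes X: "Xspace k g" and j: "j < k"
  shows "continuous_on UNIV ((deriv ^^ j) g)"
proof (cases "j + 1 < k")
  case True
  then have "\<And>x. ((deriv ^^ j) g has_real_derivative (deriv ^^ Suc j) g x) (at x)"
    using X unfolding Xspace_def by blast
  then show ?thesis by (meson DERIV_isCont continuous_at_imp_continuous_on)
next
  case False
  then have "j = k - 1" "k = Suc (k - 1)" using j by auto
  moreover obtain h where "weak_top k g h" using X by (auto simp: Xspace_def)
  ultimately have "weak_top (Suc 0) ((deriv ^^ j) g) h" using weak_top_iff[of "k - 1" g h] by simp
  then show ?thesis by (rule weak_top_imp_continuous)
qed

text \<open>Below the top order the derivative is classical and continuous; at order k - 1 only the
  weak derivative is available. The common form lets the later bounds ignore this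
  distinction.\<close>

lemma Xspace_weak_top:
  assumes X: "Xspace k g" and j: "j \<in> {1..<k}"
  obtains h where "weak_top (Suc 0) ((deriv ^^ j) g) h"
    and "(LINT x|lborel. (h x)\<^sup>2) \<le> (Xnorm k g)\<^sup>2"
proof (cases "j + 1 < k")
  case True
  have "\<And>x. ((deriv ^^ j) g has_real_derivative (deriv ^^ Suc j) g x) (at x)"
    using X True unfolding Xspace_def by blast
  moreover have "integrable lborel (\<lambda>x. ((deriv ^^ Suc j) g x)\<^sup>2)"
    using X True unfolding Xspace_def by (simp del: funpow.simps)
  moreover have "continuous_on UNIV ((deriv ^^ Suc j) g)" using Xspace_continuous[OF X, of "Suc j"] True by simp
  ultimately have "weak_top (Suc 0) ((deriv ^^ j) g) ((deriv ^^ Suc j) g)"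
    by (intro weak_top_of_derivative) auto
  moreover have "(LINT x|lborel. ((deriv ^^ Suc j) g x)\<^sup>2) \<le> (Xnorm k g)\<^sup>2"
    by (rule Xnorm_bounds(3)) (use X True in \<open>auto simp: Xspace_def\<close>)
  ultimately show thesis by (rule that)
next
  case False
  then have jk: "j = k - 1" "k = Suc (k - 1)" using j by auto
  \<comment> \<open>The representative has to be the very one that \<open>Xnorm\<close> integrates,
    so that its square integral is bounded by the norm.\<close>
  let ?h = "SOME h. weak_top k g h"
  have "\<exists>h. weak_top k g h" using X by (auto simp: Xspace_def)
  then have "weak_top k g ?h" by (rule someI_ex)
  then have "weak_top (Suc 0) ((deriv ^^ j) g) ?h" using weak_top_iff[of "k - 1" g ?h] jk by simp
  moreover have "(LINT x|lborel. (?h x)\<^sup>2) \<le> (Xnorm k g)\<^sup>2"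
    by (rule Xnorm_bounds(4)) (use X in \<open>auto simp: Xspace_def\<close>)
  ultimately show thesis by (rule that)
qed

lemma Xspace_deriv_bound:
  assumes X: "Xspace k g" and j: "j < k"
  shows "\<bar>(deriv ^^ j) g x\<bar> \<le> 2 * Xnorm k g"
proof (cases "j = 0")
  case True
  have "bounded (range g)" using X by (simp add: Xspace_def)
  then have "0 \<le> Xnorm k g" "\<bar>g x\<bar> \<le> Xnorm k g" by (rule Xnorm_bounds)+
  then show ?thesis using True by simp
next
  case False
  then have j': "j \<in> {1..<k}" using j by auto
  obtain h where h: "weak_top (Suc 0) ((deriv ^^ j) g) h" "(LINT x|lborel. (h x)\<^sup>2) \<le> (Xnorm k g)\<^sup>2"
    using Xspace_weak_top[OF X j'] by blast
  have b: "bounded (range g)" using X by (simp add: Xspace_def)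
  show ?thesis
    by (rule weak_top_sup_bound[OF h(1) _ Xnorm_bounds(3)[OF b j'] h(2) Xnorm_bounds(1)[OF b]])
       (use X j' in \<open>auto simp: Xspace_def\<close>)
qed

text \<open>A single majorant for all orders is the Euclidean norm of the majorants of the
  individual orders. Order 0 is left out because the function itself tends to possibly nonzero
  limits and has no square summable samples in general.\<close>

lemma Xspace_sampling:
  assumes X: "Xspace k g" and \<epsilon>: "0 < \<epsilon>" "\<epsilon> \<le> 1" and B: "Xnorm k g \<le> B"
  obtains s where "\<And>n. 0 \<le> s n"
    and "\<And>F. finite F \<Longrightarrow> (\<Sum>n\<in>F. (s n)\<^sup>2) \<le> 8 * real k * B\<^sup>2 / \<epsilon>"
    and "\<And>n y j. \<lbrakk>\<bar>y - (b + \<epsilon> * of_int n)\<bar> \<le> \<epsilon> / 2; j \<in> {1..<k}\<rbrakk> \<Longrightarrow> \<bar>(deriv ^^ j) g y\<bar> \<le> s n"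
proof -
  have bd: "bounded (range g)" using X by (simp add: Xspace_def)
  have X0: "0 \<le> Xnorm k g" by (rule Xnorm_bounds(1)[OF bd])
  have XB: "(Xnorm k g)\<^sup>2 \<le> B\<^sup>2" using X0 B by (intro power_mono)
  have "\<exists>s. (\<forall>n. 0 \<le> s n) \<and> (\<forall>F. finite F \<longrightarrow> (\<Sum>n\<in>F. (s n)\<^sup>2) \<le> 8 * B\<^sup>2 / \<epsilon>)
     \<and> (\<forall>n y. \<bar>y - (b + \<epsilon> * of_int n)\<bar> \<le> \<epsilon> / 2 \<longrightarrow> \<bar>(deriv ^^ j) g y\<bar> \<le> s n)" if j: "j \<in> {1..<k}" for j
  proof -
    obtain h where h: "weak_top (Suc 0) ((deriv ^^ j) g) h" "(LINT x|lborel. (h x)\<^sup>2) \<le> (Xnorm k g)\<^sup>2"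
      using Xspace_weak_top[OF X j] by blast
    have i: "integrable lborel (\<lambda>x. ((deriv ^^ j) g x)\<^sup>2)" using X j by (auto simp: Xspace_def)
    obtain s where s: "\<And>n. 0 \<le> s n"
      "\<And>F. finite F \<Longrightarrow> (\<Sum>n\<in>F. (s n)\<^sup>2) \<le> 4 / \<epsilon> * ((LINT x|lborel. ((deriv ^^ j) g x)\<^sup>2) + (LINT x|lborel. (h x)\<^sup>2))"
      "\<And>n y. \<bar>y - (b + \<epsilon> * of_int n)\<bar> \<le> \<epsilon> / 2 \<Longrightarrow> \<bar>(deriv ^^ j) g y\<bar> \<le> s n"
      using weak_top_sampling[OF h(1) i \<epsilon>, of b] by blast
    have "4 / \<epsilon> * ((LINT x|lborel. ((deriv ^^ j) g x)\<^sup>2) + (LINT x|lborel. (h x)\<^sup>2)) \<le> 4 / \<epsilon> * (B\<^sup>2 + B\<^sup>2)"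
      using Xnorm_bounds(3)[OF bd j] h(2) XB \<epsilon> by (intro mult_left_mono) auto
    also have "\<dots> = 8 * B\<^sup>2 / \<epsilon>" by simp
    finally show ?thesis using s by (intro exI[of _ s]) (auto intro: order_trans)
  qed
  then obtain s where s: "\<And>j n. j \<in> {1..<k} \<Longrightarrow> 0 \<le> s j n"
     "\<And>j F. j \<in> {1..<k} \<Longrightarrow> finite F \<Longrightarrow> (\<Sum>n\<in>F. (s j n)\<^sup>2) \<le> 8 * B\<^sup>2 / \<epsilon>"
     "\<And>j n y. j \<in> {1..<k} \<Longrightarrow> \<bar>y - (b + \<epsilon> * of_int n)\<bar> \<le> \<epsilon> / 2 \<Longrightarrow> \<bar>(deriv ^^ j) g y\<bar> \<le> s j n"
    by metis
  define r where "r n = sqrt (\<Sum>j\<in>{1..<k}. (s j n)\<^sup>2)" for n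
  show thesis
  proof (rule that[of r])
    show "0 \<le> r n" for n by (auto simp: r_def intro: sum_nonneg)
    fix F :: "int set" assume F: "finite F"
    have "(\<Sum>n\<in>F. (r n)\<^sup>2) = (\<Sum>n\<in>F. \<Sum>j\<in>{1..<k}. (s j n)\<^sup>2)"
      by (intro sum.cong refl) (simp add: r_def sum_nonneg)
    also have "\<dots> = (\<Sum>j\<in>{1..<k}. \<Sum>n\<in>F. (s j n)\<^sup>2)" by (rule sum.swap)
    also have "\<dots> \<le> (\<Sum>j\<in>{1..<k}. 8 * B\<^sup>2 / \<epsilon>)" by (intro sum_mono s F)
    also have "\<dots> \<le> 8 * real k * B\<^sup>2 / \<epsilon>" using \<epsilon> by (simp add: divide_right_mono mult_right_mono)
    finally show "(\<Sum>n\<in>F. (r n)\<^sup>2) \<le> 8 * real k * B\<^sup>2 / \<epsilon>" .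
  next
    fix n y j assume y: "\<bar>y - (b + \<epsilon> * of_int n)\<bar> \<le> \<epsilon> / 2" and j: "j \<in> {1..<k}"
    have "\<bar>(deriv ^^ j) g y\<bar> \<le> s j n" by (rule s(3)[OF j y])
    also have "s j n = sqrt ((s j n)\<^sup>2)" using s(1)[OF j] by simp
    also have "\<dots> \<le> r n" unfolding r_def using j by (intro real_sqrt_le_mono member_le_sum) auto
    finally show "\<bar>(deriv ^^ j) g y\<bar> \<le> r n" .
  qed
qed

section \<open>Joint continuity of the space derivative and the chain rule along lines\<close>

lemma integrable_square_diff:
  fixes p q :: "real \<Rightarrow> real"
  assumes "integrable lborel (\<lambda>x. (p x)\<^sup>2)" "integrable lborel (\<lambda>x. (q x)\<^sup>2)"
    and "continuous_on UNIV p" "continuous_on UNIV q"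
  shows "integrable lborel (\<lambda>x. (p x - q x)\<^sup>2)"
proof (rule Bochner_Integration.integrable_bound)
  show "integrable lborel (\<lambda>x. 2 * (p x)\<^sup>2 + 2 * (q x)\<^sup>2)" using assms by simp
  have "continuous_on UNIV (\<lambda>x. (p x - q x)\<^sup>2)" using assms by (intro continuous_intros)
  then show "(\<lambda>x. (p x - q x)\<^sup>2) \<in> borel_measurable lborel"
    using borel_measurable_continuous_onI by simp
  have "(p x - q x)\<^sup>2 \<le> 2 * (p x)\<^sup>2 + 2 * (q x)\<^sup>2" for x
    using zero_le_power2[of "p x + q x"] by (simp add: power2_eq_square algebra_simps)
  then show "AE x in lborel. norm ((p x - q x)\<^sup>2) \<le> norm (2 * (p x)\<^sup>2 + 2 * (q x)\<^sup>2)"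
    by (intro AE_I2) simp
qed

text \<open>The sup bound is applied to p' - q'. Its square integral and that of p'' - q'' are two
  of the terms inside the norm of the difference.\<close>

lemma Xspace_deriv_diff_bound:
  assumes X1: "Xspace k p" and X2: "Xspace k q" and k: "3 < k"
  shows "\<bar>deriv p x - deriv q x\<bar> \<le> 2 * Xnorm k (\<lambda>x. p x - q x)"
proof -
  have d: "(p has_real_derivative deriv p x) (at x)" "(q has_real_derivative deriv q x) (at x)"
    "(deriv p has_real_derivative deriv (deriv p) x) (at x)" "(deriv q has_real_derivative deriv (deriv q) x) (at x)" for x
  proof -
    note * = Xspace_has_derivative
    show "(p has_real_derivative deriv p x) (at x)" "(q has_real_derivative deriv q x) (at x)"
      using *[OF X1, of 0] *[OF X2, of 0] k by simp_all
    show "(deriv p has_real_derivative deriv (deriv p) x) (at x)" "(deriv q has_real_derivative deriv (deriv q) x) (at x)"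
      using *[OF X1, of 1] *[OF X2, of 1] k by simp_all
  qed
  let ?D = "\<lambda>x. p x - q x"
  have D1: "deriv ?D = (\<lambda>x. deriv p x - deriv q x)"
    using d by (intro ext DERIV_imp_deriv) (auto intro!: derivative_intros)
  have D2: "deriv (deriv ?D) = (\<lambda>x. deriv (deriv p) x - deriv (deriv q) x)"
    unfolding D1 using d by (intro ext DERIV_imp_deriv) (auto intro!: derivative_intros)
  have c: "continuous_on UNIV (deriv p)" "continuous_on UNIV (deriv q)"
     "continuous_on UNIV (deriv (deriv p))" "continuous_on UNIV (deriv (deriv q))"
    using Xspace_continuous[OF X1, of 1] Xspace_continuous[OF X2, of 1]
       Xspace_continuous[OF X1, of 2] Xspace_continuous[OF X2, of 2] k by (simp_all add: numeral_2_eq_2)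
  have i: "integrable lborel (\<lambda>x. ((deriv ^^ j) g x)\<^sup>2)" if "Xspace k g" "j \<in> {1..<k}" for g j
    using that unfolding Xspace_def by blast
  have i1: "integrable lborel (\<lambda>x. (deriv ?D x)\<^sup>2)"
    unfolding D1 using i[OF X1, of 1] i[OF X2, of 1] c k by (intro integrable_square_diff) auto
  have i2: "integrable lborel (\<lambda>x. (deriv (deriv ?D) x)\<^sup>2)"
    unfolding D2 using i[OF X1, of 2] i[OF X2, of 2] c k
    by (intro integrable_square_diff) (auto simp: numeral_2_eq_2)
  have wt: "weak_top (Suc 0) (deriv ?D) (deriv (deriv ?D))"
  proof (rule weak_top_of_derivative[OF _ _ i2])
    show "(deriv ?D has_real_derivative deriv (deriv ?D) x) (at x)" for x
      unfolding D2 unfolding D1 using d by (auto intro!: derivative_intros)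
    show "continuous_on UNIV (deriv (deriv ?D))" unfolding D2 using c by (intro continuous_intros)
  qed
  have b: "bounded (range ?D)"
    using X1 X2 by (intro bounded_minus_comp) (auto simp: Xspace_def)
  have "\<bar>deriv ?D x\<bar> \<le> 2 * Xnorm k ?D"
    by (rule weak_top_sup_bound[OF wt i1])
       (use Xnorm_bounds(3)[OF b, of 1 k] Xnorm_bounds(3)[OF b, of 2 k] Xnorm_bounds(1)[OF b] k in
         \<open>auto simp: numeral_2_eq_2\<close>)
  then show ?thesis by (simp add: D1)
qed

text \<open>Triangle inequality: changing T costs at most twice the X^k norm of the difference of
  the two profiles, uniformly in x, and at the fixed time T0 the derivative is continuous in
  x.\<close>

lemma Cb_X_imp_joint_continuous_deriv:
  assumes reg: "Cb_X k f" and k: "3 < k"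
  shows "((\<lambda>(T, x). deriv (\<lambda>x. f x T) x) \<longlongrightarrow> deriv (\<lambda>x. f x T0) x0) (at (T0, x0))"
proof -
  have X: "Xspace k (\<lambda>x. f x T)" for T using reg by (simp add: Cb_X_def)
  \<comment> \<open>Continuity of the flow in X^k is stated as a punctured limit, but a punctured
    neighbourhood of (T0, x0) contains points with T = T0. Setting the value to 0 there makes N
    continuous at T0.\<close>
  define N where "N T = (if T = T0 then 0 else 2 * Xnorm k (\<lambda>x. f x T - f x T0))" for T
  define g where "g = deriv (\<lambda>x. f x T0)"
  have N: "(N \<longlongrightarrow> N T0) (at T0)"
  proof -
    have "((\<lambda>S. 2 * Xnorm k (\<lambda>x. f x S - f x T0)) \<longlongrightarrow> 2 * 0) (at T0)"
      using reg unfolding Cb_X_def by (intro tendsto_mult tendsto_const) auto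
    then have "((\<lambda>S. 2 * Xnorm k (\<lambda>x. f x S - f x T0)) \<longlongrightarrow> N T0) (at T0)" by (simp add: N_def)
    then show ?thesis
      by (rule Lim_transform_eventually) (auto simp: N_def eventually_at_filter)
  qed
  have fst_lim: "((\<lambda>z. fst z) \<longlongrightarrow> T0) (at (T0, x0))" and snd_lim: "((\<lambda>z. snd z) \<longlongrightarrow> x0) (at (T0, x0))"
    using tendsto_fst[OF tendsto_ident_at, of "(T0, x0)" UNIV] tendsto_snd[OF tendsto_ident_at, of "(T0, x0)" UNIV] by simp_all
  have lN: "((\<lambda>z. N (fst z)) \<longlongrightarrow> N T0) (at (T0, x0))"
    using isCont_o2[where a = "(T0, x0)" and f = fst and g = N] N fst_lim by (simp add: isCont_def)
  have "isCont g x0"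
    using Xspace_continuous[OF X[of T0], of 1] k by (simp add: g_def continuous_on_eq_continuous_at)
  then have lg: "((\<lambda>z. g (snd z)) \<longlongrightarrow> g x0) (at (T0, x0))"
    using isCont_o2[where a = "(T0, x0)" and f = snd and g = g] snd_lim by (simp add: isCont_def)
  have "((\<lambda>z. (\<lambda>(T, x). deriv (\<lambda>x. f x T) x) z - g (snd z)) \<longlongrightarrow> 0) (at (T0, x0))"
  proof (rule Lim_null_comparison)
    show "eventually (\<lambda>z. norm ((\<lambda>(T, x). deriv (\<lambda>x. f x T) x) z - g (snd z)) \<le> N (fst z)) (at (T0, x0))"
    proof (intro always_eventually allI)
      fix z :: "real \<times> real"
      show "norm ((\<lambda>(T, x). deriv (\<lambda>x. f x T) x) z - g (snd z)) \<le> N (fst z)"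
        using Xspace_deriv_diff_bound[OF X[of "fst z"] X[of T0] k, of "snd z"]
        by (auto simp: N_def g_def split_beta)
    qed
    show "((\<lambda>z. N (fst z)) \<longlongrightarrow> 0) (at (T0, x0))" using lN by (simp add: N_def)
  qed
  from tendsto_add[OF this lg] show ?thesis by (simp add: g_def)
qed

text \<open>The equation provides only a partial derivative in time, whereas the ansatz moves in
  space and time simultaneously. Together with the jointly continuous space derivative the time
  derivative gives total differentiability. The variables are paired as (T, x), so that the
  component with the continuous partial derivative comes second.\<close>

lemma mkdv_has_derivative_along_line:
  assumes sol: "mkdv_sol f" and reg: "Cb_X 6 f"
  defines "g \<equiv> \<lambda>j x T. (deriv ^^ j) (\<lambda>x. f x T) x"
  shows "((\<lambda>t. f (c + \<alpha> * t) (\<beta> * t)) has_real_derivative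
     \<alpha> * g 1 (c + \<alpha> * t) (\<beta> * t) + \<beta> * (g 3 (c + \<alpha> * t) (\<beta> * t) / 24
        - (f (c + \<alpha> * t) (\<beta> * t))\<^sup>2 * g 1 (c + \<alpha> * t) (\<beta> * t) / 4)) (at t)"
proof -
  let ?x = "c + \<alpha> * t" and ?T = "\<beta> * t"
  define fT where "fT = g 3 ?x ?T / 24 - (f ?x ?T)\<^sup>2 * g 1 ?x ?T / 4"
  have X: "Xspace 6 (\<lambda>x. f x T)" for T using reg by (simp add: Cb_X_def)
  have d0: "((\<lambda>x. f x T) has_real_derivative deriv (\<lambda>x. f x T) x) (at x)" for x T
  proof -
    show ?thesis using Xspace_has_derivative[OF X[of T], of 0 x] by simp
  qed
  have dt: "((\<lambda>T. f ?x T) has_real_derivative fT) (at ?T)"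
  proof -
    have "deriv (\<lambda>x. (f x ?T)^3) ?x = 3 * (f ?x ?T)\<^sup>2 * deriv (\<lambda>x. f x ?T) ?x"
      by (intro DERIV_imp_deriv) (auto intro!: derivative_eq_intros d0)
    then have "(- (1/6) * deriv (\<lambda>x. (f x ?T)^3) ?x + (1/12) * (deriv ^^ 3) (\<lambda>x. f x ?T) ?x) / 2 = fT"
      by (simp add: fT_def g_def field_simps)
    then show ?thesis using sol unfolding mkdv_sol_def by metis
  qed
  have "((\<lambda>(T, x). f x T) has_derivative
      (\<lambda>(a, b). fT * a + blinfun_apply (blinfun_mult_right (deriv (\<lambda>x. f x ?T) ?x)) b)) (at (?T, ?x) within UNIV \<times> UNIV)"
  proof (rule has_derivative_partialsI[where fy = "\<lambda>T x. blinfun_mult_right (deriv (\<lambda>x. f x T) x)"])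
    show "((\<lambda>T. f ?x T) has_derivative (*) fT) (at ?T within UNIV)"
      using dt by (simp add: has_field_derivative_def)
    show "((\<lambda>x. f x T) has_derivative blinfun_apply (blinfun_mult_right (deriv (\<lambda>x. f x T) x))) (at x within UNIV)" for T x
      using d0[of T x] by (simp add: has_field_derivative_def)
    have "((\<lambda>z. blinfun_mult_right ((\<lambda>(T, x). deriv (\<lambda>x. f x T) x) z)) \<longlongrightarrow> blinfun_mult_right (deriv (\<lambda>x. f x ?T) ?x)) (at (?T, ?x))"
      by (intro bounded_linear.tendsto[OF bounded_linear_blinfun_mult_right]
          Cb_X_imp_joint_continuous_deriv[OF reg]) simp
    then show "continuous (at (?T, ?x) within UNIV \<times> UNIV) (\<lambda>(T, x). blinfun_mult_right (deriv (\<lambda>x. f x T) x))"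
      by (simp add: continuous_within case_prod_unfold)
  qed auto
  then have F: "((\<lambda>(T, x). f x T) has_derivative (\<lambda>(a, b). fT * a + deriv (\<lambda>x. f x ?T) ?x * b)) (at (?T, ?x))"
    by simp
  have "((\<lambda>t. (\<beta> * t, c + \<alpha> * t)) has_derivative (\<lambda>h. (\<beta> * h, \<alpha> * h))) (at t)"
    by (auto intro!: derivative_eq_intros)
  from has_derivative_compose[OF this F]
  have "((\<lambda>t. f (c + \<alpha> * t) (\<beta> * t)) has_derivative (\<lambda>h. fT * (\<beta> * h) + deriv (\<lambda>x. f x ?T) ?x * (\<alpha> * h))) (at t)"
    by simp
  then show ?thesis
    unfolding has_field_derivative_def fT_def[symmetric]
    by (rule has_derivative_eq_rhs) (auto simp: g_def algebra_simps)
qed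

section \<open>The mKdV ansatz and its residuals\<close>

text \<open>The even Taylor terms at x cancel, which leaves orders 1 and 3 and two remainders of
  order 5. The bound S is local to the h-neighbourhood of x, so that a cell majorant can be inserted
  for it.\<close>

lemma centered_difference_order5:
  fixes g :: "nat \<Rightarrow> real \<Rightarrow> real"
  assumes der: "\<And>j x. j < 5 \<Longrightarrow> (g j has_real_derivative g (Suc j) x) (at x)"
    and h: "h > 0" and S: "\<And>y. \<bar>y - x\<bar> \<le> h \<Longrightarrow> \<bar>g 5 y\<bar> \<le> S"
  shows "\<bar>g 0 (x + h) - g 0 (x - h) - (2 * h * g 1 x + h^3 / 3 * g 3 x)\<bar> \<le> h^5 / 60 * S"
proof -
  obtain y1 where y1: "x < y1" "y1 < x + h"
    and e1: "g 0 (x + h) = (\<Sum>m<5. (g m x / fact m) * ((x + h) - x)^m) + (g 5 y1 / fact 5) * ((x + h) - x)^5"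
    using Taylor_up[of 5 g "g 0" x "x + h" x] der h by auto
  obtain y2 where y2: "x - h < y2" "y2 < x"
    and e2: "g 0 (x - h) = (\<Sum>m<5. (g m x / fact m) * ((x - h) - x)^m) + (g 5 y2 / fact 5) * ((x - h) - x)^5"
    using Taylor_down[of 5 g "g 0" "x - h" x x] der h by auto
  have "g 0 (x + h) - g 0 (x - h) - (2 * h * g 1 x + h^3 / 3 * g 3 x) = h^5 / 120 * (g 5 y1 + g 5 y2)"
    unfolding e1 e2 by (simp add: eval_nat_numeral fact_numeral algebra_simps)
  moreover have "\<bar>g 5 y1 + g 5 y2\<bar> \<le> 2 * S"
    using S[of y1] S[of y2] y1 y2 by (smt (verit))
  then have "\<bar>h^5 / 120 * (g 5 y1 + g 5 y2)\<bar> \<le> h^5 / 120 * (2 * S)"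
    using h unfolding abs_mult by (intro mult_mono) auto
  ultimately show ?thesis by (simp only:)
qed

lemma centered_difference_order3:
  fixes g :: "nat \<Rightarrow> real \<Rightarrow> real"
  assumes der: "\<And>j x. j < 3 \<Longrightarrow> (g j has_real_derivative g (Suc j) x) (at x)"
    and h: "h > 0" and S: "\<And>y. \<bar>y - x\<bar> \<le> h \<Longrightarrow> \<bar>g 3 y\<bar> \<le> S"
  shows "\<bar>g 0 (x + h) - g 0 (x - h) - 2 * h * g 1 x\<bar> \<le> h^3 / 3 * S"
proof -
  obtain y1 where y1: "x < y1" "y1 < x + h"
    and e1: "g 0 (x + h) = (\<Sum>m<3. (g m x / fact m) * ((x + h) - x)^m) + (g 3 y1 / fact 3) * ((x + h) - x)^3"
    using Taylor_up[of 3 g "g 0" x "x + h" x] der h by auto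
  obtain y2 where y2: "x - h < y2" "y2 < x"
    and e2: "g 0 (x - h) = (\<Sum>m<3. (g m x / fact m) * ((x - h) - x)^m) + (g 3 y2 / fact 3) * ((x - h) - x)^3"
    using Taylor_down[of 3 g "g 0" "x - h" x x] der h by auto
  have "g 0 (x + h) - g 0 (x - h) - 2 * h * g 1 x = h^3 / 6 * (g 3 y1 + g 3 y2)"
    unfolding e1 e2 by (simp add: eval_nat_numeral fact_numeral algebra_simps)
  moreover have "\<bar>g 3 y1 + g 3 y2\<bar> \<le> 2 * S"
    using S[of y1] S[of y2] y1 y2 by (smt (verit))
  then have "\<bar>h^3 / 6 * (g 3 y1 + g 3 y2)\<bar> \<le> h^3 / 6 * (2 * S)"
    using h unfolding abs_mult by (intro mult_mono) auto
  ultimately show ?thesis by (simp only:)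
qed

text \<open>\<open>c j\<close> is the j-th derivative of the cube of \<open>g 0\<close>. Every
  monomial of the third one contains a derivative of \<open>g 0\<close>, hence is at most B^2 S, and
  the coefficients 6, 18 and 3 add up to 27. The factor S keeps the bound square summable although
  \<open>g 0\<close> itself does not decay.\<close>

lemma centered_difference_cube:
  fixes g :: "nat \<Rightarrow> real \<Rightarrow> real"
  assumes der: "\<And>j x. j < 3 \<Longrightarrow> (g j has_real_derivative g (Suc j) x) (at x)"
    and B: "\<And>j x. j \<le> 3 \<Longrightarrow> \<bar>g j x\<bar> \<le> B"
    and h: "h > 0" and S: "\<And>j y. \<bar>y - x\<bar> \<le> h \<Longrightarrow> 1 \<le> j \<Longrightarrow> j \<le> 3 \<Longrightarrow> \<bar>g j y\<bar> \<le> S"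
  shows "\<bar>(g 0 (x + h))^3 - (g 0 (x - h))^3 - 2 * h * (3 * (g 0 x)\<^sup>2 * g 1 x)\<bar> \<le> 9 * h^3 * B\<^sup>2 * S"
proof -
  have d: "(g 0 has_real_derivative g 1 y) (at y)" "(g 1 has_real_derivative g 2 y) (at y)"
      "(g 2 has_real_derivative g 3 y) (at y)" for y
    using der[of 0 y] der[of 1 y] der[of 2 y] by (simp_all add: eval_nat_numeral)
  define c where "c j y = (if j = 0 then (g 0 y)^3 else if j = 1 then 3 * (g 0 y)\<^sup>2 * g 1 y
     else if j = 2 then 6 * g 0 y * (g 1 y)\<^sup>2 + 3 * (g 0 y)\<^sup>2 * g 2 y
     else 6 * (g 1 y)^3 + 18 * g 0 y * g 1 y * g 2 y + 3 * (g 0 y)\<^sup>2 * g 3 y)" for j :: nat and y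
  have dc: "(c j has_real_derivative c (Suc j) y) (at y)" if j: "j < 3" for j y
  proof -
    consider "j = 0" | "j = 1" | "j = 2" using j by force
    then show ?thesis
    proof cases
      case 1
      have "((\<lambda>y. (g 0 y)^3) has_real_derivative 3 * (g 0 y)\<^sup>2 * g 1 y) (at y)"
        by (auto intro!: derivative_eq_intros d)
      then show ?thesis unfolding c_def 1 by simp
    next
      case 2
      have "((\<lambda>y. 3 * (g 0 y)\<^sup>2 * g 1 y) has_real_derivative 6 * g 0 y * (g 1 y)\<^sup>2 + 3 * (g 0 y)\<^sup>2 * g 2 y) (at y)"
        by (rule derivative_eq_intros d refl)+ (simp add: power2_eq_square algebra_simps)
      then show ?thesis unfolding c_def 2 by simp
    next
      case 3
      have "((\<lambda>y. 6 * g 0 y * (g 1 y)\<^sup>2 + 3 * (g 0 y)\<^sup>2 * g 2 y) has_real_derivative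
          6 * (g 1 y)^3 + 18 * g 0 y * g 1 y * g 2 y + 3 * (g 0 y)\<^sup>2 * g 3 y) (at y)"
        by (rule derivative_eq_intros d refl)+ (simp add: power2_eq_square power3_eq_cube algebra_simps)
      then show ?thesis unfolding c_def 3 by simp
    qed
  qed
  have c3: "\<bar>c 3 y\<bar> \<le> 27 * B\<^sup>2 * S" if y: "\<bar>y - x\<bar> \<le> h" for y
  proof -
    have B0: "0 \<le> B" using B[of 0 x] by simp
    have m3: "\<bar>p * q * r\<bar> \<le> B\<^sup>2 * S" if "\<bar>p\<bar> \<le> B" "\<bar>q\<bar> \<le> B" "\<bar>r\<bar> \<le> S" for p q r
      unfolding abs_mult power2_eq_square using that B0 by (intro mult_mono) auto
    have a: "\<bar>g 1 y * g 1 y * g 1 y\<bar> \<le> B\<^sup>2 * S" "\<bar>g 0 y * g 1 y * g 2 y\<bar> \<le> B\<^sup>2 * S" "\<bar>g 0 y * g 0 y * g 3 y\<bar> \<le> B\<^sup>2 * S"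
      using B S[OF y] by (auto intro!: m3)
    have "c 3 y = 6 * (g 1 y * g 1 y * g 1 y) + 18 * (g 0 y * g 1 y * g 2 y) + 3 * (g 0 y * g 0 y * g 3 y)"
      by (simp add: c_def power2_eq_square power3_eq_cube)
    then show ?thesis using a by linarith
  qed
  have "\<bar>c 0 (x + h) - c 0 (x - h) - 2 * h * c 1 x\<bar> \<le> h^3 / 3 * (27 * B\<^sup>2 * S)"
    by (rule centered_difference_order3[OF dc h c3])
  then show ?thesis by (simp add: c_def algebra_simps)
qed

text \<open>What the lattice argument uses of f, with \<open>g j\<close> for its j-th space
  derivative: five derivatives in x, uniform bounds, square summable cell majorants of the
  derivatives at spacing \<epsilon>, and the mKdV equation in the form of the derivative along lines
  of the (X, T) plane.\<close>

locale mkdv_profile =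
  fixes g :: "nat \<Rightarrow> real \<Rightarrow> real \<Rightarrow> real" and B S0 :: real
  assumes B_ge_1: "1 \<le> B" and S0_pos: "0 < S0"
    and deriv_x: "\<And>j x T. j < 5 \<Longrightarrow> ((\<lambda>x. g j x T) has_real_derivative g (Suc j) x T) (at x)"
    and bound_g: "\<And>j x T. j \<le> 5 \<Longrightarrow> \<bar>g j x T\<bar> \<le> B"
    and sampling: "\<And>\<epsilon> b T. 0 < \<epsilon> \<Longrightarrow> \<epsilon> \<le> 1 \<Longrightarrow> \<exists>s. (\<forall>n. 0 \<le> s n)
        \<and> (\<forall>F. finite F \<longrightarrow> (\<Sum>n\<in>F. (s n)\<^sup>2) \<le> S0 / \<epsilon>)
        \<and> (\<forall>n y j. \<bar>y - (b + \<epsilon> * of_int (n::int))\<bar> \<le> \<epsilon> / 2 \<longrightarrow> 1 \<le> j \<longrightarrow> j \<le> 5 \<longrightarrow> \<bar>g j y T\<bar> \<le> s n)"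
    and deriv_line: "\<And>c \<alpha> \<beta> t. ((\<lambda>t. g 0 (c + \<alpha> * t) (\<beta> * t)) has_real_derivative
     \<alpha> * g 1 (c + \<alpha> * t) (\<beta> * t) + \<beta> * (g 3 (c + \<alpha> * t) (\<beta> * t) / 24
        - (g 0 (c + \<alpha> * t) (\<beta> * t))\<^sup>2 * g 1 (c + \<alpha> * t) (\<beta> * t) / 4)) (at t)"
begin

lemma B_powers: "1 \<le> B ^ k" using B_ge_1 by (rule one_le_power)

text \<open>Both lattice equations lead to this expansion of the centred difference of \<epsilon> f
  - \<kappa> \<epsilon>^3 f^3: \<kappa> = 1/12 for the increments of \<open>Q\<close>, \<kappa> =
  1/6 for the force.\<close>

lemma cell_residual:
  assumes \<epsilon>: "0 < \<epsilon>" and \<kappa>: "0 \<le> \<kappa>" "\<kappa> \<le> 1/6" and S: "0 \<le> S"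
    and S': "\<And>j y. \<bar>y - x\<bar> \<le> \<epsilon> / 2 \<Longrightarrow> 1 \<le> j \<Longrightarrow> j \<le> 5 \<Longrightarrow> \<bar>g j y T\<bar> \<le> S"
  shows "\<bar>(\<epsilon> * (g 0 (x + \<epsilon> / 2) T - g 0 (x - \<epsilon> / 2) T)
      - \<kappa> * \<epsilon>^3 * ((g 0 (x + \<epsilon> / 2) T)^3 - (g 0 (x - \<epsilon> / 2) T)^3))
     - (\<epsilon>^2 * g 1 x T + \<epsilon>^4 * (g 3 x T / 24 - 3 * \<kappa> * (g 0 x T)\<^sup>2 * g 1 x T))\<bar> \<le> \<epsilon>^6 * B\<^sup>2 * S"
proof -
  let ?h = "\<epsilon> / 2"
  have h: "0 < ?h" using \<epsilon> by simp
  have a: "\<bar>g 0 (x + ?h) T - g 0 (x - ?h) T - (2 * ?h * g 1 x T + ?h^3 / 3 * g 3 x T)\<bar> \<le> ?h^5 / 60 * S"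
    using centered_difference_order5[of "\<lambda>j x. g j x T", OF deriv_x h S'] by simp
  have b: "\<bar>(g 0 (x + ?h) T)^3 - (g 0 (x - ?h) T)^3 - 2 * ?h * (3 * (g 0 x T)\<^sup>2 * g 1 x T)\<bar> \<le> 9 * ?h^3 * B\<^sup>2 * S"
    by (rule centered_difference_cube[of "\<lambda>j x. g j x T", OF deriv_x bound_g h S']) auto
  define A where "A = g 0 (x + ?h) T - g 0 (x - ?h) T - (2 * ?h * g 1 x T + ?h^3 / 3 * g 3 x T)"
  define D where "D = (g 0 (x + ?h) T)^3 - (g 0 (x - ?h) T)^3 - 2 * ?h * (3 * (g 0 x T)\<^sup>2 * g 1 x T)"
  have "(\<epsilon> * (g 0 (x + \<epsilon> / 2) T - g 0 (x - \<epsilon> / 2) T)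
      - \<kappa> * \<epsilon>^3 * ((g 0 (x + \<epsilon> / 2) T)^3 - (g 0 (x - \<epsilon> / 2) T)^3))
     - (\<epsilon>^2 * g 1 x T + \<epsilon>^4 * (g 3 x T / 24 - 3 * \<kappa> * (g 0 x T)\<^sup>2 * g 1 x T)) = \<epsilon> * A - \<kappa> * \<epsilon>^3 * D"
    by (simp add: A_def D_def eval_nat_numeral algebra_simps)
  moreover have "\<bar>\<epsilon> * A\<bar> \<le> \<epsilon> * (?h^5 / 60 * S)"
    using a \<epsilon> unfolding A_def[symmetric] by (simp add: abs_mult)
  moreover have "\<bar>\<kappa> * \<epsilon>^3 * D\<bar> \<le> 1/6 * \<epsilon>^3 * (9 * ?h^3 * B\<^sup>2 * S)"
    using b \<epsilon> \<kappa> S unfolding D_def[symmetric] abs_mult by (intro mult_mono) auto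
  moreover have "\<epsilon> * (?h^5 / 60 * S) \<le> \<epsilon>^6 * S * (1/2)"
    using \<epsilon> S by (simp add: eval_nat_numeral)
  moreover have "\<epsilon>^6 * S * (1/2) \<le> \<epsilon>^6 * S * (1/2 * B\<^sup>2)"
    using \<epsilon> S B_powers[of 2] by (intro mult_left_mono) auto
  moreover have "1/6 * \<epsilon>^3 * (9 * ?h^3 * B\<^sup>2 * S) \<le> \<epsilon>^6 * S * (1/2 * B\<^sup>2)"
  proof -
    have "1/6 * \<epsilon>^3 * (9 * ?h^3 * B\<^sup>2 * S) = 3/16 * (\<epsilon>^6 * S * B\<^sup>2)" by (simp add: eval_nat_numeral)
    moreover have "0 \<le> \<epsilon>^6 * S * B\<^sup>2" using \<epsilon> S by simp
    ultimately show ?thesis by linarith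
  qed
  ultimately show ?thesis by (simp add: algebra_simps)
qed

end

definition fput_force :: "real \<Rightarrow> real" where
  "fput_force u = u - u^3 / 6"

locale mkdv_ansatz = mkdv_profile +
  fixes \<epsilon> k :: real
  assumes \<epsilon>_pos: "0 < \<epsilon>" and \<epsilon>_le_1: "\<epsilon> \<le> 1" and \<epsilon>_B: "\<epsilon> * B \<le> 1"
begin

text \<open>The time derivative of f as given by the mKdV equation.\<close>

definition gT :: "real \<Rightarrow> real \<Rightarrow> real" where
  "gT x T = g 3 x T / 24 - (g 0 x T)\<^sup>2 * g 1 x T / 4"

definition U :: "real \<Rightarrow> int \<Rightarrow> real" where
  "U t n = \<epsilon> * g 0 (\<epsilon> * (of_int n + t)) (\<epsilon>^3 * t)"

definition U' :: "real \<Rightarrow> int \<Rightarrow> real" where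
  "U' t n = \<epsilon>^2 * g 1 (\<epsilon> * (of_int n + t)) (\<epsilon>^3 * t) + \<epsilon>^4 * gT (\<epsilon> * (of_int n + t)) (\<epsilon>^3 * t)"

text \<open>The constant \<open>k\<close> normalises the limit of \<open>Q\<close> at \<open>-\<infinity>\<close> to zero.\<close>

definition Q :: "real \<Rightarrow> int \<Rightarrow> real" where
  "Q t n = \<epsilon> * (g 0 (\<epsilon> * (of_int n + t) - \<epsilon> / 2) (\<epsilon>^3 * t)
     - \<epsilon>^2 / 12 * (g 0 (\<epsilon> * (of_int n + t) - \<epsilon> / 2) (\<epsilon>^3 * t))^3) - k"

definition Q' :: "real \<Rightarrow> int \<Rightarrow> real" where
  "Q' t n = (let y = \<epsilon> * (of_int n + t) - \<epsilon> / 2; T = \<epsilon>^3 * t in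
     \<epsilon> * (1 - \<epsilon>^2 / 4 * (g 0 y T)\<^sup>2) * (\<epsilon> * g 1 y T + \<epsilon>^3 * gT y T))"

text \<open>The signs are chosen so that the residuals appear as added sources in the equations for
  the errors u - U and q - Q.\<close>

definition R1 :: "real \<Rightarrow> int \<Rightarrow> real" where
  "R1 t n = Q t (n + 1) - Q t n - U' t n"

definition R2 :: "real \<Rightarrow> int \<Rightarrow> real" where
  "R2 t n = fput_force (U t n) - fput_force (U t (n - 1)) - Q' t n"

lemma has_derivative_U: "((\<lambda>t. U t n) has_real_derivative U' t n) (at t)"
  using DERIV_cmult[OF deriv_line[of "\<epsilon> * of_int n" \<epsilon> "\<epsilon>^3" t], of \<epsilon>]
  unfolding U_def U'_def gT_def
  by (simp add: distrib_left eval_nat_numeral algebra_simps)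

lemma has_derivative_Q: "((\<lambda>t. Q t n) has_real_derivative Q' t n) (at t)"
proof -
  define v where "v t = g 0 (\<epsilon> * (of_int n + t) - \<epsilon> / 2) (\<epsilon>^3 * t)" for t
  define v' where "v' = \<epsilon> * g 1 (\<epsilon> * (of_int n + t) - \<epsilon> / 2) (\<epsilon>^3 * t) + \<epsilon>^3 * gT (\<epsilon> * (of_int n + t) - \<epsilon> / 2) (\<epsilon>^3 * t)"
  have e: "\<epsilon> * of_int n - \<epsilon> / 2 + \<epsilon> * s = \<epsilon> * (of_int n + s) - \<epsilon> / 2" for s by (simp add: algebra_simps)
  have v: "(v has_real_derivative v') (at t)"
    using deriv_line[of "\<epsilon> * of_int n - \<epsilon> / 2" \<epsilon> "\<epsilon>^3" t] unfolding v_def v'_def gT_def e .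
  have "((\<lambda>t. \<epsilon> * (v t - \<epsilon>^2 / 12 * (v t)^3) - k) has_real_derivative \<epsilon> * (v' - \<epsilon>^2 / 12 * (3 * (v t)^2 * v'))) (at t)"
    by (auto intro!: derivative_eq_intros v)
  moreover have "\<epsilon> * (v' - \<epsilon>^2 / 12 * (3 * (v t)^2 * v')) = Q' t n"
    unfolding Q'_def Let_def v'_def v_def by (simp add: algebra_simps)
  ultimately show ?thesis unfolding Q_def v_def by simp
qed

lemma abs_U_le: "\<bar>U t n\<bar> \<le> \<epsilon> * B"
  using bound_g[of 0] \<epsilon>_pos by (simp add: U_def abs_mult)

lemma abs_gT_le:
  assumes "\<bar>g 1 y T\<bar> \<le> S" "\<bar>g 3 y T\<bar> \<le> S"
  shows "\<bar>gT y T\<bar> \<le> B\<^sup>2 * S / 2"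
proof -
  have S: "0 \<le> S" using assms by linarith
  have "\<bar>(g 0 y T)\<^sup>2 * g 1 y T\<bar> \<le> B\<^sup>2 * S"
    unfolding abs_mult using assms bound_g[of 0 y T] S
    by (intro mult_mono) (auto simp: abs_le_square_iff[symmetric])
  moreover have "S \<le> B\<^sup>2 * S" using S B_powers[of 2] by (simp add: mult_le_cancel_right1)
  ultimately show ?thesis using assms unfolding gT_def by linarith
qed

lemma abs_U'_le: "\<bar>U' t n\<bar> \<le> 2 * \<epsilon>\<^sup>2 * B ^ 3"
proof -
  let ?y = "\<epsilon> * (of_int n + t)" and ?T = "\<epsilon>^3 * t"
  have "\<bar>gT ?y ?T\<bar> \<le> B\<^sup>2 * B / 2" by (rule abs_gT_le) (auto intro: bound_g)
  then have "\<bar>\<epsilon>^4 * gT ?y ?T\<bar> \<le> \<epsilon>^2 * B^3"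
  proof -
    have "\<epsilon>^4 * \<bar>gT ?y ?T\<bar> \<le> \<epsilon>^2 * (B\<^sup>2 * B / 2)"
      using \<open>\<bar>gT ?y ?T\<bar> \<le> B\<^sup>2 * B / 2\<close> \<epsilon>_pos \<epsilon>_le_1 by (intro mult_mono power_decreasing) auto
    also have "\<dots> \<le> \<epsilon>^2 * B^3" using B_ge_1 \<epsilon>_pos by (simp add: eval_nat_numeral)
    finally show ?thesis using \<epsilon>_pos by (simp add: abs_mult)
  qed
  moreover have "\<bar>\<epsilon>^2 * g 1 ?y ?T\<bar> \<le> \<epsilon>^2 * B^3"
  proof -
    have "\<bar>g 1 ?y ?T\<bar> \<le> B^3" using bound_g[of 1 ?y ?T] self_le_power[of B 3] B_ge_1 by simp
    then show ?thesis using \<epsilon>_pos by (simp add: abs_mult)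
  qed
  ultimately show ?thesis unfolding U'_def by linarith
qed

text \<open>The cubic term of \<open>Q\<close> yields exactly the part -f^2 f'/4 of
  \<open>gT\<close>, so the orders \<epsilon>^2 and \<epsilon>^4 cancel and
  \<open>cell_residual\<close> with \<kappa> = 1/12 remains. The stated constant is enlarged so that
  it has the same form as for \<open>R2\<close>.\<close>

lemma residual_bound_R1:
  assumes S: "0 \<le> S" and S': "\<And>j y. \<bar>y - \<epsilon> * (of_int n + t)\<bar> \<le> \<epsilon> / 2 \<Longrightarrow> 1 \<le> j \<Longrightarrow> j \<le> 5 \<Longrightarrow> \<bar>g j y (\<epsilon>^3 * t)\<bar> \<le> S"
  shows "\<bar>R1 t n\<bar> \<le> 2 * \<epsilon>^6 * B^4 * S"
proof -
  have mono: "\<epsilon>^6 * B\<^sup>2 * S \<le> \<epsilon>^6 * B^4 * S"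
    using \<epsilon>_pos S B_ge_1 by (intro mult_right_mono mult_left_mono power_increasing) auto
  have nn: "0 \<le> \<epsilon>^6 * B^4 * S" using \<epsilon>_pos S B_ge_1 by simp
  let ?T = "\<epsilon>^3 * t"
  let ?x = "\<epsilon> * (of_int n + t)"
  have e: "\<epsilon> * (of_int (n + 1) + t) - \<epsilon> / 2 = ?x + \<epsilon> / 2" by (simp add: algebra_simps)
  define A where "A = (\<epsilon> * (g 0 (?x + \<epsilon> / 2) ?T - g 0 (?x - \<epsilon> / 2) ?T)
      - 1/12 * \<epsilon>^3 * ((g 0 (?x + \<epsilon> / 2) ?T)^3 - (g 0 (?x - \<epsilon> / 2) ?T)^3))
     - (\<epsilon>^2 * g 1 ?x ?T + \<epsilon>^4 * (g 3 ?x ?T / 24 - 3 * (1/12) * (g 0 ?x ?T)\<^sup>2 * g 1 ?x ?T))"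
  have "R1 t n = A"
    unfolding A_def R1_def Q_def e U'_def gT_def by (simp add: eval_nat_numeral algebra_simps)
  moreover have "\<bar>A\<bar> \<le> \<epsilon>^6 * B\<^sup>2 * S"
    unfolding A_def by (rule cell_residual[OF \<epsilon>_pos _ _ S S']) auto
  ultimately show "\<bar>R1 t n\<bar> \<le> 2 * \<epsilon>^6 * B^4 * S" using mono nn unfolding mult.assoc by linarith
qed

lemma residual_bound_R2:
  assumes S: "0 \<le> S" and S': "\<And>j y. \<bar>y - (\<epsilon> * (of_int n + t) - \<epsilon> / 2)\<bar> \<le> \<epsilon> / 2 \<Longrightarrow> 1 \<le> j \<Longrightarrow> j \<le> 5 \<Longrightarrow> \<bar>g j y (\<epsilon>^3 * t)\<bar> \<le> S"
  shows "\<bar>R2 t n\<bar> \<le> 2 * \<epsilon>^6 * B^4 * S"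
proof -
  have mono: "\<epsilon>^6 * B\<^sup>2 * S \<le> \<epsilon>^6 * B^4 * S"
    using \<epsilon>_pos S B_ge_1 by (intro mult_right_mono mult_left_mono power_increasing) auto
  have nn: "0 \<le> \<epsilon>^6 * B^4 * S" using \<epsilon>_pos S B_ge_1 by simp
  let ?T = "\<epsilon>^3 * t"
  define x where "x = \<epsilon> * (of_int n + t) - \<epsilon> / 2"
  have e: "\<epsilon> * (of_int n + t) = x + \<epsilon> / 2" "\<epsilon> * (of_int (n - 1) + t) = x - \<epsilon> / 2"
    by (simp_all add: x_def algebra_simps)
  have e': "\<epsilon> * (of_int n + t) - \<epsilon> / 2 = x" by (simp add: x_def)
  note S'' = S'[unfolded e']
  have gx: "\<bar>g 1 x ?T\<bar> \<le> S" "\<bar>g 3 x ?T\<bar> \<le> S" using S''[of x] \<epsilon>_pos by auto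
  define A where "A = (\<epsilon> * (g 0 (x + \<epsilon> / 2) ?T - g 0 (x - \<epsilon> / 2) ?T)
      - 1/6 * \<epsilon>^3 * ((g 0 (x + \<epsilon> / 2) ?T)^3 - (g 0 (x - \<epsilon> / 2) ?T)^3))
     - (\<epsilon>^2 * g 1 x ?T + \<epsilon>^4 * (g 3 x ?T / 24 - 3 * (1/6) * (g 0 x ?T)\<^sup>2 * g 1 x ?T))"
  \<comment> \<open>The coefficient 3 * (1/6) = 1/2 of f^2 f' is met by 1/4 from \<open>gT\<close>
    and 1/4 from differentiating the cubic term of \<open>Q\<close>. What is left over is the
    product of that cubic term's factor f^2/4 with \<open>gT\<close>, already of order
    \<epsilon>^6.\<close>
  have "R2 t n = A + \<epsilon>^6 * ((g 0 x ?T)\<^sup>2 * gT x ?T / 4)"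
    unfolding R2_def U_def fput_force_def A_def Q'_def Let_def e' e gT_def by (simp add: eval_nat_numeral field_simps)
  moreover have "\<bar>A\<bar> \<le> \<epsilon>^6 * B\<^sup>2 * S"
    unfolding A_def by (rule cell_residual[OF \<epsilon>_pos _ _ S S'']) auto
  moreover have "\<bar>\<epsilon>^6 * ((g 0 x ?T)\<^sup>2 * gT x ?T / 4)\<bar> \<le> \<epsilon>^6 * B^4 * S"
  proof -
    have "\<bar>(g 0 x ?T)\<^sup>2 * gT x ?T\<bar> \<le> B\<^sup>2 * (B\<^sup>2 * S / 2)"
      unfolding abs_mult using abs_gT_le[OF gx] bound_g[of 0 x ?T] S
      by (intro mult_mono) (auto simp: abs_le_square_iff[symmetric])
    also have "B\<^sup>2 * (B\<^sup>2 * S / 2) = B^4 * S / 2" by (simp add: eval_nat_numeral)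
    also have "\<dots> \<le> B^4 * S" using S B_ge_1 by simp
    finally have "\<bar>(g 0 x ?T)\<^sup>2 * gT x ?T / 4\<bar> \<le> B^4 * S" by simp
    from mult_left_mono[OF this, of "\<epsilon>^6"] show ?thesis
      using \<epsilon>_pos by (simp add: abs_mult mult.assoc)
  qed
  ultimately show "\<bar>R2 t n\<bar> \<le> 2 * \<epsilon>^6 * B^4 * S" using mono nn unfolding mult.assoc by linarith
qed

text \<open>The two residuals are centred at lattice points and at half-lattice points, so the
  profile is sampled twice. A square sum over the lattice carries 1 / \<epsilon>, since there are
  about 1 / \<epsilon> sites per unit of X; thus \<epsilon>^12 becomes \<epsilon>^11.\<close>

lemma sum_residual_le:
  assumes F: "finite F"
  shows "(\<Sum>n\<in>F. (R1 t n)\<^sup>2 + (R2 t n)\<^sup>2) \<le> 8 * B^8 * S0 * \<epsilon>^11"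
proof -
  let ?T = "\<epsilon>^3 * t"
  obtain s1 where s1: "\<And>n. 0 \<le> s1 n" "\<And>F. finite F \<Longrightarrow> (\<Sum>n\<in>F. (s1 n)\<^sup>2) \<le> S0 / \<epsilon>"
     "\<And>n y j. \<bar>y - (\<epsilon> * t + \<epsilon> * of_int n)\<bar> \<le> \<epsilon> / 2 \<Longrightarrow> 1 \<le> j \<Longrightarrow> j \<le> 5 \<Longrightarrow> \<bar>g j y ?T\<bar> \<le> s1 n"
    using sampling[OF \<epsilon>_pos \<epsilon>_le_1, of "\<epsilon> * t" ?T] by blast
  obtain s2 where s2: "\<And>n. 0 \<le> s2 n" "\<And>F. finite F \<Longrightarrow> (\<Sum>n\<in>F. (s2 n)\<^sup>2) \<le> S0 / \<epsilon>"
     "\<And>n y j. \<bar>y - (\<epsilon> * t - \<epsilon> / 2 + \<epsilon> * of_int n)\<bar> \<le> \<epsilon> / 2 \<Longrightarrow> 1 \<le> j \<Longrightarrow> j \<le> 5 \<Longrightarrow> \<bar>g j y ?T\<bar> \<le> s2 n"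
    using sampling[OF \<epsilon>_pos \<epsilon>_le_1, of "\<epsilon> * t - \<epsilon> / 2" ?T] by blast
  have r1: "\<bar>R1 t n\<bar> \<le> 2 * \<epsilon>^6 * B^4 * s1 n" for n
    by (rule residual_bound_R1[OF s1(1)], rule s1(3)) (auto simp: algebra_simps)
  have r2: "\<bar>R2 t n\<bar> \<le> 2 * \<epsilon>^6 * B^4 * s2 n" for n
    by (rule residual_bound_R2[OF s2(1)], rule s2(3)) (auto simp: algebra_simps)
  have sq: "x\<^sup>2 \<le> 4 * \<epsilon>^12 * B^8 * y\<^sup>2" if "\<bar>x\<bar> \<le> 2 * \<epsilon>^6 * B^4 * y" for x y
  proof -
    have "\<bar>x\<bar>\<^sup>2 \<le> (2 * \<epsilon>^6 * B^4 * y)\<^sup>2" using that by (intro power_mono) auto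
    then show ?thesis by (simp add: power_mult_distrib flip: power_mult)
  qed
  have "(\<Sum>n\<in>F. (R1 t n)\<^sup>2 + (R2 t n)\<^sup>2) \<le> (\<Sum>n\<in>F. 4 * \<epsilon>^12 * B^8 * (s1 n)\<^sup>2 + 4 * \<epsilon>^12 * B^8 * (s2 n)\<^sup>2)"
    by (intro sum_mono add_mono sq r1 r2)
  also have "\<dots> = 4 * \<epsilon>^12 * B^8 * ((\<Sum>n\<in>F. (s1 n)\<^sup>2) + (\<Sum>n\<in>F. (s2 n)\<^sup>2))"
    by (simp add: sum.distrib sum_distrib_left distrib_left)
  also have "\<dots> \<le> 4 * \<epsilon>^12 * B^8 * (S0 / \<epsilon> + S0 / \<epsilon>)"
    using s1(2)[OF F] s2(2)[OF F] \<epsilon>_pos by (intro mult_left_mono add_mono) auto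
  also have "\<dots> = 8 * B^8 * S0 * \<epsilon>^11"
    using \<epsilon>_pos by (simp add: eval_nat_numeral)
  finally show ?thesis .
qed

text \<open>The velocity is to be compared with \<epsilon>^2 f', while the ansatz moves with
  \<open>U'\<close>. The extra term \<epsilon>^4 \<open>gT\<close> has square sum of order
  \<epsilon>^7, well below \<epsilon>^5.\<close>

lemma sum_velocity_correction_le:
  assumes F: "finite F"
  shows "(\<Sum>n\<in>F. (U' t n - \<epsilon>\<^sup>2 * g 1 (\<epsilon> * (of_int n + t)) (\<epsilon>^3 * t))\<^sup>2) \<le> B^4 * S0 * \<epsilon>^7"
proof -
  let ?T = "\<epsilon>^3 * t"
  obtain s where s: "\<And>n. 0 \<le> s n" "\<And>F. finite F \<Longrightarrow> (\<Sum>n\<in>F. (s n)\<^sup>2) \<le> S0 / \<epsilon>"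
     "\<And>n y j. \<bar>y - (\<epsilon> * t + \<epsilon> * of_int n)\<bar> \<le> \<epsilon> / 2 \<Longrightarrow> 1 \<le> j \<Longrightarrow> j \<le> 5 \<Longrightarrow> \<bar>g j y ?T\<bar> \<le> s n"
    using sampling[OF \<epsilon>_pos \<epsilon>_le_1, of "\<epsilon> * t" ?T] by blast
  have "(U' t n - \<epsilon>\<^sup>2 * g 1 (\<epsilon> * (of_int n + t)) ?T)\<^sup>2 \<le> \<epsilon>^8 * B^4 * (s n)\<^sup>2" for n
  proof -
    let ?x = "\<epsilon> * (of_int n + t)"
    have "\<bar>g j ?x ?T\<bar> \<le> s n" if "1 \<le> j" "j \<le> 5" for j
      using s(3)[of ?x n j] that \<epsilon>_pos by (simp add: algebra_simps)
    then have "\<bar>gT ?x ?T\<bar> \<le> B\<^sup>2 * s n / 2" by (intro abs_gT_le) auto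
    then have "\<bar>gT ?x ?T\<bar>\<^sup>2 \<le> (B\<^sup>2 * s n)\<^sup>2"
      using s(1)[of n] by (intro power_mono) auto
    then have "\<epsilon>^8 * (gT ?x ?T)\<^sup>2 \<le> \<epsilon>^8 * (B^4 * (s n)\<^sup>2)"
      using \<epsilon>_pos by (intro mult_left_mono) (auto simp: power_mult_distrib simp flip: power_mult)
    then show ?thesis unfolding U'_def by (simp add: power_mult_distrib mult.assoc flip: power_mult)
  qed
  then have "(\<Sum>n\<in>F. (U' t n - \<epsilon>\<^sup>2 * g 1 (\<epsilon> * (of_int n + t)) ?T)\<^sup>2) \<le> (\<Sum>n\<in>F. \<epsilon>^8 * B^4 * (s n)\<^sup>2)"
    by (rule sum_mono)
  also have "\<dots> = \<epsilon>^8 * B^4 * (\<Sum>n\<in>F. (s n)\<^sup>2)" by (simp add: sum_distrib_left)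
  also have "\<dots> \<le> \<epsilon>^8 * B^4 * (S0 / \<epsilon>)" using s(2)[OF F] \<epsilon>_pos by (intro mult_left_mono) auto
  also have "\<dots> = B^4 * S0 * \<epsilon>^7" using \<epsilon>_pos by (simp add: eval_nat_numeral)
  finally show ?thesis .
qed

end

section \<open>Initial data\<close>

lemma infsum_superset_close:
  fixes f :: "'a \<Rightarrow> real"
  assumes f: "(f has_sum s) UNIV" and e: "e > 0"
  obtains F0 where "finite F0" "\<And>A. F0 \<subseteq> A \<Longrightarrow> \<bar>infsum f A - s\<bar> \<le> e"
proof -
  have "eventually (\<lambda>F. dist (sum f F) s < e) (finite_subsets_at_top UNIV)"
    using f e by (simp add: has_sum_def tendsto_iff)
  then obtain F0 where F0: "finite F0" "\<And>F. finite F \<Longrightarrow> F0 \<subseteq> F \<Longrightarrow> dist (sum f F) s < e"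
    by (auto simp: eventually_finite_subsets_at_top)
  show thesis
  proof (rule that[OF F0(1)])
    fix A assume A: "F0 \<subseteq> A"
    have "f summable_on A"
      using f summable_on_subset[of f UNIV A] by (auto simp: summable_on_def)
    then have "(sum f \<longlongrightarrow> infsum f A) (finite_subsets_at_top A)"
      using has_sum_infsum by (auto simp: has_sum_def)
    then have "((\<lambda>F. \<bar>sum f F - s\<bar>) \<longlongrightarrow> \<bar>infsum f A - s\<bar>) (finite_subsets_at_top A)"
      by (intro tendsto_intros)
    moreover have "eventually (\<lambda>F. \<bar>sum f F - s\<bar> \<le> e) (finite_subsets_at_top A)"
      unfolding eventually_finite_subsets_at_top
      using F0 A by (intro exI[of _ F0]) (auto simp: dist_real_def less_imp_le)
    ultimately show "\<bar>infsum f A - s\<bar> \<le> e"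
      by (intro tendsto_upperbound) auto
  qed
qed

lemma infsum_lessThan_tendsto:
  fixes v :: "int \<Rightarrow> real"
  assumes v: "(v has_sum s) UNIV"
  shows "(\<lambda>m. infsum v {..<int m}) \<longlonglongrightarrow> s" and "(\<lambda>m. infsum v {..<- int m}) \<longlonglongrightarrow> 0"
proof -
  have bdd: "\<exists>M. \<forall>k\<in>F0. \<bar>k\<bar> < int M" if "finite F0" for F0
  proof -
    have "bdd_above (abs ` F0)" using that by simp
    then obtain b where "\<And>k. k \<in> F0 \<Longrightarrow> \<bar>k\<bar> \<le> b" by (auto simp: bdd_above_def)
    then show ?thesis by (intro exI[of _ "Suc (nat b)"]) force
  qed
  show "(\<lambda>m. infsum v {..<int m}) \<longlonglongrightarrow> s"
  proof (rule LIMSEQ_I)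
    fix e :: real assume "0 < e"
    then obtain F0 where F0: "finite F0" "\<And>A. F0 \<subseteq> A \<Longrightarrow> \<bar>infsum v A - s\<bar> \<le> e / 2"
      using infsum_superset_close[OF v, of "e / 2"] by auto
    obtain M where M: "\<And>k. k \<in> F0 \<Longrightarrow> \<bar>k\<bar> < int M" using bdd[OF F0(1)] by blast
    have "norm (infsum v {..<int m} - s) < e" if "M \<le> m" for m
    proof -
      have "F0 \<subseteq> {..<int m}" using M that by fastforce
      from F0(2)[OF this] show ?thesis using \<open>0 < e\<close> by simp
    qed
    then show "\<exists>M. \<forall>m\<ge>M. norm (infsum v {..<int m} - s) < e" by blast
  qed
  show "(\<lambda>m. infsum v {..<- int m}) \<longlonglongrightarrow> 0"
  proof (rule LIMSEQ_I)
    fix e :: real assume "0 < e"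
    then obtain F0 where F0: "finite F0" "\<And>A. F0 \<subseteq> A \<Longrightarrow> \<bar>infsum v A - s\<bar> \<le> e / 2"
      using infsum_superset_close[OF v, of "e / 2"] by auto
    obtain M where M: "\<And>k. k \<in> F0 \<Longrightarrow> \<bar>k\<bar> < int M" using bdd[OF F0(1)] by blast
    have "norm (infsum v {..<- int m} - 0) < e" if "M \<le> m" for m
    proof -
      have su: "v summable_on A" for A
        using v summable_on_subset[of v UNIV A] by (auto simp: summable_on_def)
      have "infsum v ({..<- int m} \<union> {- int m..}) = infsum v {..<- int m} + infsum v {- int m..}"
        by (intro infsum_Un_disjoint su) auto
      moreover have "{..<- int m} \<union> {- int m..} = UNIV" by auto
      moreover have "infsum v UNIV = s" using v by (rule infsumI)
      moreover have "F0 \<subseteq> {- int m..}" using M that by fastforce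
      ultimately show ?thesis using F0(2)[of "{- int m..}"] \<open>0 < e\<close> by simp
    qed
    then show "\<exists>M. \<forall>m\<ge>M. norm (infsum v {..<- int m} - 0) < e" by blast
  qed
qed

text \<open>From n to n + j the increments are bounded by \<Phi> n - \<Phi> (n + j), and \<zeta> (n
  + j) vanishes in the limit. A potential \<Phi> replaces the summation of tails.\<close>

lemma null_sequence_le_of_increments:
  fixes \<zeta> \<Phi> :: "nat \<Rightarrow> real"
  assumes lim: "\<zeta> \<longlonglongrightarrow> 0" and inc: "\<And>k. \<bar>\<zeta> (Suc k) - \<zeta> k\<bar> \<le> \<Phi> k - \<Phi> (Suc k)" and nn: "\<And>k. 0 \<le> \<Phi> k"
  shows "\<bar>\<zeta> n\<bar> \<le> \<Phi> n"
proof -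
  have "\<bar>\<zeta> n\<bar> \<le> \<bar>\<zeta> (n + j)\<bar> + (\<Phi> n - \<Phi> (n + j))" for j
  proof (induction j)
    case (Suc j)
    then show ?case using inc[of "n + j"] by simp
  qed simp
  then have "\<bar>\<zeta> n\<bar> \<le> \<bar>\<zeta> (n + j)\<bar> + \<Phi> n" for j
    using nn[of "n + j"] by (smt (verit))
  moreover have "(\<lambda>j. \<bar>\<zeta> (n + j)\<bar> + \<Phi> n) \<longlonglongrightarrow> \<bar>0\<bar> + \<Phi> n"
    using LIMSEQ_ignore_initial_segment[OF lim, of n] by (intro tendsto_intros) (simp add: add.commute)
  ultimately show ?thesis
    by (intro tendsto_lowerbound[of "\<lambda>j. \<bar>\<zeta> (n + j)\<bar> + \<Phi> n" "\<Phi> n" sequentially]) auto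
qed

text \<open>Discrete counterpart of the primitive -1 / (\<epsilon> (1 + \<epsilon> x)) of 1 / (1 +
  \<epsilon> x)^2. The shift by one site costs the factor 2, because \<epsilon> \<le> 1 \<le> 1 +
  \<epsilon> k; the second bound loses another 2 through (1 + y)^2 \<le> 2 (1 + y^2).\<close>

lemma inverse_square_le_telescope:
  fixes \<epsilon> :: real and k :: nat
  assumes \<epsilon>: "0 < \<epsilon>" "\<epsilon> \<le> 1"
  shows "1 / (1 + \<epsilon> * real k)\<^sup>2 \<le> 2 / \<epsilon> * (1 / (1 + \<epsilon> * real k) - 1 / (1 + \<epsilon> * real (Suc k)))"
    and "1 / (1 + (\<epsilon> * real k)\<^sup>2) \<le> 4 / \<epsilon> * (1 / (1 + \<epsilon> * real k) - 1 / (1 + \<epsilon> * real (Suc k)))"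
proof -
  define a where "a = 1 + \<epsilon> * real k"
  have a: "1 \<le> a" using \<epsilon> by (simp add: a_def)
  have s: "1 + \<epsilon> * real (Suc k) = a + \<epsilon>" by (simp add: a_def algebra_simps)
  have "2 / \<epsilon> * (1 / a - 1 / (a + \<epsilon>)) = 2 / (a * (a + \<epsilon>))"
    using a \<epsilon> by (simp add: field_simps)
  moreover have "1 / a\<^sup>2 \<le> 2 / (a * (a + \<epsilon>))"
  proof -
    have "a * (a + \<epsilon>) \<le> a * (2 * a)" using a \<epsilon> by (intro mult_left_mono) auto
    then have "2 / (a * (2 * a)) \<le> 2 / (a * (a + \<epsilon>))" using a \<epsilon> by (intro divide_left_mono) auto
    then show ?thesis by (simp add: power2_eq_square)
  qed
  ultimately have 1: "1 / a\<^sup>2 \<le> 2 / \<epsilon> * (1 / a - 1 / (a + \<epsilon>))" by simp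
  then show "1 / (1 + \<epsilon> * real k)\<^sup>2 \<le> 2 / \<epsilon> * (1 / (1 + \<epsilon> * real k) - 1 / (1 + \<epsilon> * real (Suc k)))"
    unfolding s a_def[symmetric] .
  have "a\<^sup>2 \<le> 2 * (1 + (\<epsilon> * real k)\<^sup>2)"
    using zero_le_power2[of "1 - \<epsilon> * real k"] unfolding a_def by (simp add: power2_eq_square algebra_simps)
  moreover have "0 < a\<^sup>2" using a by simp
  ultimately have "2 / (2 * (1 + (\<epsilon> * real k)\<^sup>2)) \<le> 2 / a\<^sup>2"
    by (intro divide_left_mono mult_pos_pos) (auto simp: add_pos_nonneg)
  moreover have "2 * 1 / (2 * (1 + (\<epsilon> * real k)\<^sup>2)) = 1 / (1 + (\<epsilon> * real k)\<^sup>2)"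
    by (rule mult_divide_mult_cancel_left) simp
  ultimately have "1 / (1 + (\<epsilon> * real k)\<^sup>2) \<le> 2 * (1 / a\<^sup>2)" by simp
  also have "\<dots> \<le> 2 * (2 / \<epsilon> * (1 / a - 1 / (a + \<epsilon>)))" using 1 by linarith
  also have "\<dots> = 4 / \<epsilon> * (1 / a - 1 / (a + \<epsilon>))" by simp
  finally show "1 / (1 + (\<epsilon> * real k)\<^sup>2) \<le> 4 / \<epsilon> * (1 / (1 + \<epsilon> * real k) - 1 / (1 + \<epsilon> * real (Suc k)))"
    unfolding s a_def[symmetric] .
qed

lemma sum_inverse_square_le:
  fixes \<epsilon> :: real
  assumes \<epsilon>: "0 < \<epsilon>" "\<epsilon> \<le> 1" and F: "finite (F :: int set)"
  shows "(\<Sum>n\<in>F. 1 / (1 + \<epsilon> * \<bar>of_int n\<bar>)\<^sup>2) \<le> 4 / \<epsilon>"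
proof -
  define \<psi> where "\<psi> k = 1 / (1 + \<epsilon> * real k)\<^sup>2" for k
  have \<psi>0: "0 \<le> \<psi> k" for k by (simp add: \<psi>_def)
  have partial: "(\<Sum>k<N. \<psi> k) \<le> 2 / \<epsilon>" for N
  proof -
    have "(\<Sum>k<N. \<psi> k) \<le> (\<Sum>k<N. 2 / \<epsilon> * (1 / (1 + \<epsilon> * real k) - 1 / (1 + \<epsilon> * real (Suc k))))"
      unfolding \<psi>_def by (intro sum_mono inverse_square_le_telescope \<epsilon>)
    also have "\<dots> = 2 / \<epsilon> * (1 - 1 / (1 + \<epsilon> * real N))"
    proof -
      have "(\<Sum>k<N. 1 / (1 + \<epsilon> * real k) - 1 / (1 + \<epsilon> * real (Suc k))) = 1 - 1 / (1 + \<epsilon> * real N)"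
        using sum_lessThan_telescope'[of "\<lambda>k. 1 / (1 + \<epsilon> * real k)" N] by simp
      then show ?thesis by (simp only: sum_distrib_left[symmetric])
    qed
    also have "\<dots> \<le> 2 / \<epsilon> * 1" using \<epsilon> by (intro mult_left_mono) auto
    finally show ?thesis by simp
  qed
  have nat_sum: "(\<Sum>k\<in>A. \<psi> k) \<le> 2 / \<epsilon>" if "finite A" for A
  proof -
    obtain N where "A \<subseteq> {..<N}" using finite_nat_iff_bounded \<open>finite A\<close> by blast
    then have "(\<Sum>k\<in>A. \<psi> k) \<le> (\<Sum>k<N. \<psi> k)" by (intro sum_mono2) (auto simp: \<psi>0)
    then show ?thesis using partial[of N] by linarith
  qed
  have half: "(\<Sum>n\<in>G. \<psi> (nat \<bar>n\<bar>)) \<le> 2 / \<epsilon>" if "finite G" "inj_on (\<lambda>n. nat \<bar>n\<bar>) G" for G :: "int set"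
    using sum.reindex[OF that(2), of \<psi>] nat_sum[of "(\<lambda>n. nat \<bar>n\<bar>) ` G"] that(1) by (simp add: o_def)
  have "(\<Sum>n\<in>F. 1 / (1 + \<epsilon> * \<bar>of_int n\<bar>)\<^sup>2) = (\<Sum>n\<in>F. \<psi> (nat \<bar>n\<bar>))"
    by (simp add: \<psi>_def)
  also have "\<dots> = (\<Sum>n\<in>F \<inter> {0..}. \<psi> (nat \<bar>n\<bar>)) + (\<Sum>n\<in>F \<inter> {..<0}. \<psi> (nat \<bar>n\<bar>))"
  proof -
    have "(F \<inter> {0..}) \<union> (F \<inter> {..<0}) = F" by auto
    then show ?thesis
      using sum.union_disjoint[of "F \<inter> {0..}" "F \<inter> {..<0}" "\<lambda>n. \<psi> (nat \<bar>n\<bar>)"] F by force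
  qed
  also have "\<dots> \<le> 2 / \<epsilon> + 2 / \<epsilon>"
    using F by (intro add_mono half) (auto simp: inj_on_def)
  finally show ?thesis by simp
qed

section \<open>Mismatch of the ansatz at time zero\<close>

context mkdv_ansatz
begin

text \<open>The data are close to \<epsilon>^2 f', not to \<open>U'\<close>, so the mismatch with
  the increments of \<open>Q\<close> at time 0 is of order \<epsilon>^4 only. The spatial decay of
  f' and f''' makes up for this when the increments are summed.\<close>

lemma initial_increment_bound:
  fixes m :: int
  assumes decay: "\<And>x j. j \<in> {1, 3} \<Longrightarrow> \<bar>g j x 0\<bar> \<le> A / (1 + x\<^sup>2)" and A: "0 \<le> A"
  shows "\<bar>\<epsilon>\<^sup>2 * g 1 (\<epsilon> * of_int m) 0 - (Q 0 (m + 1) - Q 0 m)\<bar> \<le> 2 * A * B\<^sup>2 * \<epsilon>^4 / (1 + (\<epsilon> * of_int m)\<^sup>2)"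
proof -
  define x where "x = \<epsilon> * of_int m"
  define S where "S = 2 * A / (1 + x\<^sup>2)"
  let ?h = "\<epsilon> / 2"
  have h: "0 < ?h" using \<epsilon>_pos by simp
  have S: "\<bar>g j y 0\<bar> \<le> S" if y: "\<bar>y - x\<bar> \<le> ?h" and j: "j \<in> {1, 3}" for y j
  proof -
    \<comment> \<open>Within half a lattice spacing the decay factor changes by at most 2, which is
      the 2 in \<open>S\<close>.\<close>
    have "(x - y)\<^sup>2 \<le> (1/2)\<^sup>2"
      using y \<epsilon>_le_1 by (intro abs_le_square_iff[THEN iffD1]) linarith
    then have "1 + x\<^sup>2 \<le> 2 * (1 + y\<^sup>2)"
      using zero_le_power2[of "2 * y - x"] by (simp add: power2_eq_square algebra_simps)
    moreover have "0 < 1 + x\<^sup>2" "0 < 1 + y\<^sup>2" by (simp_all add: add_pos_nonneg)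
    ultimately have "2 * A / (2 * (1 + y\<^sup>2)) \<le> 2 * A / (1 + x\<^sup>2)"
      using A by (intro divide_left_mono mult_pos_pos) auto
    moreover have "2 * A / (2 * (1 + y\<^sup>2)) = A / (1 + y\<^sup>2)"
      by (rule mult_divide_mult_cancel_left) simp
    ultimately have "A / (1 + y\<^sup>2) \<le> S" by (simp only: S_def)
    with decay[OF j, of y] show ?thesis by (rule order_trans)
  qed
  have S0: "0 \<le> S" using A by (simp add: S_def add_nonneg_nonneg)
  have a: "\<bar>g 0 (x + ?h) 0 - g 0 (x - ?h) 0 - 2 * ?h * g 1 x 0\<bar> \<le> ?h^3 / 3 * S"
    using centered_difference_order3[of "\<lambda>j x. g j x 0", OF deriv_x h] S by simp
  \<comment> \<open>A mean value bound of order \<epsilon> suffices: with the prefactor \<epsilon>^3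
    / 12 it has the order \<epsilon>^4 of the whole mismatch.\<close>
  have b: "\<bar>(g 0 (x + ?h) 0)^3 - (g 0 (x - ?h) 0)^3\<bar> \<le> \<epsilon> * (3 * B\<^sup>2 * S)"
  proof -
    have d: "((\<lambda>x. (g 0 x 0)^3) has_real_derivative 3 * (g 0 y 0)\<^sup>2 * g 1 y 0) (at y)" for y
      using deriv_x[of 0 0 y] by (auto intro!: derivative_eq_intros)
    obtain z where z: "x - ?h < z" "z < x + ?h"
      "(g 0 (x + ?h) 0)^3 - (g 0 (x - ?h) 0)^3 = (x + ?h - (x - ?h)) * (3 * (g 0 z 0)\<^sup>2 * g 1 z 0)"
      using MVT2[of "x - ?h" "x + ?h" "\<lambda>x. (g 0 x 0)^3" "\<lambda>y. 3 * (g 0 y 0)\<^sup>2 * g 1 y 0"] d \<epsilon>_pos by auto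
    have "\<bar>z - x\<bar> \<le> ?h" using z(1,2) by linarith
    then have gz: "\<bar>g 1 z 0\<bar> \<le> S" by (rule S) simp
    have "\<bar>(g 0 z 0)\<^sup>2 * g 1 z 0\<bar> \<le> B\<^sup>2 * S"
      unfolding abs_mult using gz bound_g[of 0 z 0] S0
      by (intro mult_mono) (auto simp: abs_le_square_iff[symmetric])
    then have "\<epsilon> * \<bar>3 * (g 0 z 0)\<^sup>2 * g 1 z 0\<bar> \<le> \<epsilon> * (3 * B\<^sup>2 * S)"
      using \<epsilon>_pos by (intro mult_left_mono) (auto simp: abs_mult)
    then show ?thesis using z(3) \<epsilon>_pos by (simp add: abs_mult)
  qed
  define A1 where "A1 = g 0 (x + ?h) 0 - g 0 (x - ?h) 0 - 2 * ?h * g 1 x 0"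
  define A2 where "A2 = (g 0 (x + ?h) 0)^3 - (g 0 (x - ?h) 0)^3"
  have e1: "\<epsilon> * (of_int (m + 1) + 0) - \<epsilon> / 2 = x + ?h" and e2: "\<epsilon> * (of_int m + 0) - \<epsilon> / 2 = x - ?h"
    by (simp_all add: x_def algebra_simps)
  have "\<epsilon>\<^sup>2 * g 1 x 0 - (Q 0 (m + 1) - Q 0 m) = \<epsilon>^3 / 12 * A2 - \<epsilon> * A1"
    unfolding Q_def e1 e2 A1_def A2_def mult_zero_right by (simp add: eval_nat_numeral algebra_simps)
  moreover have "\<bar>\<epsilon> * A1\<bar> \<le> \<epsilon> * (?h^3 / 3 * S)"
    using a \<epsilon>_pos unfolding A1_def[symmetric] abs_mult by (intro mult_mono) auto
  moreover have "\<bar>\<epsilon>^3 / 12 * A2\<bar> \<le> \<epsilon>^3 / 12 * (\<epsilon> * (3 * B\<^sup>2 * S))"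
    using b \<epsilon>_pos unfolding A2_def[symmetric] abs_mult by (intro mult_mono) auto
  moreover have "\<epsilon> * (?h^3 / 3 * S) \<le> \<epsilon>^4 * B\<^sup>2 * S / 24"
  proof -
    have "\<epsilon>^4 * S * 1 \<le> \<epsilon>^4 * S * B\<^sup>2" using B_powers[of 2] S0 \<epsilon>_pos by (intro mult_left_mono) auto
    then have "\<epsilon>^4 * S * 1 / 24 \<le> \<epsilon>^4 * S * B\<^sup>2 / 24" by (rule divide_right_mono) simp
    moreover have "\<epsilon> * (?h^3 / 3 * S) = \<epsilon>^4 * S * 1 / 24" by (simp add: eval_nat_numeral)
    ultimately show ?thesis by (simp only: mult_ac)
  qed
  moreover have "\<epsilon>^3 / 12 * (\<epsilon> * (3 * B\<^sup>2 * S)) = \<epsilon>^4 * B\<^sup>2 * S / 4" by (simp add: eval_nat_numeral)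
  moreover have "0 \<le> \<epsilon>^4 * B\<^sup>2 * S" using S0 \<epsilon>_pos by simp
  ultimately have "\<bar>\<epsilon>\<^sup>2 * g 1 x 0 - (Q 0 (m + 1) - Q 0 m)\<bar> \<le> \<epsilon>^4 * B\<^sup>2 * S" by linarith
  also have "\<epsilon>^4 * B\<^sup>2 * S = 2 * A * B\<^sup>2 * \<epsilon>^4 / (1 + x\<^sup>2)" by (simp add: S_def)
  finally show ?thesis by (simp add: x_def)
qed

text \<open>The error q(0) - Q(0) vanishes at both ends: at -\<infinity> by the choice of k, at
  +\<infinity> by the prescribed total of the velocities. Its increments are at most D / (1 + n^2)
  from the weighted data error plus a multiple of \<epsilon>^4 / (1 + (\<epsilon> n)^2) from the
  ansatz. Summing from the nearer end gives decay like D / (1 + |n|) and \<epsilon>^3 / (1 +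
  \<epsilon> |n|). The squares of these sum to order D^2 and \<epsilon>^6 / \<epsilon>, that is,
  \<epsilon>^5 in both cases.\<close>

lemma initial_momentum_bound:
  assumes decay: "\<And>x j. j \<in> {1, 3} \<Longrightarrow> \<bar>g j x 0\<bar> \<le> A / (1 + x\<^sup>2)" and A: "0 \<le> A"
    and limp: "((\<lambda>x. g 0 x 0) \<longlongrightarrow> fp) at_top" and limm: "((\<lambda>x. g 0 x 0) \<longlongrightarrow> fm) at_bot"
    and k: "k = \<epsilon> * (fm - \<epsilon>\<^sup>2 / 12 * fm^3)"
    and v: "(v has_sum (\<epsilon> * (fp - \<epsilon>\<^sup>2 / 12 * fp^3) - k)) UNIV"
    and e: "\<And>n. (1 + (of_int n)\<^sup>2) * \<bar>v n - \<epsilon>\<^sup>2 * g 1 (\<epsilon> * of_int n) 0\<bar> \<le> D"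
    and D: "D\<^sup>2 = \<epsilon>^5"
    and F: "finite F"
  shows "(\<Sum>n\<in>F. (infsum v {..<n} - Q 0 n)\<^sup>2) \<le> 128 * (1 + 4 * A\<^sup>2 * B^4) * \<epsilon>^5"
proof -
  define \<sigma> where "\<sigma> = \<epsilon> * (fp - \<epsilon>\<^sup>2 / 12 * fp^3) - k"
  define \<xi> where "\<xi> n = infsum v {..<n} - Q 0 n" for n
  define D2 where "D2 = 2 * A * B\<^sup>2"
  have D0: "0 \<le> D" using order_trans[OF _ e[of 0]] by simp
  have D20: "0 \<le> D2" using A by (simp add: D2_def)
  \<comment> \<open>Two scales are superposed: lattice scale for the data error, scale 1 /
    \<epsilon> for the ansatz. The factor \<open>1 * real m\<close> keeps the first in the shape of
    the second, so the same telescoping lemma serves both.\<close>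
  define \<Phi> where "\<Phi> m = 4 * D * (1 / (1 + 1 * real m)) + 4 * (D2 * \<epsilon>^3) * (1 / (1 + \<epsilon> * real m))" for m
  have inc: "\<bar>\<xi> (n + 1) - \<xi> n\<bar> \<le> D * (1 / (1 + (of_int n)\<^sup>2)) + D2 * \<epsilon>^4 * (1 / (1 + (\<epsilon> * of_int n)\<^sup>2))" for n
  proof -
    have su: "v summable_on A" for A
      using v summable_on_subset[of v UNIV A] by (auto simp: summable_on_def)
    have "{..<n + 1} = {..<n} \<union> {n}" by auto
    then have "infsum v {..<n + 1} = infsum v {..<n} + infsum v {n}"
      by (simp only:) (intro infsum_Un_disjoint su, auto)
    then have "\<xi> (n + 1) - \<xi> n = (v n - \<epsilon>\<^sup>2 * g 1 (\<epsilon> * of_int n) 0) + (\<epsilon>\<^sup>2 * g 1 (\<epsilon> * of_int n) 0 - (Q 0 (n + 1) - Q 0 n))"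
      by (simp add: \<xi>_def)
    moreover have "\<bar>v n - \<epsilon>\<^sup>2 * g 1 (\<epsilon> * of_int n) 0\<bar> \<le> D * (1 / (1 + (of_int n)\<^sup>2))"
    proof -
      have "0 < 1 + (of_int n :: real)\<^sup>2" by (simp add: add_pos_nonneg)
      then show ?thesis using e[of n] by (simp add: pos_le_divide_eq mult.commute)
    qed
    moreover have "\<bar>\<epsilon>\<^sup>2 * g 1 (\<epsilon> * of_int n) 0 - (Q 0 (n + 1) - Q 0 n)\<bar> \<le> D2 * \<epsilon>^4 * (1 / (1 + (\<epsilon> * of_int n)\<^sup>2))"
      using initial_increment_bound[OF decay A, of n] by (simp add: D2_def)
    ultimately show ?thesis by linarith
  qed
  have \<Phi>: "D * (1 / (1 + (real m)\<^sup>2)) + D2 * \<epsilon>^4 * (1 / (1 + (\<epsilon> * real m)\<^sup>2)) \<le> \<Phi> m - \<Phi> (Suc m)" for m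
  proof -
    let ?p = "1 / (1 + 1 * real m) - 1 / (1 + 1 * real (Suc m))" and ?q = "1 / (1 + \<epsilon> * real m) - 1 / (1 + \<epsilon> * real (Suc m))"
    have "D * (1 / (1 + (1 * real m)\<^sup>2)) \<le> D * (4 / 1 * ?p)"
      by (intro mult_left_mono inverse_square_le_telescope D0) auto
    also have "D * (4 / 1 * ?p) = 4 * D * ?p" by (simp only: mult_ac div_by_1)
    finally have 1: "D * (1 / (1 + (real m)\<^sup>2)) \<le> 4 * D * ?p" by (simp only: mult_1)
    have "D2 * \<epsilon>^4 * (1 / (1 + (\<epsilon> * real m)\<^sup>2)) \<le> D2 * \<epsilon>^4 * (4 / \<epsilon> * ?q)"
      using D20 \<epsilon>_pos \<epsilon>_le_1 by (intro mult_left_mono inverse_square_le_telescope) auto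
    also have "\<dots> = 4 * (D2 * \<epsilon>^3) * ?q"
    proof -
      have "D2 * \<epsilon>^4 * (4 / \<epsilon> * z) = 4 * (D2 * \<epsilon>^3) * z" for z
        using \<epsilon>_pos by (simp add: eval_nat_numeral)
      then show ?thesis .
    qed
    finally have 2: "D2 * \<epsilon>^4 * (1 / (1 + (\<epsilon> * real m)\<^sup>2)) \<le> 4 * (D2 * \<epsilon>^3) * ?q" .
    have "\<Phi> m - \<Phi> (Suc m) = 4 * D * ?p + 4 * (D2 * \<epsilon>^3) * ?q"
      unfolding \<Phi>_def by (simp only: right_diff_distrib)
    with add_mono[OF 1 2] show ?thesis by (simp only:)
  qed
  have \<Phi>0: "0 \<le> \<Phi> m" for m using D0 D20 \<epsilon>_pos by (simp add: \<Phi>_def)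
  have Qlim: "(\<lambda>m. Q 0 (int m)) \<longlonglongrightarrow> \<sigma>" "(\<lambda>m. Q 0 (- int m)) \<longlonglongrightarrow> 0"
  proof -
    have "filterlim (\<lambda>m::nat. \<epsilon> * real m) at_top sequentially"
      by (rule filterlim_tendsto_pos_mult_at_top[OF tendsto_const \<epsilon>_pos filterlim_real_sequentially])
    note lin = filterlim_tendsto_add_at_top[OF tendsto_const this]
    have "filterlim (\<lambda>m::nat. - \<epsilon> / 2 + \<epsilon> * real m) at_top sequentially" by (rule lin)
    from filterlim_compose[OF limp this]
    have "(\<lambda>m. \<epsilon> * (g 0 (- \<epsilon> / 2 + \<epsilon> * real m) 0 - \<epsilon>^2 / 12 * (g 0 (- \<epsilon> / 2 + \<epsilon> * real m) 0)^3) - k) \<longlonglongrightarrow> \<sigma>"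
      unfolding \<sigma>_def by (intro tendsto_intros)
    moreover have "- \<epsilon> / 2 + \<epsilon> * real m = \<epsilon> * (of_int (int m) + 0) - \<epsilon> / 2" for m by (simp add: algebra_simps)
    ultimately show "(\<lambda>m. Q 0 (int m)) \<longlonglongrightarrow> \<sigma>" by (simp only: Q_def mult_zero_right)
    have "filterlim (\<lambda>m::nat. \<epsilon> / 2 + \<epsilon> * real m) at_top sequentially" by (rule lin)
    then have "filterlim (\<lambda>m::nat. - (\<epsilon> / 2 + \<epsilon> * real m)) at_bot sequentially"
      by (simp only: filterlim_uminus_at_bot minus_minus)
    from filterlim_compose[OF limm this]
    have "(\<lambda>m. \<epsilon> * (g 0 (- (\<epsilon> / 2 + \<epsilon> * real m)) 0 - \<epsilon>^2 / 12 * (g 0 (- (\<epsilon> / 2 + \<epsilon> * real m)) 0)^3) - k)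
       \<longlonglongrightarrow> \<epsilon> * (fm - \<epsilon>^2 / 12 * fm^3) - k"
      by (intro tendsto_intros)
    moreover have "- (\<epsilon> / 2 + \<epsilon> * real m) = \<epsilon> * (of_int (- int m) + 0) - \<epsilon> / 2" for m by (simp add: algebra_simps)
    ultimately show "(\<lambda>m. Q 0 (- int m)) \<longlonglongrightarrow> 0"
      by (simp only: Q_def mult_zero_right right_minus_eq[THEN iffD2, OF k[symmetric]])
  qed
  have right: "\<bar>\<xi> (int m)\<bar> \<le> \<Phi> m" for m
  proof (rule null_sequence_le_of_increments[of "\<lambda>m. \<xi> (int m)"])
    show "(\<lambda>m. \<xi> (int m)) \<longlonglongrightarrow> 0"
      using tendsto_diff[OF infsum_lessThan_tendsto(1)[OF v, folded \<sigma>_def] Qlim(1)] by (simp add: \<xi>_def)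
    show "\<bar>\<xi> (int (Suc m)) - \<xi> (int m)\<bar> \<le> \<Phi> m - \<Phi> (Suc m)" for m
      using inc[of "int m"] \<Phi>[of m] by (simp add: add.commute)
  qed (rule \<Phi>0)
  \<comment> \<open>On the left the increment from -(m + 1) to -m carries the decay factor of site m
    + 1; by monotonicity it is bounded by that of m, which is the one in \<Phi>.\<close>
  have left: "\<bar>\<xi> (- int m)\<bar> \<le> \<Phi> m" for m
  proof (rule null_sequence_le_of_increments[of "\<lambda>m. \<xi> (- int m)"])
    show "(\<lambda>m. \<xi> (- int m)) \<longlonglongrightarrow> 0"
      using tendsto_diff[OF infsum_lessThan_tendsto(2)[OF v] Qlim(2)] by (simp add: \<xi>_def)
    fix m
    have mono: "1 / (1 + (c * real (Suc m))\<^sup>2) \<le> 1 / (1 + (c * real m)\<^sup>2)" if "0 \<le> c" for c :: real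
    proof -
      have "(c * real m)\<^sup>2 \<le> (c * real (Suc m))\<^sup>2" using that by (intro power_mono mult_left_mono) auto
      then show ?thesis by (intro divide_left_mono mult_pos_pos) (auto simp: add_pos_nonneg)
    qed
    have "\<bar>\<xi> (- int (Suc m)) - \<xi> (- int m)\<bar> = \<bar>\<xi> (- int (Suc m) + 1) - \<xi> (- int (Suc m))\<bar>"
      by (simp add: abs_minus_commute)
    also have "\<dots> \<le> D * (1 / (1 + (1 * real (Suc m))\<^sup>2)) + D2 * \<epsilon>^4 * (1 / (1 + (\<epsilon> * real (Suc m))\<^sup>2))"
    proof -
      have r: "(of_int (- int (Suc m)) :: real) = - real (Suc m)" by simp
      show ?thesis using inc[of "- int (Suc m)"] unfolding r by (simp only: mult_minus_right power2_minus mult_1)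
    qed
    also have "\<dots> \<le> D * (1 / (1 + (1 * real m)\<^sup>2)) + D2 * \<epsilon>^4 * (1 / (1 + (\<epsilon> * real m)\<^sup>2))"
      using D0 D20 \<epsilon>_pos by (intro add_mono mult_left_mono mono) auto
    also have "\<dots> \<le> \<Phi> m - \<Phi> (Suc m)" using \<Phi>[of m] by simp
    finally show "\<bar>\<xi> (- int (Suc m)) - \<xi> (- int m)\<bar> \<le> \<Phi> m - \<Phi> (Suc m)" .
  qed (rule \<Phi>0)
  have \<xi>2: "(\<xi> n)\<^sup>2 \<le> 32 * D\<^sup>2 * (1 / (1 + 1 * \<bar>of_int n\<bar>)\<^sup>2) + 32 * (D2 * \<epsilon>^3)\<^sup>2 * (1 / (1 + \<epsilon> * \<bar>of_int n\<bar>)\<^sup>2)" for n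
  proof -
    have "\<bar>\<xi> n\<bar> \<le> \<Phi> (nat \<bar>n\<bar>)"
      using right[of "nat \<bar>n\<bar>"] left[of "nat \<bar>n\<bar>"] by (cases "0 \<le> n") auto
    then have "\<bar>\<xi> n\<bar>\<^sup>2 \<le> (\<Phi> (nat \<bar>n\<bar>))\<^sup>2" by (intro power_mono) auto
    also have "\<dots> \<le> 2 * (4 * D * (1 / (1 + 1 * real (nat \<bar>n\<bar>))))\<^sup>2 + 2 * (4 * (D2 * \<epsilon>^3) * (1 / (1 + \<epsilon> * real (nat \<bar>n\<bar>))))\<^sup>2"
    proof -
      have "(a + b)\<^sup>2 \<le> 2 * a\<^sup>2 + 2 * b\<^sup>2" for a b :: real
        using zero_le_power2[of "a - b"] by (simp add: power2_eq_square algebra_simps)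
      then show ?thesis unfolding \<Phi>_def .
    qed
    also have "\<dots> = 32 * D\<^sup>2 * (1 / (1 + 1 * \<bar>of_int n\<bar>)\<^sup>2) + 32 * (D2 * \<epsilon>^3)\<^sup>2 * (1 / (1 + \<epsilon> * \<bar>of_int n\<bar>)\<^sup>2)"
      by (simp add: power_mult_distrib power_divide)
    finally show ?thesis by simp
  qed
  have "(\<Sum>n\<in>F. (\<xi> n)\<^sup>2) \<le> (\<Sum>n\<in>F. 32 * D\<^sup>2 * (1 / (1 + 1 * \<bar>of_int n\<bar>)\<^sup>2) + 32 * (D2 * \<epsilon>^3)\<^sup>2 * (1 / (1 + \<epsilon> * \<bar>of_int n\<bar>)\<^sup>2))"
    by (intro sum_mono \<xi>2)
  also have "\<dots> = 32 * D\<^sup>2 * (\<Sum>n\<in>F. 1 / (1 + 1 * \<bar>of_int n\<bar>)\<^sup>2) + 32 * (D2 * \<epsilon>^3)\<^sup>2 * (\<Sum>n\<in>F. 1 / (1 + \<epsilon> * \<bar>of_int n\<bar>)\<^sup>2)"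
    by (simp only: sum.distrib sum_distrib_left)
  also have "\<dots> \<le> 32 * D\<^sup>2 * (4 / 1) + 32 * (D2 * \<epsilon>^3)\<^sup>2 * (4 / \<epsilon>)"
    using \<epsilon>_pos \<epsilon>_le_1 F by (intro add_mono mult_left_mono sum_inverse_square_le) auto
  also have "\<dots> = 128 * (1 + 4 * A\<^sup>2 * B^4) * \<epsilon>^5"
    using \<epsilon>_pos by (simp add: D D2_def power_mult_distrib) (simp add: eval_nat_numeral field_simps)
  finally show ?thesis by (simp add: \<xi>_def)
qed

end

section \<open>Profiles from mKdV solutions\<close>

lemma deriv_eq_on_open:
  assumes "open S" "\<And>x. x \<in> S \<Longrightarrow> p x = q x" "\<And>x. x \<in> S \<Longrightarrow> (q has_real_derivative d x) (at x)" "x \<in> S"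
  shows "deriv p x = d x"
  using assms by (intro DERIV_imp_deriv has_field_derivative_transform_within_open[of q "d x" x S p]) auto

text \<open>Where the weight is explicit, g = L + G0 / (1 + x^2) with G0 and its derivatives up to
  order 3 bounded by twice the norm, and L drops out on differentiation. The first three derivatives
  of \<psi> = 1 / (1 + x^2) are at most 2 \<psi>, 10 \<psi> and 72 \<psi>. The Leibniz rule at order
  3 gives 1 + 3 * 2 + 3 * 10 + 72 = 109, hence 218.\<close>

lemma Xspace_weighted_decay:
  assumes G: "Xspace 6 (\<lambda>x. (g x - L) * (w x)^2)"
    and S: "open S" and w: "\<And>x. x \<in> S \<Longrightarrow> w x = jbr x"
    and x: "x \<in> S" and j: "j \<in> {1, 3}"
  shows "\<bar>(deriv ^^ j) g x\<bar> \<le> 218 * Xnorm 6 (\<lambda>x. (g x - L) * (w x)^2) / (1 + x\<^sup>2)"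
proof -
  define G0 where "G0 = (\<lambda>x. (g x - L) * (w x)^2)"
  define N where "N = 2 * Xnorm 6 G0"
  define G1 where "G1 = deriv G0"
  define G2 where "G2 = deriv G1"
  define G3 where "G3 = deriv G2"
  define \<psi> where "\<psi> y = 1 / (1 + y\<^sup>2)" for y :: real
  define \<psi>1 where "\<psi>1 y = - 2 * y * (\<psi> y)\<^sup>2" for y
  define \<psi>2 where "\<psi>2 y = - 2 * (\<psi> y)\<^sup>2 + 8 * y\<^sup>2 * (\<psi> y)^3" for y
  define \<psi>3 where "\<psi>3 y = 24 * y * (\<psi> y)^3 - 48 * y^3 * (\<psi> y)^4" for y
  have X: "Xspace 6 G0" using G by (simp add: G0_def)
  have dG: "(G0 has_real_derivative G1 y) (at y)" "(G1 has_real_derivative G2 y) (at y)" "(G2 has_real_derivative G3 y) (at y)" for y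
    using Xspace_has_derivative[OF X, of 0 y] Xspace_has_derivative[OF X, of 1 y] Xspace_has_derivative[OF X, of 2 y]
    by (simp_all add: G1_def G2_def G3_def numeral_2_eq_2)
  have bG: "\<bar>G0 y\<bar> \<le> N" "\<bar>G1 y\<bar> \<le> N" "\<bar>G2 y\<bar> \<le> N" "\<bar>G3 y\<bar> \<le> N" for y
    using Xspace_deriv_bound[OF X, of 0 y] Xspace_deriv_bound[OF X, of 1 y] Xspace_deriv_bound[OF X, of 2 y] Xspace_deriv_bound[OF X, of 3 y]
    by (simp_all add: G1_def G2_def G3_def N_def numeral_2_eq_2 numeral_3_eq_3)
  have pos: "0 < 1 + y\<^sup>2" for y :: real by (simp add: add_pos_nonneg)
  have ne: "1 + y\<^sup>2 \<noteq> 0" for y :: real using pos[of y] by linarith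
  have d\<psi>: "(\<psi> has_real_derivative \<psi>1 y) (at y)" for y
    unfolding \<psi>_def \<psi>1_def using ne by (auto intro!: derivative_eq_intros simp: power2_eq_square)
  have d\<psi>1: "(\<psi>1 has_real_derivative \<psi>2 y) (at y)" for y
    unfolding \<psi>1_def[abs_def]
    by (rule derivative_eq_intros d\<psi> refl)+ (simp add: \<psi>1_def \<psi>2_def eval_nat_numeral algebra_simps)
  have d\<psi>2: "(\<psi>2 has_real_derivative \<psi>3 y) (at y)" for y
    unfolding \<psi>2_def[abs_def]
    by (rule derivative_eq_intros d\<psi> refl)+ (simp add: \<psi>1_def \<psi>3_def eval_nat_numeral algebra_simps)
  have g0: "g y = L + G0 y * \<psi> y" if "y \<in> S" for y
  proof -
    have "(w y)\<^sup>2 = 1 + y\<^sup>2" using w[OF that] by (simp add: jbr_def add_nonneg_nonneg)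
    then show ?thesis using ne[of y] by (simp add: G0_def \<psi>_def)
  qed
  have g1: "deriv g y = G1 y * \<psi> y + G0 y * \<psi>1 y" if "y \<in> S" for y
    by (rule deriv_eq_on_open[OF S g0 _ that])
       (auto intro!: derivative_eq_intros dG d\<psi>)
  have g2: "deriv (deriv g) y = G2 y * \<psi> y + 2 * G1 y * \<psi>1 y + G0 y * \<psi>2 y" if "y \<in> S" for y
    by (rule deriv_eq_on_open[OF S g1 _ that])
       (auto intro!: derivative_eq_intros dG d\<psi> d\<psi>1)
  have g3: "deriv (deriv (deriv g)) y = G3 y * \<psi> y + 3 * G2 y * \<psi>1 y + 3 * G1 y * \<psi>2 y + G0 y * \<psi>3 y" if "y \<in> S" for y
    by (rule deriv_eq_on_open[OF S g2 _ that])
       (auto intro!: derivative_eq_intros dG d\<psi> d\<psi>1 d\<psi>2)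
  have \<psi>0: "0 \<le> \<psi> x" "\<psi> x \<le> 1" using pos[of x] by (simp_all add: \<psi>_def)
  have xp: "\<bar>x\<bar> * \<psi> x \<le> 1"
  proof -
    have "\<bar>x\<bar> \<le> 1 + x\<^sup>2" using zero_le_power2[of "\<bar>x\<bar> - 1"] by (simp add: power2_diff)
    then show ?thesis using pos[of x] by (simp add: \<psi>_def)
  qed
  have xp2: "x\<^sup>2 * \<psi> x \<le> 1" using pos[of x] by (simp add: \<psi>_def)
  have p1: "\<bar>\<psi>1 x\<bar> \<le> 2 * \<psi> x"
  proof -
    have "\<bar>\<psi>1 x\<bar> = 2 * ((\<bar>x\<bar> * \<psi> x) * \<psi> x)" using \<psi>0 by (simp add: \<psi>1_def abs_mult power2_eq_square)
    also have "\<dots> \<le> 2 * (1 * \<psi> x)" using xp \<psi>0 by (intro mult_left_mono mult_right_mono) auto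
    finally show ?thesis by simp
  qed
  have p2: "\<bar>\<psi>2 x\<bar> \<le> 10 * \<psi> x"
  proof -
    have "\<bar>\<psi>2 x\<bar> \<le> \<bar>2 * (\<psi> x)\<^sup>2\<bar> + \<bar>8 * x\<^sup>2 * (\<psi> x)^3\<bar>" unfolding \<psi>2_def by linarith
    also have "\<dots> = 2 * (\<psi> x * \<psi> x) + 8 * ((x\<^sup>2 * \<psi> x) * (\<psi> x * \<psi> x))"
      using \<psi>0 by (simp add: abs_mult eval_nat_numeral)
    also have "\<dots> \<le> 2 * (1 * \<psi> x) + 8 * (1 * (1 * \<psi> x))"
      using xp2 \<psi>0 by (intro add_mono mult_left_mono mult_mono) auto
    finally show ?thesis by simp
  qed
  have p3: "\<bar>\<psi>3 x\<bar> \<le> 72 * \<psi> x"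
  proof -
    have "\<bar>\<psi>3 x\<bar> \<le> \<bar>24 * x * (\<psi> x)^3\<bar> + \<bar>48 * x^3 * (\<psi> x)^4\<bar>" unfolding \<psi>3_def by linarith
    also have "\<dots> = 24 * ((\<bar>x\<bar> * \<psi> x) * (\<psi> x * \<psi> x)) + 48 * ((x\<^sup>2 * \<psi> x) * ((\<bar>x\<bar> * \<psi> x) * (\<psi> x * \<psi> x)))"
      using \<psi>0 by (simp add: abs_mult eval_nat_numeral)
    also have "\<dots> \<le> 24 * (1 * (1 * \<psi> x)) + 48 * (1 * (1 * (1 * \<psi> x)))"
      using xp xp2 \<psi>0 by (intro add_mono mult_left_mono mult_mono) auto
    finally show ?thesis by simp
  qed
  have m: "\<bar>c * p * q\<bar> \<le> c * (N * (e * \<psi> x))" if "\<bar>p\<bar> \<le> N" "\<bar>q\<bar> \<le> e * \<psi> x" "0 \<le> c" for c p q e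
  proof -
    have "\<bar>c * p * q\<bar> = c * (\<bar>p\<bar> * \<bar>q\<bar>)" using that by (simp add: abs_mult)
    also have "\<dots> \<le> c * (N * (e * \<psi> x))" using that by (intro mult_left_mono mult_mono) auto
    finally show ?thesis .
  qed
  have q0: "\<bar>\<psi> x\<bar> \<le> 1 * \<psi> x" using \<psi>0 by simp
  have N\<psi>: "0 \<le> N * \<psi> x" using bG(1)[of 0] \<psi>0 by simp
  have "\<bar>(deriv ^^ j) g x\<bar> \<le> 109 * (N * \<psi> x)"
  proof (cases "j = 1")
    case True
    have "\<bar>deriv g x\<bar> \<le> \<bar>1 * G1 x * \<psi> x\<bar> + \<bar>1 * G0 x * \<psi>1 x\<bar>" unfolding g1[OF x] by linarith
    also have "\<dots> \<le> 1 * (N * (1 * \<psi> x)) + 1 * (N * (2 * \<psi> x))"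
      by (intro add_mono m bG q0 p1) auto
    also have "\<dots> \<le> 109 * (N * \<psi> x)" using N\<psi> by simp
    finally show ?thesis using True by simp
  next
    case False
    then have j3: "j = 3" using j by simp
    have "\<bar>deriv (deriv (deriv g)) x\<bar> \<le> \<bar>1 * G3 x * \<psi> x\<bar> + \<bar>3 * G2 x * \<psi>1 x\<bar> + \<bar>3 * G1 x * \<psi>2 x\<bar> + \<bar>1 * G0 x * \<psi>3 x\<bar>"
      unfolding g3[OF x] by linarith
    also have "\<dots> \<le> 1 * (N * (1 * \<psi> x)) + 3 * (N * (2 * \<psi> x)) + 3 * (N * (10 * \<psi> x)) + 1 * (N * (72 * \<psi> x))"
      by (intro add_mono m bG q0 p1 p2 p3) auto
    also have "\<dots> \<le> 109 * (N * \<psi> x)" using N\<psi> by simp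
    finally show ?thesis using j3 by (simp add: numeral_3_eq_3)
  qed
  also have "109 * (N * \<psi> x) = 218 * Xnorm 6 G0 / (1 + x\<^sup>2)" by (simp add: N_def \<psi>_def)
  finally show ?thesis by (simp add: G0_def)
qed

text \<open>Each weight gives decay on its own half-line, possibly with a different limit. In the
  gap |x| \<le> 1 plain boundedness is enough, since 1 + x^2 \<le> 2 there.\<close>

lemma Xspace_w_decay:
  assumes wp: "weight_plus wp" and wm: "weight_minus wm" and dec: "Xspace_w wp wm 6 2 g"
  obtains A where "0 \<le> A" "\<And>j x. j \<in> {1, 3} \<Longrightarrow> \<bar>(deriv ^^ j) g x\<bar> \<le> A / (1 + x\<^sup>2)"
proof -
  have X: "Xspace 6 g" using dec by (simp add: Xspace_w_def Xspace_plus_def)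
  obtain Lp where Lp: "Xspace 6 (\<lambda>x. (g x - Lp) * (wp x)^2)"
    using dec by (auto simp: Xspace_w_def Xspace_plus_def)
  obtain Lm where Lm: "Xspace 6 (\<lambda>x. (g x - Lm) * (wm x)^2)"
    using dec by (auto simp: Xspace_w_def Xspace_minus_def)
  define Np where "Np = Xnorm 6 (\<lambda>x. (g x - Lp) * (wp x)^2)"
  define Nm where "Nm = Xnorm 6 (\<lambda>x. (g x - Lm) * (wm x)^2)"
  define N where "N = Xnorm 6 g"
  have nn: "0 \<le> Np" "0 \<le> Nm" "0 \<le> N"
    unfolding Np_def Nm_def N_def using Lp Lm X by (auto intro!: Xnorm_bounds simp: Xspace_def)
  define A where "A = 218 * Np + 218 * Nm + 4 * N"
  show thesis
  proof (rule that[of A])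
    show "0 \<le> A" using nn by (simp add: A_def)
    fix j and x :: real assume j: "j \<in> {1, 3 :: nat}"
    have pos: "0 < 1 + x\<^sup>2" by (simp add: add_pos_nonneg)
    have up: "\<bar>(deriv ^^ j) g x\<bar> \<le> c / (1 + x\<^sup>2) \<Longrightarrow> c \<le> A \<Longrightarrow> \<bar>(deriv ^^ j) g x\<bar> \<le> A / (1 + x\<^sup>2)" for c
      using pos divide_right_mono[of c A "1 + x\<^sup>2"] by linarith
    consider "1 < x" | "x < -1" | "\<bar>x\<bar> \<le> 1" by linarith
    then show "\<bar>(deriv ^^ j) g x\<bar> \<le> A / (1 + x\<^sup>2)"
    proof cases
      case 1
      have "\<bar>(deriv ^^ j) g x\<bar> \<le> 218 * Np / (1 + x\<^sup>2)" unfolding Np_def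
        by (rule Xspace_weighted_decay[OF Lp, of "{1<..}"]) (use wp 1 j in \<open>auto simp: weight_plus_def\<close>)
      then show ?thesis by (rule up) (use nn in \<open>simp add: A_def\<close>)
    next
      case 2
      have "\<bar>(deriv ^^ j) g x\<bar> \<le> 218 * Nm / (1 + x\<^sup>2)" unfolding Nm_def
        by (rule Xspace_weighted_decay[OF Lm, of "{..<-1}"]) (use wm 2 j in \<open>auto simp: weight_minus_def\<close>)
      then show ?thesis by (rule up) (use nn in \<open>simp add: A_def\<close>)
    next
      case 3
      have "x\<^sup>2 \<le> 1" using 3 by (simp add: abs_square_le_1)
      have "\<bar>(deriv ^^ j) g x\<bar> \<le> 2 * N"
        unfolding N_def by (rule Xspace_deriv_bound[OF X]) (use j in auto)
      also have "2 * N \<le> 4 * N / (1 + x\<^sup>2)"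
      proof -
        have "2 * N * (1 + x\<^sup>2) \<le> 2 * N * 2" using nn \<open>x\<^sup>2 \<le> 1\<close> by (intro mult_left_mono) auto
        then show ?thesis using pos by (simp add: pos_le_divide_eq)
      qed
      finally show ?thesis by (rule up) (use nn in \<open>simp add: A_def\<close>)
    qed
  qed
qed

lemma mkdv_profile_exists:
  assumes sol: "mkdv_sol f" and reg: "Cb_X 6 f"
  obtains B S0 where "mkdv_profile (\<lambda>j x T. (deriv ^^ j) (\<lambda>x. f x T) x) B S0"
proof -
  have X: "Xspace 6 (\<lambda>x. f x T)" for T using reg by (simp add: Cb_X_def)
  obtain B0 where B0: "\<And>T. Xnorm 6 (\<lambda>x. f x T) \<le> B0" using reg by (auto simp: Cb_X_def)
  define B where "B = max 1 (2 * B0)"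
  \<comment> \<open>The summand 1 keeps \<open>S0\<close> strictly positive even when
    \<open>B0\<close> is 0.\<close>
  define S0 where "S0 = 8 * real 6 * B0\<^sup>2 + 1"
  show thesis
  proof (rule that[of B S0], unfold_locales)
    show "1 \<le> B" by (simp add: B_def)
    show "0 < S0" by (simp add: S0_def add_nonneg_pos)
    show "((\<lambda>x. (deriv ^^ j) (\<lambda>x. f x T) x) has_real_derivative (deriv ^^ Suc j) (\<lambda>x. f x T) x) (at x)" if "j < 5" for j x T
      using Xspace_has_derivative[OF X[of T], of j x] that by simp
    show "\<bar>(deriv ^^ j) (\<lambda>x. f x T) x\<bar> \<le> B" if "j \<le> 5" for j x T
      using Xspace_deriv_bound[OF X[of T], of j x] that B0[of T] by (simp add: B_def)
    show "\<exists>s. (\<forall>n. 0 \<le> s n) \<and> (\<forall>F. finite F \<longrightarrow> (\<Sum>n\<in>F. (s n)\<^sup>2) \<le> S0 / \<epsilon>)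
        \<and> (\<forall>n y j. \<bar>y - (b + \<epsilon> * of_int (n::int))\<bar> \<le> \<epsilon> / 2 \<longrightarrow> 1 \<le> j \<longrightarrow> j \<le> 5 \<longrightarrow> \<bar>(deriv ^^ j) (\<lambda>x. f x T) y\<bar> \<le> s n)"
      if \<epsilon>: "0 < \<epsilon>" "\<epsilon> \<le> 1" for \<epsilon> b T
    proof -
      obtain s where s: "\<And>n. 0 \<le> s n"
        "\<And>F. finite F \<Longrightarrow> (\<Sum>n\<in>F. (s n)\<^sup>2) \<le> 8 * real 6 * B0\<^sup>2 / \<epsilon>"
        "\<And>n y j. \<lbrakk>\<bar>y - (b + \<epsilon> * of_int n)\<bar> \<le> \<epsilon> / 2; j \<in> {1..<6}\<rbrakk> \<Longrightarrow> \<bar>(deriv ^^ j) (\<lambda>x. f x T) y\<bar> \<le> s n"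
        using Xspace_sampling[OF X[of T] \<epsilon> B0[of T], of b] by blast
      have "8 * real 6 * B0\<^sup>2 / \<epsilon> \<le> S0 / \<epsilon>" using \<epsilon> by (intro divide_right_mono) (auto simp: S0_def)
      then show ?thesis using s by (intro exI[of _ s]) (auto intro: order_trans)
    qed
    show "((\<lambda>t. (deriv ^^ 0) (\<lambda>x. f x (\<beta> * t)) (c + \<alpha> * t)) has_real_derivative
       \<alpha> * (deriv ^^ 1) (\<lambda>x. f x (\<beta> * t)) (c + \<alpha> * t) + \<beta> * ((deriv ^^ 3) (\<lambda>x. f x (\<beta> * t)) (c + \<alpha> * t) / 24
        - ((deriv ^^ 0) (\<lambda>x. f x (\<beta> * t)) (c + \<alpha> * t))\<^sup>2 * (deriv ^^ 1) (\<lambda>x. f x (\<beta> * t)) (c + \<alpha> * t) / 4)) (at t)" for c \<alpha> \<beta> t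
      using mkdv_has_derivative_along_line[OF sol reg, of c \<alpha> \<beta> t] by simp
  qed
qed

section \<open>The truncated lattice system\<close>

text \<open>Completeness of spaces of bounded continuous functions is available for metric domains only.\<close>

instantiation int :: metric_space
begin

definition dist_int :: "int \<Rightarrow> int \<Rightarrow> real" where
  "dist_int x y = real_of_int \<bar>x - y\<bar>"

definition uniformity_int :: "(int \<times> int) filter" where
  "uniformity_int = (INF e\<in>{0 <..}. principal {(x, y). dist x y < e})"

instance
proof
  show "uniformity = (INF e\<in>{0 <..}. principal {(x, y :: int). dist x y < e})"
    by (rule uniformity_int_def)
  \<comment> \<open>Balls of radius 1 are singletons, so the metric induces the discrete topology
    that the type already carries.\<close>
  have eq: "x = y" if "dist x y < 1" for x y :: int
  proof -
    have "\<bar>x - y\<bar> < 1" using that by (simp only: dist_int_def of_int_less_1_iff)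
    then show ?thesis by simp
  qed
  have "(uniformity :: (int \<times> int) filter) \<le> principal {(x, y). dist x y < 1}"
    unfolding uniformity_int_def by (rule INF_lower) simp
  then have "eventually (\<lambda>z :: int \<times> int. z \<in> {(x, y). dist x y < 1}) uniformity"
    by (simp only: le_principal)
  then have "\<forall>\<^sub>F (x', y) in uniformity. x' = x \<longrightarrow> y \<in> W" if "x \<in> W" for x and W :: "int set"
    by (rule eventually_mono) (use that eq in auto)
  then show "open W = (\<forall>x\<in>W. \<forall>\<^sub>F (x', y) in uniformity. x' = x \<longrightarrow> y \<in> W)" for W :: "int set"
    by (simp add: open_discrete)
  show "dist x y = 0 \<longleftrightarrow> x = y" for x y :: int by (simp add: dist_int_def)
  show "dist x y \<le> dist x z + dist y z" for x y z :: int by (simp add: dist_int_def)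
qed

end
instance bcontfun :: (metric_space, banach) banach ..

lemma apply_Bcontfun_int:
  fixes f :: "int \<Rightarrow> real"
  assumes "\<And>n. \<bar>f n\<bar> \<le> c"
  shows "apply_bcontfun (Bcontfun f) = f"
proof (rule Bcontfun_inverse)
  show "f \<in> bcontfun" by (rule bcontfun_normI[of _ c]) (use assms in auto)
qed

lemma bounded_linear_apply_bcontfun: "bounded_linear (\<lambda>z :: 'a::topological_space \<Rightarrow>\<^sub>C 'b::real_normed_vector. apply_bcontfun z n)"
  by (rule bounded_linear_intro[where K = 1])
     (auto simp: plus_bcontfun.rep_eq scaleR_bcontfun.rep_eq norm_bounded)

lemma abs_bcontfun_le: "\<bar>apply_bcontfun (z :: 'a::topological_space \<Rightarrow>\<^sub>C real) n\<bar> \<le> norm z"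
  using norm_bounded[of z n] by simp

context mkdv_ansatz
begin

definition cut :: "real \<Rightarrow> real" where
  "cut \<eta> = max (- \<epsilon>\<^sup>2) (min (\<epsilon>\<^sup>2) \<eta>)"

text \<open>Up to sign, the quadratic and cubic terms of the expansion of u - u^3/6 at V, evaluated
  at the truncated error.\<close>

definition cubic_part :: "real \<Rightarrow> real \<Rightarrow> real" where
  "cubic_part V \<eta> = V * (cut \<eta>)\<^sup>2 / 2 + (cut \<eta>)^3 / 6"

text \<open>The FPUT force expanded around the ansatz value \<open>V\<close>, with the terms of order at least two in
  \<open>u - V\<close> truncated.  It is globally Lipschitz in \<open>u\<close> and agrees with the true force as long as
  the error is at most \<open>\<epsilon>\<^sup>2\<close>.\<close>

definition cut_force :: "real \<Rightarrow> real \<Rightarrow> real" where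
  "cut_force V u = fput_force V + (1 - V\<^sup>2 / 2) * (u - V) - cubic_part V (u - V)"

lemma cut_force_eq: "\<bar>u - V\<bar> \<le> \<epsilon>\<^sup>2 \<Longrightarrow> cut_force V u = fput_force u"
proof -
  assume a: "\<bar>u - V\<bar> \<le> \<epsilon>\<^sup>2"
  then have c: "cut (u - V) = u - V" unfolding cut_def by linarith
  show ?thesis
    unfolding cut_force_def cubic_part_def fput_force_def c by (simp add: eval_nat_numeral field_simps)
qed

lemma cut_bounds: "\<bar>cut \<eta>\<bar> \<le> \<epsilon>\<^sup>2" "\<bar>cut \<eta>\<bar> \<le> \<bar>\<eta>\<bar>" "\<bar>cut \<eta>\<bar> \<le> 1" "\<bar>cut \<eta> - cut \<eta>'\<bar> \<le> \<bar>\<eta> - \<eta>'\<bar>"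
proof -
  have e: "0 < \<epsilon>\<^sup>2" "\<epsilon>\<^sup>2 \<le> 1" using \<epsilon>_pos \<epsilon>_le_1 by (auto intro: power_le_one)
  show 1: "\<bar>cut \<eta>\<bar> \<le> \<epsilon>\<^sup>2" using e unfolding cut_def by linarith
  show "\<bar>cut \<eta>\<bar> \<le> 1" using 1 e by linarith
  show "\<bar>cut \<eta>\<bar> \<le> \<bar>\<eta>\<bar>" using e unfolding cut_def by linarith
  show "\<bar>cut \<eta> - cut \<eta>'\<bar> \<le> \<bar>\<eta> - \<eta>'\<bar>" unfolding cut_def by (simp add: max_def min_def)
qed

text \<open>One truncated factor is bounded by |\<eta>|, the others by \<epsilon>^2, and V itself is
  of order \<epsilon>. The nonlinearity thus enters the energy estimate as a linear term with
  coefficient of order \<epsilon>^3, like the drift of the ansatz.\<close>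

lemma abs_cubic_part_le:
  assumes V: "\<bar>V\<bar> \<le> \<epsilon> * B"
  shows "\<bar>cubic_part V \<eta>\<bar> \<le> B * \<epsilon>^3 * \<bar>\<eta>\<bar>"
proof -
  have "\<bar>V * (cut \<eta>)\<^sup>2 / 2\<bar> = \<bar>V\<bar> * (\<bar>cut \<eta>\<bar> * \<bar>cut \<eta>\<bar>) / 2" by (simp add: abs_mult power2_eq_square)
  also have "\<dots> \<le> (\<epsilon> * B) * (\<epsilon>\<^sup>2 * \<bar>\<eta>\<bar>) / 2"
    using V cut_bounds(1,2)[of \<eta>] by (intro divide_right_mono mult_mono) auto
  also have "\<dots> = B * \<epsilon>^3 * \<bar>\<eta>\<bar> / 2" by (simp add: eval_nat_numeral)
  finally have 1: "\<bar>V * (cut \<eta>)\<^sup>2 / 2\<bar> \<le> B * \<epsilon>^3 * \<bar>\<eta>\<bar> / 2" .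
  have "\<bar>(cut \<eta>)^3 / 6\<bar> = \<bar>cut \<eta>\<bar> * (\<bar>cut \<eta>\<bar> * \<bar>cut \<eta>\<bar>) / 6" by (simp add: abs_mult eval_nat_numeral)
  also have "\<dots> \<le> \<epsilon>\<^sup>2 * (\<epsilon>\<^sup>2 * \<bar>\<eta>\<bar>) / 6"
    using cut_bounds(1,2)[of \<eta>] by (intro divide_right_mono mult_mono) auto
  also have "\<dots> = \<epsilon>^4 * \<bar>\<eta>\<bar> / 6" by (simp add: eval_nat_numeral)
  also have "\<dots> \<le> (B * \<epsilon>^3) * \<bar>\<eta>\<bar> / 6"
  proof -
    have "\<epsilon>^4 = \<epsilon> * \<epsilon>^3" by (simp add: eval_nat_numeral)
    also have "\<dots> \<le> B * \<epsilon>^3" using \<epsilon>_le_1 B_ge_1 \<epsilon>_pos by (intro mult_right_mono) auto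
    finally show ?thesis by (intro divide_right_mono mult_right_mono) auto
  qed
  finally have 2: "\<bar>(cut \<eta>)^3 / 6\<bar> \<le> B * \<epsilon>^3 * \<bar>\<eta>\<bar> / 6" .
  have "0 \<le> B * \<epsilon>^3 * \<bar>\<eta>\<bar>" using B_ge_1 \<epsilon>_pos by simp
  with 1 2 show ?thesis unfolding cubic_part_def by linarith
qed

lemma cut_force_lipschitz:
  assumes V: "\<bar>V\<bar> \<le> 1"
  shows "\<bar>cut_force V u - cut_force V u'\<bar> \<le> 3 * \<bar>u - u'\<bar>"
proof -
  define c where "c = cut (u - V)"
  define c' where "c' = cut (u' - V)"
  have c: "\<bar>c\<bar> \<le> 1" "\<bar>c'\<bar> \<le> 1" "\<bar>c - c'\<bar> \<le> \<bar>u - u'\<bar>"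
    using cut_bounds(3)[of "u - V"] cut_bounds(3)[of "u' - V"] cut_bounds(4)[of "u - V" "u' - V"]
    by (simp_all add: c_def c'_def)
  have V2: "V\<^sup>2 \<le> 1" using V by (simp add: abs_square_le_1)
  have eq: "cut_force V u - cut_force V u' = (1 - V\<^sup>2 / 2) * (u - u') - (V * (c + c') / 2) * (c - c')
      - ((c * c + c * c' + c' * c') / 6) * (c - c')"
    unfolding cut_force_def cubic_part_def c_def[symmetric] c'_def[symmetric]
    by (simp add: eval_nat_numeral field_simps)
  have m: "\<bar>p * d\<bar> \<le> 1 * \<bar>u - u'\<bar>" if "\<bar>p\<bar> \<le> 1" "\<bar>d\<bar> \<le> \<bar>u - u'\<bar>" for p d
    unfolding abs_mult using that by (intro mult_mono) auto
  have b1: "\<bar>1 - V\<^sup>2 / 2\<bar> \<le> 1" using V2 zero_le_power2[of V] by linarith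
  have b2: "\<bar>V * (c + c') / 2\<bar> \<le> 1"
  proof -
    have "\<bar>V\<bar> * \<bar>c + c'\<bar> \<le> 1 * 2" using V c by (intro mult_mono) auto
    then show ?thesis by (simp add: abs_mult)
  qed
  have b3: "\<bar>(c * c + c * c' + c' * c') / 6\<bar> \<le> 1"
  proof -
    have "\<bar>c\<bar> * \<bar>c\<bar> \<le> 1 * 1" "\<bar>c\<bar> * \<bar>c'\<bar> \<le> 1 * 1" "\<bar>c'\<bar> * \<bar>c'\<bar> \<le> 1 * 1" using c by (intro mult_mono; simp)+
    then have "\<bar>c * c\<bar> \<le> 1" "\<bar>c * c'\<bar> \<le> 1" "\<bar>c' * c'\<bar> \<le> 1" by (simp_all only: abs_mult mult_1)
    moreover have "\<bar>(x + y + z) / 6\<bar> \<le> 1" if "\<bar>x\<bar> \<le> 1" "\<bar>y\<bar> \<le> 1" "\<bar>z\<bar> \<le> 1" for x y z :: real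
    proof -
      have "\<bar>x + y + z\<bar> \<le> 6" using that by linarith
      then show ?thesis by simp
    qed
    ultimately show ?thesis by blast
  qed
  show ?thesis unfolding eq using m[OF b1 order_refl] m[OF b2 c(3)] m[OF b3 c(3)] by linarith
qed

lemma continuous_on_cut_force: "continuous_on A (\<lambda>(V, u). cut_force V u)"
  unfolding cut_force_def cubic_part_def cut_def fput_force_def case_prod_unfold
  by (intro continuous_intros) auto

lemma abs_U_le_1: "\<bar>U t n\<bar> \<le> 1"
  using abs_U_le[of t n] \<epsilon>_B by linarith

lemma cut_force_bounded: "\<exists>c. \<forall>V u. \<bar>V\<bar> \<le> 1 \<longrightarrow> \<bar>cut_force V u\<bar> \<le> c + 3 * \<bar>u\<bar>"
proof -
  have "continuous_on {-1..1} (\<lambda>V. cut_force V 0)"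
    unfolding cut_force_def cubic_part_def cut_def fput_force_def by (intro continuous_intros) auto
  then have "compact ((\<lambda>V. cut_force V 0) ` {-1..1})" by (intro compact_continuous_image) auto
  then obtain c where c: "\<forall>x\<in>(\<lambda>V. cut_force V 0) ` {-1..1}. norm x \<le> c"
    by (meson compact_imp_bounded bounded_iff)
  show ?thesis
  proof (intro exI[of _ c] allI impI)
    fix V u :: real assume V: "\<bar>V\<bar> \<le> 1"
    have "\<bar>cut_force V 0\<bar> \<le> c" using c V by (auto simp: abs_le_iff)
    then show "\<bar>cut_force V u\<bar> \<le> c + 3 * \<bar>u\<bar>" using cut_force_lipschitz[OF V, of u 0] by simp
  qed
qed

text \<open>The constant is uniform in the site n, as continuity in time of the vector field with
  respect to the sup norm requires.\<close>

lemma U_lipschitz: "\<bar>U t n - U s n\<bar> \<le> 2 * B^3 * \<bar>t - s\<bar>"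
proof -
  have "norm (U t n - U s n) \<le> 2 * B^3 * norm (t - s)"
  proof (rule field_differentiable_bound[of UNIV "\<lambda>t. U t n" "\<lambda>t. U' t n"])
    show "((\<lambda>t. U t n) has_field_derivative U' z n) (at z within UNIV)" for z
      using has_derivative_U[of n z] by simp
    show "norm (U' z n) \<le> 2 * B^3" for z
    proof -
      have "\<epsilon>\<^sup>2 * (2 * B^3) \<le> 1 * (2 * B^3)" using \<epsilon>_pos \<epsilon>_le_1 B_ge_1 by (intro mult_right_mono power_le_one) auto
      then show ?thesis using abs_U'_le[of z n] by (simp add: mult_ac)
    qed
  qed auto
  then show ?thesis by simp
qed

text \<open>The system is posed on pairs of bounded sequences and depends on time through the
  ansatz. The first component has Lipschitz constant 2 and the second 6, both independent of t, so
  the global existence theorem applies with constant 8.\<close>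

lemma truncated_system_exists:
  fixes u0 q0 :: "int \<Rightarrow>\<^sub>C real"
  assumes T: "0 \<le> T"
  obtains u q du dq :: "real \<Rightarrow> (int \<Rightarrow>\<^sub>C real)" where "u 0 = u0" "q 0 = q0"
    "\<And>t. t \<in> {-T..T} \<Longrightarrow> (u has_vector_derivative du t) (at t within {-T..T})"
    "\<And>t. t \<in> {-T..T} \<Longrightarrow> (q has_vector_derivative dq t) (at t within {-T..T})"
    "\<And>t n. apply_bcontfun (du t) n = apply_bcontfun (q t) (n + 1) - apply_bcontfun (q t) n"
    "\<And>t n. apply_bcontfun (dq t) n = cut_force (U t n) (apply_bcontfun (u t) n) - cut_force (U t (n - 1)) (apply_bcontfun (u t) (n - 1))"
proof -
  obtain c where c: "\<And>V u. \<bar>V\<bar> \<le> 1 \<Longrightarrow> \<bar>cut_force V u\<bar> \<le> c + 3 * \<bar>u\<bar>"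
    using cut_force_bounded by blast
  define F1 :: "(int \<Rightarrow>\<^sub>C real) \<Rightarrow> (int \<Rightarrow>\<^sub>C real)"
    where "F1 q = Bcontfun (\<lambda>n. apply_bcontfun q (n + 1) - apply_bcontfun q n)" for q
  define F2 :: "real \<Rightarrow> (int \<Rightarrow>\<^sub>C real) \<Rightarrow> (int \<Rightarrow>\<^sub>C real)"
    where "F2 t u = Bcontfun (\<lambda>n. cut_force (U t n) (apply_bcontfun u n) - cut_force (U t (n - 1)) (apply_bcontfun u (n - 1)))" for t u
  have F1: "apply_bcontfun (F1 q) = (\<lambda>n. apply_bcontfun q (n + 1) - apply_bcontfun q n)" for q
    unfolding F1_def
  proof (rule apply_Bcontfun_int)
    show "\<bar>apply_bcontfun q (n + 1) - apply_bcontfun q n\<bar> \<le> 2 * norm q" for n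
      using abs_bcontfun_le[of q n] abs_bcontfun_le[of q "n + 1"] by linarith
  qed
  have F2: "apply_bcontfun (F2 t u) = (\<lambda>n. cut_force (U t n) (apply_bcontfun u n) - cut_force (U t (n - 1)) (apply_bcontfun u (n - 1)))" for t u
    unfolding F2_def
  proof (rule apply_Bcontfun_int)
    show "\<bar>cut_force (U t n) (apply_bcontfun u n) - cut_force (U t (n - 1)) (apply_bcontfun u (n - 1))\<bar> \<le> 2 * c + 6 * norm u" for n
      using c[OF abs_U_le_1[of t n], of "apply_bcontfun u n"] c[OF abs_U_le_1[of t "n - 1"], of "apply_bcontfun u (n - 1)"]
        abs_bcontfun_le[of u n] abs_bcontfun_le[of u "n - 1"] by linarith
  qed
  define F where "F t y = (F1 (snd y), F2 t (fst y))" for t and y :: "(int \<Rightarrow>\<^sub>C real) \<times> (int \<Rightarrow>\<^sub>C real)"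
  have cont: "continuous_on UNIV (\<lambda>t. F t y)" for y
  proof -
    have "continuous_on UNIV (\<lambda>t. F2 t u)" for u
      unfolding continuous_on_iff
    proof (intro ballI allI impI)
      fix t e :: real assume e: "0 < e"
      \<comment> \<open>All pairs (U t n, u n) lie in this compact set, so one modulus of continuity
        of \<open>cut_force\<close> serves every site simultaneously.\<close>
      let ?K = "{-1..1} \<times> {- norm u..norm u}"
      have "uniformly_continuous_on ?K (\<lambda>(V, u). cut_force V u)"
        by (intro compact_uniformly_continuous continuous_on_cut_force compact_Times) auto
      then obtain d where d: "0 < d"
        "\<And>x y. x \<in> ?K \<Longrightarrow> y \<in> ?K \<Longrightarrow> dist y x < d \<Longrightarrow> dist ((\<lambda>(V, u). cut_force V u) y) ((\<lambda>(V, u). cut_force V u) x) < e / 4"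
        unfolding uniformly_continuous_on_def using e by (metis divide_pos_pos zero_less_numeral)
      define d' where "d' = d / (2 * B^3)"
      have B3: "0 < 2 * B^3" using B_ge_1 by simp
      have "dist (F2 s u) (F2 t u) < e" if s: "dist s t < d'" for s
      proof -
        have step: "\<bar>cut_force (U s n) (apply_bcontfun u n) - cut_force (U t n) (apply_bcontfun u n)\<bar> < e / 4" for n
        proof -
          have "\<bar>U s n - U t n\<bar> \<le> 2 * B^3 * \<bar>s - t\<bar>" by (rule U_lipschitz)
          also have "\<dots> < d" using s B3 by (simp add: d'_def dist_real_def pos_less_divide_eq mult.commute)
          finally have "\<bar>U s n - U t n\<bar> < d" .
          then show ?thesis
            using d(2)[of "(U t n, apply_bcontfun u n)" "(U s n, apply_bcontfun u n)"]
              abs_U_le_1[of t n] abs_U_le_1[of s n] abs_bcontfun_le[of u n]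
            by (auto simp: dist_Pair_Pair dist_real_def abs_le_iff)
        qed
        have "dist (F2 s u) (F2 t u) \<le> e / 2"
        proof (rule dist_bound)
          fix n
          show "dist (apply_bcontfun (F2 s u) n) (apply_bcontfun (F2 t u) n) \<le> e / 2"
            unfolding F2 dist_real_def using step[of n] step[of "n - 1"] by linarith
        qed
        then show ?thesis using e by simp
      qed
      moreover have "0 < d'" using d(1) B3 by (simp add: d'_def)
      ultimately show "\<exists>d>0. \<forall>s\<in>UNIV. dist s t < d \<longrightarrow> dist (F2 s u) (F2 t u) < e" by blast
    qed
    then show ?thesis unfolding F_def by (intro continuous_intros)
  qed
  have lip: "norm (F t y - F t z) \<le> 8 * norm (y - z)" for t y z
  proof -
    have a: "norm (F1 (snd y) - F1 (snd z)) \<le> 2 * norm (y - z)"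
    proof -
      have "dist (F1 (snd y)) (F1 (snd z)) \<le> 2 * norm (snd (y - z))"
      proof (rule dist_bound)
        fix n
        show "dist (apply_bcontfun (F1 (snd y)) n) (apply_bcontfun (F1 (snd z)) n) \<le> 2 * norm (snd (y - z))"
          unfolding F1 dist_real_def
          using abs_bcontfun_le[of "snd (y - z)" n] abs_bcontfun_le[of "snd (y - z)" "n + 1"]
          by (simp add: minus_bcontfun.rep_eq)
      qed
      also have "\<dots> \<le> 2 * norm (y - z)" using norm_snd_le[where x = "fst (y - z)" and y = "snd (y - z)"] by (simp only: prod.collapse)
      finally show ?thesis by (simp add: dist_norm)
    qed
    have b: "norm (F2 t (fst y) - F2 t (fst z)) \<le> 6 * norm (y - z)"
    proof -
      have "dist (F2 t (fst y)) (F2 t (fst z)) \<le> 6 * norm (fst (y - z))"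
      proof (rule dist_bound)
        fix n
        have l: "\<bar>cut_force (U t n) (apply_bcontfun (fst y) n) - cut_force (U t n) (apply_bcontfun (fst z) n)\<bar> \<le> 3 * norm (fst (y - z))" for n
          using cut_force_lipschitz[OF abs_U_le_1[of t n], of "apply_bcontfun (fst y) n" "apply_bcontfun (fst z) n"]
            abs_bcontfun_le[of "fst (y - z)" n] by (simp add: minus_bcontfun.rep_eq)
        show "dist (apply_bcontfun (F2 t (fst y)) n) (apply_bcontfun (F2 t (fst z)) n) \<le> 6 * norm (fst (y - z))"
          unfolding F2 dist_real_def using l[of n] l[of "n - 1"] by linarith
      qed
      also have "\<dots> \<le> 6 * norm (y - z)" using norm_fst_le[where x = "fst (y - z)" and y = "snd (y - z)"] by (simp only: prod.collapse)
      finally show ?thesis by (simp add: dist_norm)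
    qed
    have "norm (F t y - F t z) \<le> norm (F1 (snd y) - F1 (snd z)) + norm (F2 t (fst y) - F2 t (fst z))"
      unfolding F_def diff_Pair by (rule norm_Pair_le)
    then show ?thesis using a b by linarith
  qed
  obtain y where y: "y 0 = (u0, q0)"
    "\<And>t. t \<in> {-T..T} \<Longrightarrow> (y has_vector_derivative F t (y t)) (at t within {-T..T})"
    by (rule lipschitz_ode_exists[OF cont lip _ T, of "(u0, q0)"]) auto
  show thesis
  proof (rule that[of "\<lambda>t. fst (y t)" "\<lambda>t. snd (y t)" "\<lambda>t. F1 (snd (y t))" "\<lambda>t. F2 t (fst (y t))"])
    show "fst (y 0) = u0" "snd (y 0) = q0" using y(1) by simp_all
    show "((\<lambda>t. fst (y t)) has_vector_derivative F1 (snd (y t))) (at t within {-T..T})" if "t \<in> {-T..T}" for t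
      using bounded_linear.has_vector_derivative[OF bounded_linear_fst y(2)[OF that]] by (simp add: F_def)
    show "((\<lambda>t. snd (y t)) has_vector_derivative F2 t (fst (y t))) (at t within {-T..T})" if "t \<in> {-T..T}" for t
      using bounded_linear.has_vector_derivative[OF bounded_linear_snd y(2)[OF that]] by (simp add: F_def)
  qed (simp_all add: F1 F2)
qed

lemma abs_Q_le: "\<bar>Q t n\<bar> \<le> B + B^3 + \<bar>k\<bar>"
proof -
  let ?v = "g 0 (\<epsilon> * (of_int n + t) - \<epsilon> / 2) (\<epsilon>^3 * t)"
  have v: "\<bar>?v\<bar> \<le> B" by (rule bound_g) simp
  have "\<bar>\<epsilon>\<^sup>2 / 12 * ?v^3\<bar> \<le> 1 * B^3"
    unfolding abs_mult power_abs
    using v \<epsilon>_pos \<epsilon>_le_1 power_le_one[of \<epsilon> 2] by (intro mult_mono power_mono) auto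
  then have "\<bar>?v - \<epsilon>\<^sup>2 / 12 * ?v^3\<bar> \<le> B + B^3" using v by linarith
  then have "\<bar>\<epsilon>\<bar> * \<bar>?v - \<epsilon>\<^sup>2 / 12 * ?v^3\<bar> \<le> 1 * (B + B^3)" using \<epsilon>_pos \<epsilon>_le_1 by (intro mult_mono) auto
  then have "\<bar>\<epsilon> * (?v - \<epsilon>\<^sup>2 / 12 * ?v^3)\<bar> \<le> B + B^3" by (simp add: abs_mult)
  then show ?thesis unfolding Q_def by linarith
qed

text \<open>\<open>lattice_energy\<close> with the linearised force 1 - U^2/2 as coefficient and the
  truncated remainder as perturbation m. The rate \<kappa> = 2 B^4 \<epsilon>^3 is the bound for |U
  U'|, and it also dominates the constant B \<epsilon>^3 of the cubic part.\<close>

lemma truncated_system_error: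
  fixes u q :: "real \<Rightarrow> int \<Rightarrow> real"
  assumes du: "\<And>t n. t \<in> {-T..T} \<Longrightarrow> ((\<lambda>t. u t n) has_real_derivative q t (n + 1) - q t n) (at t within {-T..T})"
    and dq: "\<And>t n. t \<in> {-T..T} \<Longrightarrow> ((\<lambda>t. q t n) has_real_derivative
        cut_force (U t n) (u t n) - cut_force (U t (n - 1)) (u t (n - 1))) (at t within {-T..T})"
    and M: "\<And>t n. t \<in> {-T..T} \<Longrightarrow> \<bar>u t n\<bar> \<le> M \<and> \<bar>q t n\<bar> \<le> M"
    and init: "\<And>F. finite F \<Longrightarrow> (\<Sum>n\<in>F. (u 0 n - U 0 n)\<^sup>2 + (q 0 n - Q 0 n)\<^sup>2) \<le> A0 * \<epsilon>^5"
    and small: "2 * B^4 * \<epsilon>^3 \<le> 1"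
    and t: "t \<in> {-T..T}" and F: "finite F"
  shows "(\<Sum>n\<in>F. (u t n - U t n)\<^sup>2 + (q t n - Q t n)\<^sup>2) \<le> 2 * (A0 + S0 / 9) * \<epsilon>^5 * exp (36 * B^4 * \<epsilon>^3 * \<bar>t\<bar>)"
proof -
  define \<kappa> where "\<kappa> = 2 * B^4 * \<epsilon>^3"
  define \<rho> where "\<rho> = 8 * B^8 * S0 * \<epsilon>^11"
  have \<kappa>: "0 < \<kappa>" "\<kappa> \<le> 1" using B_ge_1 \<epsilon>_pos small by (auto simp: \<kappa>_def)
  \<comment> \<open>The powers of B and \<epsilon> in \<rho> and \<kappa>^2 match up to
    \<epsilon>^5, and 8 / 72 gives the constant 1/9.\<close>
  have \<rho>\<kappa>: "\<rho> / (18 * \<kappa>\<^sup>2) = S0 / 9 * \<epsilon>^5"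
  proof -
    have "18 * \<kappa>\<^sup>2 = 72 * (B^8 * \<epsilon>^6)" by (simp add: \<kappa>_def power_mult_distrib flip: power_mult)
    moreover have "\<rho> = (B^8 * \<epsilon>^6) * (8 * S0 * \<epsilon>^5)" by (simp add: \<rho>_def flip: power_add)
    ultimately show ?thesis using B_ge_1 \<epsilon>_pos by simp
  qed
  \<comment> \<open>Negative times are treated by reversing time: s = -1 only puts a sign in front
    of the differences and the residuals.\<close>
  have main: "(\<Sum>n\<in>F. (u (s * \<tau>) n - U (s * \<tau>) n)\<^sup>2 + (q (s * \<tau>) n - Q (s * \<tau>) n)\<^sup>2)
      \<le> 2 * (A0 * \<epsilon>^5 + \<rho> / (18 * \<kappa>\<^sup>2)) * exp (18 * \<kappa> * \<tau>)"
    if s: "s = 1 \<or> s = -1" and \<tau>: "\<tau> \<in> {0..T}" for s \<tau>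
  proof -
    have sT: "s * \<tau> \<in> {-T..T}" if "\<tau> \<in> {0..T}" for \<tau> using s that by auto
    have chain: "((\<lambda>\<tau>. \<phi> (s * \<tau>)) has_real_derivative s * d) (at \<tau> within {0..T})"
      if "(\<phi> has_real_derivative d) (at (s * \<tau>) within {-T..T})" "\<tau> \<in> {0..T}" for \<phi> d \<tau>
    proof -
      have "(\<phi> has_real_derivative d) (at (s * \<tau>) within (\<lambda>\<tau>. s * \<tau>) ` {0..T})"
        by (rule has_field_derivative_subset[OF that(1)]) (use sT in auto)
      moreover have "((\<lambda>\<tau>. s * \<tau>) has_real_derivative s) (at \<tau> within {0..T})"
        by (auto intro!: derivative_eq_intros)
      ultimately show ?thesis
        using DERIV_image_chain[of \<phi> d "\<lambda>\<tau>. s * \<tau>" \<tau> "{0..T}" s] by (simp add: o_def mult.commute)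
    qed
    show ?thesis
    proof (rule lattice_energy[where T = T and s = s and \<kappa> = \<kappa> and \<rho> = \<rho> and t = \<tau> and F = F
          and \<eta> = "\<lambda>\<tau> n. u (s * \<tau>) n - U (s * \<tau>) n" and \<xi> = "\<lambda>\<tau> n. q (s * \<tau>) n - Q (s * \<tau>) n"
          and a = "\<lambda>\<tau> n. 1 - (U (s * \<tau>) n)\<^sup>2 / 2" and a' = "\<lambda>\<tau> n. - s * (U (s * \<tau>) n * U' (s * \<tau>) n)"
          and m = "\<lambda>\<tau> n. cubic_part (U (s * \<tau>) n) (u (s * \<tau>) n - U (s * \<tau>) n)"
          and ?R1.0 = "\<lambda>\<tau> n. s * R1 (s * \<tau>) n" and ?R2.0 = "\<lambda>\<tau> n. s * R2 (s * \<tau>) n"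
          and M = "M + 1 + (B + B^3 + \<bar>k\<bar>)" and A = "A0 * \<epsilon>^5"])
      fix \<tau> n assume \<tau>: "\<tau> \<in> {0..T}"
      note st = sT[OF \<tau>]
      have dU: "((\<lambda>\<tau>. U (s * \<tau>) n) has_real_derivative s * U' (s * \<tau>) n) (at \<tau> within {0..T})"
        by (rule chain[OF has_field_derivative_at_within[OF has_derivative_U] \<tau>])
      have dQ: "((\<lambda>\<tau>. Q (s * \<tau>) n) has_real_derivative s * Q' (s * \<tau>) n) (at \<tau> within {0..T})"
        by (rule chain[OF has_field_derivative_at_within[OF has_derivative_Q] \<tau>])
      show "((\<lambda>\<tau>. u (s * \<tau>) n - U (s * \<tau>) n) has_real_derivative
          s * ((q (s * \<tau>) (n + 1) - Q (s * \<tau>) (n + 1)) - (q (s * \<tau>) n - Q (s * \<tau>) n)) + s * R1 (s * \<tau>) n) (at \<tau> within {0..T})"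
        by (rule derivative_eq_intros chain[OF du[OF st] \<tau>] dU refl)+ (simp add: R1_def algebra_simps)
      show "((\<lambda>\<tau>. q (s * \<tau>) n - Q (s * \<tau>) n) has_real_derivative
          s * (((1 - (U (s * \<tau>) n)\<^sup>2 / 2) * (u (s * \<tau>) n - U (s * \<tau>) n) - cubic_part (U (s * \<tau>) n) (u (s * \<tau>) n - U (s * \<tau>) n))
           - ((1 - (U (s * \<tau>) (n - 1))\<^sup>2 / 2) * (u (s * \<tau>) (n - 1) - U (s * \<tau>) (n - 1))
              - cubic_part (U (s * \<tau>) (n - 1)) (u (s * \<tau>) (n - 1) - U (s * \<tau>) (n - 1)))) + s * R2 (s * \<tau>) n) (at \<tau> within {0..T})"
        by (rule derivative_eq_intros chain[OF dq[OF st] \<tau>] dQ refl)+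
           (simp add: R2_def cut_force_def right_diff_distrib distrib_left)
      show "((\<lambda>\<tau>. 1 - (U (s * \<tau>) n)\<^sup>2 / 2) has_real_derivative - s * (U (s * \<tau>) n * U' (s * \<tau>) n)) (at \<tau> within {0..T})"
        by (auto intro!: derivative_eq_intros dU)
      have U2: "(U (s * \<tau>) n)\<^sup>2 \<le> 1" using abs_U_le_1 by (simp add: abs_square_le_1)
      show "1 / 2 \<le> 1 - (U (s * \<tau>) n)\<^sup>2 / 2 \<and> 1 - (U (s * \<tau>) n)\<^sup>2 / 2 \<le> 1"
        using U2 by simp
      show "\<bar>- s * (U (s * \<tau>) n * U' (s * \<tau>) n)\<bar> \<le> \<kappa>"
      proof -
        have "\<bar>U (s * \<tau>) n\<bar> * \<bar>U' (s * \<tau>) n\<bar> \<le> (\<epsilon> * B) * (2 * \<epsilon>\<^sup>2 * B^3)"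
          using abs_U_le[of "s * \<tau>" n] abs_U'_le[of "s * \<tau>" n] \<epsilon>_pos B_ge_1 by (intro mult_mono) auto
        also have "\<dots> = \<kappa>" by (simp add: \<kappa>_def eval_nat_numeral)
        finally show ?thesis using s by (auto simp: abs_mult)
      qed
      show "\<bar>cubic_part (U (s * \<tau>) n) (u (s * \<tau>) n - U (s * \<tau>) n)\<bar> \<le> \<kappa> * \<bar>u (s * \<tau>) n - U (s * \<tau>) n\<bar>"
      proof -
        have "B * 1 \<le> B * (2 * B^3)" using B_ge_1 B_powers[of 3] by (intro mult_left_mono) linarith+
        then have "B * \<epsilon>^3 \<le> 2 * B^4 * \<epsilon>^3" using \<epsilon>_pos by (intro mult_right_mono) (auto simp: eval_nat_numeral)
        then have "B * \<epsilon>^3 * \<bar>u (s * \<tau>) n - U (s * \<tau>) n\<bar> \<le> \<kappa> * \<bar>u (s * \<tau>) n - U (s * \<tau>) n\<bar>"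
          unfolding \<kappa>_def by (rule mult_right_mono) simp
        then show ?thesis using abs_cubic_part_le[OF abs_U_le, of "s * \<tau>" n "u (s * \<tau>) n - U (s * \<tau>) n"] by linarith
      qed
      show "\<bar>u (s * \<tau>) n - U (s * \<tau>) n\<bar> \<le> M + 1 + (B + B^3 + \<bar>k\<bar>) \<and> \<bar>q (s * \<tau>) n - Q (s * \<tau>) n\<bar> \<le> M + 1 + (B + B^3 + \<bar>k\<bar>)"
      proof -
        have "0 \<le> B + B^3 + \<bar>k\<bar>" using B_ge_1 by simp
        then show ?thesis using M[OF st, of n] abs_U_le_1[of "s * \<tau>" n] abs_Q_le[of "s * \<tau>" n] by linarith
      qed
    next
      fix \<tau> and F :: "int set" assume "\<tau> \<in> {0..T}" "finite F"
      have "s\<^sup>2 = 1" using s by auto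
      then show "(\<Sum>n\<in>F. (s * R1 (s * \<tau>) n)\<^sup>2 + (s * R2 (s * \<tau>) n)\<^sup>2) \<le> \<rho>"
        using sum_residual_le[OF \<open>finite F\<close>, of "s * \<tau>"] by (simp add: power_mult_distrib \<rho>_def)
    next
      show "\<bar>s\<bar> \<le> 1" using s by auto
    qed (use \<kappa> \<tau> F init in auto)
  qed
  obtain s \<tau> where st: "s = 1 \<or> s = -1" "\<tau> \<in> {0..T}" "t = s * \<tau>" "\<bar>t\<bar> = \<tau>"
  proof (cases "0 \<le> t")
    case True
    then show thesis using that[of 1 t] t by auto
  next
    case False
    then show thesis using that[of "-1" "- t"] t by auto
  qed
  have "2 * (A0 * \<epsilon>^5 + \<rho> / (18 * \<kappa>\<^sup>2)) * exp (18 * \<kappa> * \<tau>) = 2 * (A0 + S0 / 9) * \<epsilon>^5 * exp (36 * B^4 * \<epsilon>^3 * \<bar>t\<bar>)"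
    unfolding \<rho>\<kappa> st(4) by (simp add: \<kappa>_def distrib_right mult.assoc)
  then show ?thesis using main[OF st(1,2)] unfolding st(3)[symmetric] by simp
qed

end

section \<open>Approximation of FPUT solutions\<close>

lemma continuous_on_Icc_norm_bounded:
  fixes z :: "real \<Rightarrow> 'a::real_normed_vector"
  assumes "continuous_on {a..b} z"
  shows "\<exists>M. \<forall>t\<in>{a..b}. norm (z t) \<le> M"
  using compact_imp_bounded[OF compact_continuous_image[OF assms compact_Icc]] by (auto simp: bounded_iff)

lemma l2norm_le_sqrt:
  assumes "\<And>F. finite F \<Longrightarrow> (\<Sum>n\<in>F. (a n)\<^sup>2) \<le> c"
  shows "in_l2 a" "l2norm a \<le> sqrt c"
proof -
  show l2: "in_l2 a"
    unfolding in_l2_def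
    by (rule nonneg_bdd_above_summable_on) (use assms in \<open>auto intro!: bdd_aboveI[of _ c]\<close>)
  have "(\<Sum>\<^sub>\<infinity>n. (a n)\<^sup>2) \<le> c"
    by (rule infsum_le_finite_sums) (use l2 assms in \<open>auto simp: in_l2_def\<close>)
  then show "l2norm a \<le> sqrt c" by (simp add: l2norm_def)
qed

lemma sum_square_le_l2norm:
  assumes "in_l2 a" "finite F"
  shows "(\<Sum>n\<in>F. (a n)\<^sup>2) \<le> (l2norm a)\<^sup>2"
proof -
  have "(\<Sum>n\<in>F. (a n)\<^sup>2) \<le> (\<Sum>\<^sub>\<infinity>n. (a n)\<^sup>2)"
    using assms by (intro finite_sum_le_infsum) (auto simp: in_l2_def)
  moreover have "0 \<le> (\<Sum>\<^sub>\<infinity>n. (a n)\<^sup>2)" by (intro infsum_nonneg) auto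
  ultimately show ?thesis by (simp add: l2norm_def)
qed

lemma l2norm_nonneg: "0 \<le> l2norm a"
  unfolding l2norm_def by (intro real_sqrt_ge_zero infsum_nonneg) auto

lemma fput_force_locally_lipschitz:
  assumes "\<bar>x\<bar> \<le> M" "\<bar>y\<bar> \<le> M"
  shows "\<bar>fput_force x - fput_force y\<bar> \<le> (1 + M\<^sup>2) * \<bar>x - y\<bar>"
proof -
  have M: "0 \<le> M" using assms by linarith
  have "\<bar>x * x + x * y + y * y\<bar> \<le> 3 * M\<^sup>2"
  proof -
    have m: "\<bar>a * b\<bar> \<le> M\<^sup>2" if "\<bar>a\<bar> \<le> M" "\<bar>b\<bar> \<le> M" for a b
      unfolding abs_mult power2_eq_square using that M by (intro mult_mono) auto
    have "\<bar>p + q + r\<bar> \<le> 3 * c" if "\<bar>p\<bar> \<le> c" "\<bar>q\<bar> \<le> c" "\<bar>r\<bar> \<le> c" for p q r c :: real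
      using that by linarith
    then show ?thesis using m assms by blast
  qed
  then have "\<bar>(x * x + x * y + y * y) / 6\<bar> \<le> M\<^sup>2" by simp
  then have "\<bar>1 - (x * x + x * y + y * y) / 6\<bar> \<le> 1 + M\<^sup>2" by linarith
  then have "\<bar>1 - (x * x + x * y + y * y) / 6\<bar> * \<bar>x - y\<bar> \<le> (1 + M\<^sup>2) * \<bar>x - y\<bar>"
    by (intro mult_right_mono) auto
  moreover have "fput_force x - fput_force y = (1 - (x * x + x * y + y * y) / 6) * (x - y)"
    by (simp add: fput_force_def eval_nat_numeral field_simps)
  ultimately show ?thesis by (simp add: abs_mult)
qed

lemma FPUT_sol_force:
  assumes "FPUT_sol T u0 q0 u q du dq" "t \<in> {-T..T}"
  shows "apply_bcontfun (dq t) n = fput_force (apply_bcontfun (u t) n) - fput_force (apply_bcontfun (u t) (n - 1))"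
proof -
  have "apply_bcontfun (dq t) n = apply_bcontfun (u t) n - apply_bcontfun (u t) (n - 1)
           - (1/6) * ((apply_bcontfun (u t) n)^3 - (apply_bcontfun (u t) (n - 1))^3)"
    using assms unfolding FPUT_sol_def by blast
  then show ?thesis by (simp add: fput_force_def field_simps)
qed

lemma FPUT_sol_unique:
  assumes s1: "FPUT_sol T u0 q0 u q du dq" and s2: "FPUT_sol T u0 q0 u' q' du' dq'" and t: "t \<in> {-T..T}"
  shows "u t = u' t" "q t = q' t"
proof -
  let ?I = "{-T..T}"
  have cont: "continuous_on ?I u" "continuous_on ?I u'"
    using s1 s2 unfolding FPUT_sol_def by (auto intro!: continuous_on_vector_derivative)
  obtain M1 where M1: "\<And>t. t \<in> ?I \<Longrightarrow> norm (u t) \<le> M1"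
    using continuous_on_Icc_norm_bounded[OF cont(1)] by blast
  obtain M2 where M2: "\<And>t. t \<in> ?I \<Longrightarrow> norm (u' t) \<le> M2"
    using continuous_on_Icc_norm_bounded[OF cont(2)] by blast
  define M where "M = max M1 M2"
  have M: "\<bar>apply_bcontfun (u t) n\<bar> \<le> M" "\<bar>apply_bcontfun (u' t) n\<bar> \<le> M" if "t \<in> ?I" for t n
    using M1[OF that] M2[OF that] abs_bcontfun_le[of "u t" n] abs_bcontfun_le[of "u' t" n] by (auto simp: M_def)
  define D where "D t = (u t - u' t, q t - q' t)" for t
  define D' where "D' t = (du t - du' t, dq t - dq' t)" for t
  have "D t = 0"
  proof (rule eq_zero_of_derivative_le[of T D D' "2 + 2 * (1 + M\<^sup>2)"])
    fix t assume t: "t \<in> ?I"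
    show "(D has_vector_derivative D' t) (at t within ?I)"
      unfolding D_def D'_def using s1 s2 t
      by (intro has_vector_derivative_Pair has_vector_derivative_diff) (auto simp: FPUT_sol_def)
    have "dist (du t) (du' t) \<le> 2 * norm (q t - q' t)"
    proof (rule dist_bound)
      fix n
      have "apply_bcontfun (du t) n - apply_bcontfun (du' t) n
          = apply_bcontfun (q t - q' t) (n + 1) - apply_bcontfun (q t - q' t) n"
        using s1 s2 t unfolding FPUT_sol_def by (simp add: minus_bcontfun.rep_eq)
      then show "dist (apply_bcontfun (du t) n) (apply_bcontfun (du' t) n) \<le> 2 * norm (q t - q' t)"
        using abs_bcontfun_le[of "q t - q' t" n] abs_bcontfun_le[of "q t - q' t" "n + 1"]
        by (simp add: dist_real_def)
    qed
    moreover have "dist (dq t) (dq' t) \<le> 2 * (1 + M\<^sup>2) * norm (u t - u' t)"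
    proof (rule dist_bound)
      fix n
      have l: "\<bar>fput_force (apply_bcontfun (u t) n) - fput_force (apply_bcontfun (u' t) n)\<bar> \<le> (1 + M\<^sup>2) * norm (u t - u' t)" for n
      proof -
        have "\<bar>fput_force (apply_bcontfun (u t) n) - fput_force (apply_bcontfun (u' t) n)\<bar>
            \<le> (1 + M\<^sup>2) * \<bar>apply_bcontfun (u t) n - apply_bcontfun (u' t) n\<bar>"
          by (rule fput_force_locally_lipschitz) (use M[OF t] in auto)
        also have "\<dots> \<le> (1 + M\<^sup>2) * norm (u t - u' t)"
          using abs_bcontfun_le[of "u t - u' t" n] by (intro mult_left_mono) (auto simp: minus_bcontfun.rep_eq)
        finally show ?thesis .
      qed
      show "dist (apply_bcontfun (dq t) n) (apply_bcontfun (dq' t) n) \<le> 2 * (1 + M\<^sup>2) * norm (u t - u' t)"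
        using l[of n] l[of "n - 1"] unfolding FPUT_sol_force[OF s1 t] FPUT_sol_force[OF s2 t] dist_real_def
        by linarith
    qed
    moreover have "norm (D' t) \<le> norm (du t - du' t) + norm (dq t - dq' t)"
      unfolding D'_def by (rule norm_Pair_le)
    moreover have "norm (q t - q' t) \<le> norm (D t)" "norm (u t - u' t) \<le> norm (D t)"
      unfolding D_def by (rule norm_snd_le, rule norm_fst_le)
    moreover have "2 * (1 + M\<^sup>2) * norm (u t - u' t) \<le> 2 * (1 + M\<^sup>2) * norm (D t)"
      using \<open>norm (u t - u' t) \<le> norm (D t)\<close> by (intro mult_left_mono) auto
    ultimately show "norm (D' t) \<le> (2 + 2 * (1 + M\<^sup>2)) * norm (D t)"
      by (simp add: dist_norm distrib_right)
  next
    have "(u 0, q 0) = (u' 0, q' 0)"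
      using s1 s2 unfolding FPUT_sol_def by (auto intro!: bcontfun_eqI)
    then show "D 0 = 0" by (simp add: D_def zero_prod_def)
    show "0 < 2 + 2 * (1 + M\<^sup>2)" by (simp add: add_pos_nonneg)
  qed (rule t)
  then show "u t = u' t" "q t = q' t" by (simp_all add: D_def zero_prod_def)
qed

context mkdv_ansatz
begin

text \<open>E stands for the growth factor of the squared error over the time interval. The
  assumption \<open>close\<close> places the squared error below \<epsilon>^4, and the relation
  between \<epsilon>, E and T is otherwise left open. The conclusions concern finite sums, from
  which square summability follows later.\<close>

lemma fput_approximation:
  fixes u0 v0 :: "int \<Rightarrow> real"
  defines "q0 \<equiv> \<lambda>n::int. \<Sum>\<^sub>\<infinity>k\<in>{..<n}. v0 k"
  assumes decay: "\<And>x j. j \<in> {1, 3} \<Longrightarrow> \<bar>g j x 0\<bar> \<le> A / (1 + x\<^sup>2)" and A: "0 \<le> A"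
    and limp: "((\<lambda>x. g 0 x 0) \<longlongrightarrow> fp) at_top" and limm: "((\<lambda>x. g 0 x 0) \<longlongrightarrow> fm) at_bot"
    and k: "k = \<epsilon> * (fm - \<epsilon>\<^sup>2 / 12 * fm^3)"
    and v: "(v0 has_sum (\<epsilon> * (fp - \<epsilon>\<^sup>2 / 12 * fp^3) - k)) UNIV"
    and u2: "in_l2 (\<lambda>n. u0 n - \<epsilon> * g 0 (\<epsilon> * of_int n) 0)"
    and v2: "in_l22 (\<lambda>n. v0 n - \<epsilon>\<^sup>2 * g 1 (\<epsilon> * of_int n) 0)"
    and uv: "l2norm (\<lambda>n. u0 n - \<epsilon> * g 0 (\<epsilon> * of_int n) 0)
       + l22norm (\<lambda>n. v0 n - \<epsilon>\<^sup>2 * g 1 (\<epsilon> * of_int n) 0) \<le> \<epsilon> powr (5/2)"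
    and small: "2 * B^4 * \<epsilon>^3 \<le> 1" and T: "0 \<le> T"
    and C1: "C1 = 2 * (1 + 128 * (1 + 4 * A\<^sup>2 * B^4) + S0 / 9)"
    and growth: "exp (36 * B^4 * \<epsilon>^3 * T) \<le> E" and close: "C1 * \<epsilon> * E \<le> 1"
  obtains u q du dq where "FPUT_sol T u0 q0 u q du dq"
    and "\<And>t F. t \<in> {-T..T} \<Longrightarrow> finite F \<Longrightarrow> (\<Sum>n\<in>F. (apply_bcontfun (u t) n - \<epsilon> * g 0 (\<epsilon> * (of_int n + t)) (\<epsilon>^3 * t))\<^sup>2) \<le> C1 * \<epsilon>^5 * E"
    and "\<And>t F. t \<in> {-T..T} \<Longrightarrow> finite F \<Longrightarrow> (\<Sum>n\<in>F. (apply_bcontfun (du t) n - \<epsilon>\<^sup>2 * g 1 (\<epsilon> * (of_int n + t)) (\<epsilon>^3 * t))\<^sup>2)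
       \<le> (8 * C1 + 32 * B^8 * S0 + 4 * B^4 * S0) * \<epsilon>^5 * E"
proof -
  define A0 where "A0 = 1 + 128 * (1 + 4 * A\<^sup>2 * B^4)"
  define D where "D = \<epsilon> powr (5/2)"
  let ?I = "{-T..T}"
  have D: "D\<^sup>2 = \<epsilon>^5"
  proof -
    have "D\<^sup>2 = \<epsilon> powr (real 5)" unfolding D_def power2_eq_square by (simp flip: powr_add)
    also have "\<dots> = \<epsilon>^5" using \<epsilon>_pos by (rule powr_realpow)
    finally show ?thesis .
  qed
  have l22: "l2norm (l22weight (\<lambda>n. v0 n - \<epsilon>\<^sup>2 * g 1 (\<epsilon> * of_int n) 0)) \<le> D"
    and l2: "l2norm (\<lambda>n. u0 n - \<epsilon> * g 0 (\<epsilon> * of_int n) 0) \<le> D"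
    using uv l2norm_nonneg[of "\<lambda>n. u0 n - \<epsilon> * g 0 (\<epsilon> * of_int n) 0"]
      l2norm_nonneg[of "l22weight (\<lambda>n. v0 n - \<epsilon>\<^sup>2 * g 1 (\<epsilon> * of_int n) 0)"]
    unfolding l22norm_def D_def by linarith+
  have D0: "0 \<le> D" by (simp add: D_def)
  have single: "\<bar>a n\<bar> \<le> D" if "in_l2 a" "l2norm a \<le> D" for a n
  proof -
    have "(a n)\<^sup>2 \<le> (l2norm a)\<^sup>2" using sum_square_le_l2norm[OF that(1), of "{n}"] by simp
    also have "\<dots> \<le> D\<^sup>2" using that(2) l2norm_nonneg by (intro power_mono)
    finally have "\<bar>a n\<bar> \<le> \<bar>D\<bar>" by (simp only: abs_le_square_iff)
    then show ?thesis using D0 by simp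
  qed
  have e: "(1 + (of_int n)\<^sup>2) * \<bar>v0 n - \<epsilon>\<^sup>2 * g 1 (\<epsilon> * of_int n) 0\<bar> \<le> D" for n
  proof -
    have j: "(jbr (of_int n))\<^sup>2 = 1 + (of_int n)\<^sup>2" by (simp add: jbr_def add_nonneg_nonneg)
    have "\<bar>l22weight (\<lambda>n. v0 n - \<epsilon>\<^sup>2 * g 1 (\<epsilon> * of_int n) 0) n\<bar> \<le> D"
      using v2 l22 by (intro single) (auto simp: in_l22_def)
    then show ?thesis unfolding l22weight_def j by (simp add: abs_mult)
  qed
  have U0: "U 0 n = \<epsilon> * g 0 (\<epsilon> * of_int n) 0" for n by (simp add: U_def)
  have init: "(\<Sum>n\<in>F. (u0 n - U 0 n)\<^sup>2 + (q0 n - Q 0 n)\<^sup>2) \<le> A0 * \<epsilon>^5" if F: "finite F" for F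
  proof -
    have "(\<Sum>n\<in>F. (u0 n - U 0 n)\<^sup>2) \<le> (l2norm (\<lambda>n. u0 n - \<epsilon> * g 0 (\<epsilon> * of_int n) 0))\<^sup>2"
      unfolding U0 by (rule sum_square_le_l2norm[OF u2 F])
    also have "\<dots> \<le> D\<^sup>2" using l2 l2norm_nonneg by (intro power_mono)
    finally have "(\<Sum>n\<in>F. (u0 n - U 0 n)\<^sup>2) \<le> \<epsilon>^5" by (simp only: D)
    moreover have "(\<Sum>n\<in>F. (q0 n - Q 0 n)\<^sup>2) \<le> 128 * (1 + 4 * A\<^sup>2 * B^4) * \<epsilon>^5"
      unfolding q0_def by (rule initial_momentum_bound[OF _ A limp limm k v e D F]) (rule decay)
    ultimately show ?thesis unfolding sum.distrib A0_def distrib_right[of 1] by linarith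
  qed
  have E1: "1 \<le> E"
  proof -
    have "1 \<le> exp (36 * B^4 * \<epsilon>^3 * T)" using T B_ge_1 \<epsilon>_pos by simp
    then show ?thesis using growth by linarith
  qed
  have A0nn: "0 \<le> A0" using init[of "{}"] \<epsilon>_pos by (simp add: zero_le_mult_iff)
  have C1': "C1 = 2 * (A0 + S0 / 9)" by (simp add: C1 A0_def)
  have C1nn: "0 \<le> C1" using A0nn S0_pos by (simp add: C1')
  \<comment> \<open>Sitewise bounds on the data, which allow u0 and q0 to be lifted to bounded
    sequences.\<close>
  have init1: "\<bar>u0 n - U 0 n\<bar> \<le> A0 + 1" "\<bar>q0 n - Q 0 n\<bar> \<le> A0 + 1" for n
  proof -
    have "\<epsilon>^5 \<le> 1" using \<epsilon>_pos \<epsilon>_le_1 by (intro power_le_one) auto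
    then have "A0 * \<epsilon>^5 \<le> A0 * 1" using A0nn by (intro mult_left_mono)
    then have s: "(u0 n - U 0 n)\<^sup>2 + (q0 n - Q 0 n)\<^sup>2 \<le> A0" using init[of "{n}"] by simp
    have aux: "\<bar>x\<bar> \<le> A0 + 1" if "x\<^sup>2 \<le> A0" for x
    proof -
      have "A0 \<le> (A0 + 1)\<^sup>2" using A0nn by (simp add: power2_sum add_increasing)
      then have "x\<^sup>2 \<le> (A0 + 1)\<^sup>2" using that by linarith
      then have "\<bar>x\<bar> \<le> \<bar>A0 + 1\<bar>" by (simp only: abs_le_square_iff)
      then show ?thesis using A0nn by simp
    qed
    show "\<bar>u0 n - U 0 n\<bar> \<le> A0 + 1" "\<bar>q0 n - Q 0 n\<bar> \<le> A0 + 1"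
      using s zero_le_power2[of "u0 n - U 0 n"] zero_le_power2[of "q0 n - Q 0 n"] by (intro aux; linarith)+
  qed
  have u0b: "apply_bcontfun (Bcontfun u0) = u0"
  proof (rule apply_Bcontfun_int)
    show "\<bar>u0 n\<bar> \<le> A0 + 2" for n using init1(1)[of n] abs_U_le_1[of 0 n] by linarith
  qed
  have q0b: "apply_bcontfun (Bcontfun q0) = q0"
  proof (rule apply_Bcontfun_int)
    show "\<bar>q0 n\<bar> \<le> A0 + 1 + (B + B^3 + \<bar>k\<bar>)" for n using init1(2)[of n] abs_Q_le[of 0 n] by linarith
  qed
  obtain u q du dq :: "real \<Rightarrow> (int \<Rightarrow>\<^sub>C real)" where sol0: "u 0 = Bcontfun u0" "q 0 = Bcontfun q0"
    and du: "\<And>t. t \<in> ?I \<Longrightarrow> (u has_vector_derivative du t) (at t within ?I)"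
    and dq: "\<And>t. t \<in> ?I \<Longrightarrow> (q has_vector_derivative dq t) (at t within ?I)"
    and du': "\<And>t n. apply_bcontfun (du t) n = apply_bcontfun (q t) (n + 1) - apply_bcontfun (q t) n"
    and dq': "\<And>t n. apply_bcontfun (dq t) n = cut_force (U t n) (apply_bcontfun (u t) n) - cut_force (U t (n - 1)) (apply_bcontfun (u t) (n - 1))"
    by (rule truncated_system_exists[OF T, of "Bcontfun u0" "Bcontfun q0"]) blast
  have cont: "continuous_on ?I u" "continuous_on ?I q"
    by (rule continuous_on_vector_derivative, erule du dq)+
  obtain M1 where M1: "\<And>t. t \<in> ?I \<Longrightarrow> norm (u t) \<le> M1"
    using continuous_on_Icc_norm_bounded[OF cont(1)] by blast
  obtain M2 where M2: "\<And>t. t \<in> ?I \<Longrightarrow> norm (q t) \<le> M2"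
    using continuous_on_Icc_norm_bounded[OF cont(2)] by blast
  have comp: "((\<lambda>t. apply_bcontfun (z t) n) has_real_derivative apply_bcontfun z' n) (at t within ?I)"
    if "(z has_vector_derivative z') (at t within ?I)" for z and z' :: "int \<Rightarrow>\<^sub>C real" and t n
    using bounded_linear.has_vector_derivative[OF bounded_linear_apply_bcontfun that]
    by (simp add: has_real_derivative_iff_has_vector_derivative)
  have err: "(\<Sum>n\<in>F. (apply_bcontfun (u t) n - U t n)\<^sup>2 + (apply_bcontfun (q t) n - Q t n)\<^sup>2) \<le> C1 * \<epsilon>^5 * E"
    if t: "t \<in> ?I" and F: "finite F" for t F
  proof -
    have "(\<Sum>n\<in>F. (apply_bcontfun (u t) n - U t n)\<^sup>2 + (apply_bcontfun (q t) n - Q t n)\<^sup>2)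
        \<le> 2 * (A0 + S0 / 9) * \<epsilon>^5 * exp (36 * B^4 * \<epsilon>^3 * \<bar>t\<bar>)"
    proof (rule truncated_system_error[OF _ _ _ _ small t F, where M = "max M1 M2"])
      fix t n assume t: "t \<in> ?I"
      show "((\<lambda>t. apply_bcontfun (u t) n) has_real_derivative apply_bcontfun (q t) (n + 1) - apply_bcontfun (q t) n) (at t within ?I)"
        using comp[OF du[OF t], of n] by (simp add: du')
      show "((\<lambda>t. apply_bcontfun (q t) n) has_real_derivative
          cut_force (U t n) (apply_bcontfun (u t) n) - cut_force (U t (n - 1)) (apply_bcontfun (u t) (n - 1))) (at t within ?I)"
        using comp[OF dq[OF t], of n] by (simp add: dq')
      show "\<bar>apply_bcontfun (u t) n\<bar> \<le> max M1 M2 \<and> \<bar>apply_bcontfun (q t) n\<bar> \<le> max M1 M2"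
        using M1[OF t] M2[OF t] abs_bcontfun_le[of "u t" n] abs_bcontfun_le[of "q t" n] by linarith
    next
      fix F :: "int set" assume "finite F"
      then show "(\<Sum>n\<in>F. (apply_bcontfun (u 0) n - U 0 n)\<^sup>2 + (apply_bcontfun (q 0) n - Q 0 n)\<^sup>2) \<le> A0 * \<epsilon>^5"
        using init by (simp add: sol0 u0b q0b)
    qed
    also have "\<dots> \<le> C1 * \<epsilon>^5 * E"
    proof -
      have "36 * B^4 * \<epsilon>^3 * \<bar>t\<bar> \<le> 36 * B^4 * \<epsilon>^3 * T" using t B_ge_1 \<epsilon>_pos by (intro mult_left_mono) auto
      then have "exp (36 * B^4 * \<epsilon>^3 * \<bar>t\<bar>) \<le> E" using growth by (meson exp_le_cancel_iff order_trans)
      then show ?thesis unfolding C1' using A0nn S0_pos \<epsilon>_pos by (intro mult_left_mono) auto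
    qed
    finally show ?thesis .
  qed
  \<comment> \<open>The squared error at one site is at most (C1 \<epsilon> E) \<epsilon>^4, and
    \<open>close\<close> bounds the bracket by 1. From here on the truncated force is the true
    one.\<close>
  have near: "\<bar>apply_bcontfun (u t) n - U t n\<bar> \<le> \<epsilon>\<^sup>2" if t: "t \<in> ?I" for t n
  proof -
    have "(apply_bcontfun (u t) n - U t n)\<^sup>2 \<le> C1 * \<epsilon>^5 * E"
    proof -
      have "(apply_bcontfun (u t) n - U t n)\<^sup>2 + (apply_bcontfun (q t) n - Q t n)\<^sup>2 \<le> C1 * \<epsilon>^5 * E"
        using err[OF t, of "{n}"] by simp
      then show ?thesis using zero_le_power2[of "apply_bcontfun (q t) n - Q t n"] by linarith
    qed
    also have "\<dots> = (C1 * \<epsilon> * E) * \<epsilon>^4" by (simp add: eval_nat_numeral)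
    also have "\<dots> \<le> 1 * \<epsilon>^4" using close \<epsilon>_pos by (intro mult_right_mono) auto
    also have "\<dots> = (\<epsilon>\<^sup>2)\<^sup>2" by (simp flip: power_mult)
    finally have "\<bar>apply_bcontfun (u t) n - U t n\<bar> \<le> \<bar>\<epsilon>\<^sup>2\<bar>" by (simp only: abs_le_square_iff)
    then show ?thesis by simp
  qed
  have dqV: "apply_bcontfun (dq t) n = fput_force (apply_bcontfun (u t) n) - fput_force (apply_bcontfun (u t) (n - 1))"
    if "t \<in> ?I" for t n
    unfolding dq' using cut_force_eq[OF near[OF that]] by simp
  have l_lip: "dist (z1 :: int \<Rightarrow>\<^sub>C real) z2 \<le> c" if "\<And>n. \<bar>apply_bcontfun z1 n - apply_bcontfun z2 n\<bar> \<le> c" for z1 z2 c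
    by (rule dist_bound) (use that in \<open>simp add: dist_real_def\<close>)
  \<comment> \<open>Membership in C^1 refers to the sup norm, so the derivatives need a Lipschitz
    bound in terms of z that is uniform over the sites.\<close>
  have cont_of_lip: "continuous_on ?I dz"
    if zc: "continuous_on ?I z" and L: "0 < L"
      and lipz: "\<And>s t n. s \<in> ?I \<Longrightarrow> t \<in> ?I \<Longrightarrow> \<bar>apply_bcontfun (dz s) n - apply_bcontfun (dz t) n\<bar> \<le> L * dist (z s) (z t)"
    for z dz :: "real \<Rightarrow> (int \<Rightarrow>\<^sub>C real)" and L
    unfolding continuous_on_iff
  proof (intro ballI allI impI)
    fix t e :: real assume t: "t \<in> ?I" and e: "0 < e"
    have eL: "0 < e / L" using e L by simp
    obtain d where d: "0 < d" "\<And>s. s \<in> ?I \<Longrightarrow> dist s t < d \<Longrightarrow> dist (z s) (z t) < e / L"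
      using zc[unfolded continuous_on_iff, THEN bspec, OF t, THEN spec, THEN mp, OF eL] by blast
    have "dist (dz s) (dz t) < e" if "s \<in> ?I" "dist s t < d" for s
    proof -
      have "dist (dz s) (dz t) \<le> L * dist (z s) (z t)"
        using lipz that t
        by (intro l_lip) auto
      also have "\<dots> < L * (e / L)" using d(2)[OF that] L by (intro mult_strict_left_mono) auto
      finally show ?thesis using L by simp
    qed
    then show "\<exists>d>0. \<forall>s\<in>?I. dist s t < d \<longrightarrow> dist (dz s) (dz t) < e" using d(1) by blast
  qed
  have pt: "\<bar>apply_bcontfun z1 n - apply_bcontfun z2 n\<bar> \<le> dist z1 z2" for z1 z2 :: "int \<Rightarrow>\<^sub>C real" and n
    using dist_bounded[of z1 n z2] by (simp add: dist_real_def)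
  have c_du: "continuous_on ?I du"
  proof (rule cont_of_lip[OF cont(2), of 2])
    show "\<bar>apply_bcontfun (du s) n - apply_bcontfun (du t) n\<bar> \<le> 2 * dist (q s) (q t)" for s t n
      unfolding du' using pt[of "q s" n "q t"] pt[of "q s" "n + 1" "q t"] by linarith
  qed simp
  have c_dq: "continuous_on ?I dq"
  proof (rule cont_of_lip[OF cont(1), of "2 * (1 + M1\<^sup>2)"])
    fix s t n assume s: "s \<in> ?I" and t: "t \<in> ?I"
    have l: "\<bar>fput_force (apply_bcontfun (u s) n) - fput_force (apply_bcontfun (u t) n)\<bar> \<le> (1 + M1\<^sup>2) * dist (u s) (u t)" for n
    proof -
      have "\<bar>fput_force (apply_bcontfun (u s) n) - fput_force (apply_bcontfun (u t) n)\<bar>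
          \<le> (1 + M1\<^sup>2) * \<bar>apply_bcontfun (u s) n - apply_bcontfun (u t) n\<bar>"
        using M1[OF s] M1[OF t] abs_bcontfun_le[of "u s" n] abs_bcontfun_le[of "u t" n]
        by (intro fput_force_locally_lipschitz) auto
      also have "\<dots> \<le> (1 + M1\<^sup>2) * dist (u s) (u t)" using pt[of "u s" n "u t"] by (intro mult_left_mono) auto
      finally show ?thesis .
    qed
    show "\<bar>apply_bcontfun (dq s) n - apply_bcontfun (dq t) n\<bar> \<le> 2 * (1 + M1\<^sup>2) * dist (u s) (u t)"
      unfolding dqV[OF s] dqV[OF t] mult.assoc[of 2] using l[of n] l[of "n - 1"] by linarith
  qed (simp add: add_pos_nonneg)
  show thesis
  proof (rule that[of u q du dq])
    show "FPUT_sol T u0 q0 u q du dq"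
      unfolding FPUT_sol_def
    proof (intro conjI ballI allI)
      fix t n assume t: "t \<in> ?I"
      show "apply_bcontfun (dq t) n = apply_bcontfun (u t) n - apply_bcontfun (u t) (n - 1)
           - (1/6) * ((apply_bcontfun (u t) n)^3 - (apply_bcontfun (u t) (n - 1))^3)"
        unfolding dqV[OF t] fput_force_def by (simp add: field_simps)
    qed (use du dq c_du c_dq sol0 u0b q0b du' in auto)
  next
    fix t and F :: "int set" assume t: "t \<in> ?I" and F: "finite F"
    have "(\<Sum>n\<in>F. (apply_bcontfun (u t) n - U t n)\<^sup>2) \<le> C1 * \<epsilon>^5 * E"
      by (rule order_trans[OF sum_mono err[OF t F]]) simp
    then show "(\<Sum>n\<in>F. (apply_bcontfun (u t) n - \<epsilon> * g 0 (\<epsilon> * (of_int n + t)) (\<epsilon>^3 * t))\<^sup>2) \<le> C1 * \<epsilon>^5 * E"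
      by (simp only: U_def)
    have sx: "(\<Sum>n\<in>G. (apply_bcontfun (q t) n - Q t n)\<^sup>2) \<le> C1 * \<epsilon>^5 * E" if "finite G" for G
      by (rule order_trans[OF sum_mono err[OF t that]]) simp
    define \<xi> where "\<xi> n = apply_bcontfun (q t) n - Q t n" for n
    define w where "w n = U' t n - \<epsilon>\<^sup>2 * g 1 (\<epsilon> * (of_int n + t)) (\<epsilon>^3 * t)" for n
    \<comment> \<open>The velocity error is the increment of the momentum error, plus the residual
      of the first equation, plus the part of \<open>U'\<close> beyond \<epsilon>^2 f'. It therefore
      needs no energy estimate of its own.\<close>
    have "(apply_bcontfun (du t) n - \<epsilon>\<^sup>2 * g 1 (\<epsilon> * (of_int n + t)) (\<epsilon>^3 * t))\<^sup>2
        \<le> 4 * (\<xi> (n + 1))\<^sup>2 + 4 * (\<xi> n)\<^sup>2 + 4 * (R1 t n)\<^sup>2 + 4 * (w n)\<^sup>2" for n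
    proof -
      have "apply_bcontfun (du t) n - \<epsilon>\<^sup>2 * g 1 (\<epsilon> * (of_int n + t)) (\<epsilon>^3 * t) = \<xi> (n + 1) - \<xi> n + R1 t n + w n"
        unfolding du' \<xi>_def w_def R1_def by simp
      moreover have "(a - b + c + d)\<^sup>2 \<le> 4 * a\<^sup>2 + 4 * b\<^sup>2 + 4 * c\<^sup>2 + 4 * d\<^sup>2" for a b c d :: real
        using zero_le_power2[of "a + b"] zero_le_power2[of "a - c"] zero_le_power2[of "a - d"]
          zero_le_power2[of "b + c"] zero_le_power2[of "b + d"] zero_le_power2[of "c - d"]
        by (simp add: power2_eq_square algebra_simps)
      ultimately show ?thesis by (simp only:)
    qed
    then have "(\<Sum>n\<in>F. (apply_bcontfun (du t) n - \<epsilon>\<^sup>2 * g 1 (\<epsilon> * (of_int n + t)) (\<epsilon>^3 * t))\<^sup>2)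
        \<le> (\<Sum>n\<in>F. 4 * (\<xi> (n + 1))\<^sup>2 + 4 * (\<xi> n)\<^sup>2 + 4 * (R1 t n)\<^sup>2 + 4 * (w n)\<^sup>2)"
      by (rule sum_mono)
    also have "\<dots> = 4 * (\<Sum>n\<in>F. (\<xi> (n + 1))\<^sup>2) + 4 * (\<Sum>n\<in>F. (\<xi> n)\<^sup>2) + 4 * (\<Sum>n\<in>F. (R1 t n)\<^sup>2) + 4 * (\<Sum>n\<in>F. (w n)\<^sup>2)"
      by (simp only: sum.distrib sum_distrib_left)
    also have "\<dots> \<le> 4 * (C1 * \<epsilon>^5 * E) + 4 * (C1 * \<epsilon>^5 * E) + 4 * (8 * B^8 * S0 * (\<epsilon>^5 * E)) + 4 * (B^4 * S0 * (\<epsilon>^5 * E))"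
    proof (intro add_mono mult_left_mono)
      have "(\<Sum>n\<in>F. (\<xi> (n + 1))\<^sup>2) = (\<Sum>n\<in>(\<lambda>n. n + 1) ` F. (\<xi> n)\<^sup>2)"
        by (subst sum.reindex) (auto simp: inj_on_def)
      also have "\<dots> \<le> C1 * \<epsilon>^5 * E" unfolding \<xi>_def using F by (intro sx) auto
      finally show "(\<Sum>n\<in>F. (\<xi> (n + 1))\<^sup>2) \<le> C1 * \<epsilon>^5 * E" .
      show "(\<Sum>n\<in>F. (\<xi> n)\<^sup>2) \<le> C1 * \<epsilon>^5 * E" unfolding \<xi>_def by (rule sx[OF F])
      have pw: "\<epsilon>^j \<le> \<epsilon>^5 * E" if "5 \<le> j" for j
      proof -
        have "\<epsilon>^j * 1 \<le> \<epsilon>^5 * E" using that \<epsilon>_pos \<epsilon>_le_1 E1 by (intro mult_mono power_decreasing) auto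
        then show ?thesis by simp
      qed
      have "(\<Sum>n\<in>F. (R1 t n)\<^sup>2) \<le> (\<Sum>n\<in>F. (R1 t n)\<^sup>2 + (R2 t n)\<^sup>2)" by (rule sum_mono) simp
      also have "\<dots> \<le> 8 * B^8 * S0 * \<epsilon>^11" by (rule sum_residual_le[OF F])
      also have "\<dots> \<le> 8 * B^8 * S0 * (\<epsilon>^5 * E)" using S0_pos by (intro mult_left_mono pw) auto
      finally show "(\<Sum>n\<in>F. (R1 t n)\<^sup>2) \<le> 8 * B^8 * S0 * (\<epsilon>^5 * E)" .
      have "(\<Sum>n\<in>F. (w n)\<^sup>2) \<le> B^4 * S0 * \<epsilon>^7" unfolding w_def by (rule sum_velocity_correction_le[OF F])
      also have "\<dots> \<le> B^4 * S0 * (\<epsilon>^5 * E)" using S0_pos by (intro mult_left_mono pw) auto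
      finally show "(\<Sum>n\<in>F. (w n)\<^sup>2) \<le> B^4 * S0 * (\<epsilon>^5 * E)" .
    qed auto
    also have "\<dots> = (8 * C1 + 32 * B^8 * S0 + 4 * B^4 * S0) * \<epsilon>^5 * E" by (simp add: algebra_simps)
    finally show "(\<Sum>n\<in>F. (apply_bcontfun (du t) n - \<epsilon>\<^sup>2 * g 1 (\<epsilon> * (of_int n + t)) (\<epsilon>^3 * t))\<^sup>2)
       \<le> (8 * C1 + 32 * B^8 * S0 + 4 * B^4 * S0) * \<epsilon>^5 * E" .
  qed
qed

end

theorem theorem2:
  fixes f :: "real \<Rightarrow> real \<Rightarrow> real" and fp fm r :: real
    and wp wm :: "real \<Rightarrow> real"
  assumes wp: "weight_plus wp" and wm: "weight_minus wm"
    and sol: "mkdv_sol f"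
    and reg: "Cb_X 6 f"
    and limp: "\<forall>T. ((\<lambda>x. f x T) \<longlongrightarrow> fp) at_top"
    and limm: "\<forall>T. ((\<lambda>x. f x T) \<longlongrightarrow> fm) at_bot"
    and r: "0 < r" "r < 1/2"
    and dec: "Xspace_w wp wm 6 2 (\<lambda>x. f x 0)"
  shows "\<exists>\<epsilon>0 C K. \<epsilon>0 > 0 \<and> C > 0 \<and> K > 0 \<and>
    (\<forall>\<epsilon> u0 v0. 0 < \<epsilon> \<and> \<epsilon> < \<epsilon>0 \<longrightarrow>
      (let Fp = fp - \<epsilon>^2 / 12 * fp^3; Fm = fm - \<epsilon>^2 / 12 * fm^3;
           t0 = r / K * \<epsilon> powr (-3) * \<bar>ln \<epsilon>\<bar>;
           q0 = (\<lambda>n::int. \<Sum>\<^sub>\<infinity>k\<in>{..<n}. v0 k) in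
       (v0 has_sum (\<epsilon> * Fp - \<epsilon> * Fm)) UNIV \<and>
       in_l2 (\<lambda>n. u0 n - \<epsilon> * f (\<epsilon> * of_int n) 0) \<and>
       in_l22 (\<lambda>n. v0 n - \<epsilon>^2 * d1 f (\<epsilon> * of_int n) 0) \<and>
       l2norm (\<lambda>n. u0 n - \<epsilon> * f (\<epsilon> * of_int n) 0)
         + l22norm (\<lambda>n. v0 n - \<epsilon>^2 * d1 f (\<epsilon> * of_int n) 0) \<le> \<epsilon> powr (5/2)
       \<longrightarrow>
       (\<exists>u q du dq. FPUT_sol t0 u0 q0 u q du dq) \<and>
       (\<forall>u q du dq u' q' du' dq'. FPUT_sol t0 u0 q0 u q du dq \<and> FPUT_sol t0 u0 q0 u' q' du' dq'
          \<longrightarrow> (\<forall>t\<in>{-t0..t0}. u t = u' t \<and> q t = q' t)) \<and>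
       (\<forall>u q du dq. FPUT_sol t0 u0 q0 u q du dq \<longrightarrow>
          (\<forall>t\<in>{-t0..t0}.
             in_l2 (\<lambda>n. apply_bcontfun (u t) n - \<epsilon> * f (\<epsilon> * (of_int n + t)) (\<epsilon>^3 * t)) \<and>
             in_l2 (\<lambda>n. apply_bcontfun (du t) n - \<epsilon>^2 * d1 f (\<epsilon> * (of_int n + t)) (\<epsilon>^3 * t)) \<and>
             l2norm (\<lambda>n. apply_bcontfun (u t) n - \<epsilon> * f (\<epsilon> * (of_int n + t)) (\<epsilon>^3 * t))
             + l2norm (\<lambda>n. apply_bcontfun (du t) n - \<epsilon>^2 * d1 f (\<epsilon> * (of_int n + t)) (\<epsilon>^3 * t))
               \<le> C * \<epsilon> powr (5/2 - r)))))"
proof -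
  define g where "g = (\<lambda>j x T. (deriv ^^ j) (\<lambda>x. f x T) x)"
  obtain B S0 where prof: "mkdv_profile g B S0"
    using mkdv_profile_exists[OF sol reg] unfolding g_def by blast
  interpret mkdv_profile g B S0 by (rule prof)
  obtain A where A: "0 \<le> A" "\<And>j x. j \<in> {1, 3} \<Longrightarrow> \<bar>g j x 0\<bar> \<le> A / (1 + x\<^sup>2)"
    using Xspace_w_decay[OF wp wm dec] unfolding g_def by blast
  have f_g: "f x T = g 0 x T" and d1_g: "d1 f x T = g 1 x T" for x T
    by (simp_all add: g_def d1_def)
  define C1 where "C1 = 2 * (1 + 128 * (1 + 4 * A\<^sup>2 * B^4) + S0 / 9)"
  define C2 where "C2 = 8 * C1 + 32 * B^8 * S0 + 4 * B^4 * S0"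
  \<comment> \<open>The growth rate 18 \<kappa> of the energy bound with \<kappa> = 2 B^4
    \<epsilon>^3, stripped of \<epsilon>^3.\<close>
  define K where "K = 36 * B^4"
  \<comment> \<open>The first entry yields \<epsilon> < 1, \<epsilon> B \<le> 1 and \<kappa> \<le>
    1. The second yields C1 sqrt \<epsilon> \<le> 1, which suffices for \<open>close\<close> because
    \<epsilon>^(1-r) \<le> sqrt \<epsilon> for r < 1/2.\<close>
  define \<epsilon>0 where "\<epsilon>0 = min (1 / (4 * B^4)) (1 / C1\<^sup>2)"
  have C1: "0 < C1" using A S0_pos B_ge_1 by (simp add: C1_def add_pos_nonneg add_nonneg_pos)
  have C2: "0 < C2" using C1 S0_pos B_ge_1 by (simp add: C2_def add_pos_nonneg)
  have K: "0 < K" using B_ge_1 by (simp add: K_def)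
  have \<epsilon>0: "0 < \<epsilon>0" using B_ge_1 C1 by (simp add: \<epsilon>0_def)
  show ?thesis
  proof (rule exI[of _ \<epsilon>0], rule exI[of _ "sqrt C1 + sqrt C2"], rule exI[of _ K], intro conjI allI impI)
    show "0 < \<epsilon>0" "0 < K" "0 < sqrt C1 + sqrt C2" using \<epsilon>0 K C1 C2 by (auto intro: add_pos_pos)
    fix \<epsilon> :: real and u0 v0 :: "int \<Rightarrow> real"
    assume \<epsilon>: "0 < \<epsilon> \<and> \<epsilon> < \<epsilon>0"
    define k where "k = \<epsilon> * (fm - \<epsilon>\<^sup>2 / 12 * fm^3)"
    define t0 where "t0 = r / K * \<epsilon> powr (-3) * \<bar>ln \<epsilon>\<bar>"
    define q0 where "q0 = (\<lambda>n::int. \<Sum>\<^sub>\<infinity>k\<in>{..<n}. v0 k)"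
    \<comment> \<open>The value of exp (K \<epsilon>^3 t0): the logarithmic time scale turns
      exponential growth into the loss of a power of \<epsilon>.\<close>
    define E where "E = \<epsilon> powr (- r)"
    have e: "0 < \<epsilon>" "\<epsilon> \<le> 1 / (4 * B^4)" "\<epsilon> \<le> 1 / C1\<^sup>2" using \<epsilon> by (auto simp: \<epsilon>0_def)
    have B4: "4 * B^4 * \<epsilon> \<le> 1" using e(1,2) B_ge_1 by (simp add: field_simps)
    have "\<epsilon> * 4 \<le> 4 * B^4 * \<epsilon>" using e(1) B_powers[of 4] by simp
    then have \<epsilon>1: "\<epsilon> < 1" using B4 e(1) by linarith
    have \<epsilon>B: "\<epsilon> * B \<le> 1"
    proof -
      have "B \<le> B^4" using B_ge_1 self_le_power[of B 4] by simp
      then have "\<epsilon> * B \<le> \<epsilon> * (4 * B^4)" using e(1) B_ge_1 by (intro mult_left_mono) auto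
      then show ?thesis using B4 by (simp add: mult_ac)
    qed
    have small: "2 * B^4 * \<epsilon>^3 \<le> 1"
    proof -
      have "\<epsilon>^3 \<le> \<epsilon>^1" using e(1) \<epsilon>1 by (intro power_decreasing) auto
      then have "2 * B^4 * \<epsilon>^3 \<le> 4 * B^4 * \<epsilon>" using e(1) B_ge_1 by (intro mult_mono) auto
      then show ?thesis using B4 by linarith
    qed
    interpret mkdv_ansatz g B S0 \<epsilon> k
      by unfold_locales (use e(1) \<epsilon>1 \<epsilon>B in auto)
    have t0: "0 \<le> t0" using r K by (simp add: t0_def)
    have growth: "exp (36 * B^4 * \<epsilon>^3 * t0) \<le> E"
    proof -
      have "\<epsilon> powr (-3) = inverse (\<epsilon>^3)" using e(1) by (simp add: powr_minus)
      then have "\<epsilon>^3 * \<epsilon> powr (-3) = 1" using e(1) by simp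
      then have "K * \<epsilon>^3 * t0 = r * \<bar>ln \<epsilon>\<bar>" using K by (simp add: t0_def)
      moreover have "\<bar>ln \<epsilon>\<bar> = - ln \<epsilon>" using e(1) \<epsilon>1 by simp
      ultimately show ?thesis using e(1) by (simp add: E_def powr_def K_def)
    qed
    have close: "C1 * \<epsilon> * E \<le> 1"
    proof -
      have "\<epsilon> * E = \<epsilon> powr (1 - r)" using e(1) by (simp add: E_def powr_diff powr_minus_divide)
      also have "\<dots> \<le> \<epsilon> powr (1/2)" using e(1) \<epsilon>1 r by (intro powr_mono') auto
      also have "\<dots> = sqrt \<epsilon>" using e(1) by (simp add: powr_half_sqrt)
      also have "\<dots> \<le> sqrt (1 / C1\<^sup>2)" using e(3) by (rule real_sqrt_le_mono)
      also have "\<dots> = 1 / C1" using C1 by (simp add: real_sqrt_divide)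
      finally have "C1 * (\<epsilon> * E) \<le> C1 * (1 / C1)" using C1 by (intro mult_left_mono) auto
      then show ?thesis using C1 by (simp add: mult.assoc)
    qed
    \<comment> \<open>The squared error is of order \<epsilon>^(5-r), so its root is of order
      \<epsilon>^((5-r)/2), which is at most \<epsilon>^(5/2-r) for \<epsilon> < 1.\<close>
    have root: "sqrt (c * \<epsilon>^5 * E) \<le> sqrt c * \<epsilon> powr (5/2 - r)" if "0 < c" for c
    proof -
      have "\<epsilon>^5 * E = \<epsilon> powr (5 - r)"
      proof -
        have "\<epsilon>^5 = \<epsilon> powr 5" using powr_realpow[OF e(1), of 5] by simp
        then show ?thesis by (simp add: E_def flip: powr_add)
      qed
      also have "\<dots> \<le> \<epsilon> powr (5 - 2 * r)" using e(1) \<epsilon>1 r by (intro powr_mono') auto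
      also have "\<dots> = (\<epsilon> powr (5/2 - r))\<^sup>2" by (simp add: power2_eq_square flip: powr_add)
      finally have "sqrt (\<epsilon>^5 * E) \<le> \<epsilon> powr (5/2 - r)" by (intro real_le_lsqrt) auto
      then have "sqrt c * sqrt (\<epsilon>^5 * E) \<le> sqrt c * \<epsilon> powr (5/2 - r)" using that by (intro mult_left_mono) auto
      then show ?thesis by (simp add: real_sqrt_mult mult.assoc)
    qed
    have "(\<exists>u q du dq. FPUT_sol t0 u0 q0 u q du dq) \<and>
       (\<forall>u q du dq u' q' du' dq'. FPUT_sol t0 u0 q0 u q du dq \<and> FPUT_sol t0 u0 q0 u' q' du' dq'
          \<longrightarrow> (\<forall>t\<in>{-t0..t0}. u t = u' t \<and> q t = q' t)) \<and>
       (\<forall>u q du dq. FPUT_sol t0 u0 q0 u q du dq \<longrightarrow>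
          (\<forall>t\<in>{-t0..t0}.
             in_l2 (\<lambda>n. apply_bcontfun (u t) n - \<epsilon> * g 0 (\<epsilon> * (of_int n + t)) (\<epsilon>^3 * t)) \<and>
             in_l2 (\<lambda>n. apply_bcontfun (du t) n - \<epsilon>^2 * g 1 (\<epsilon> * (of_int n + t)) (\<epsilon>^3 * t)) \<and>
             l2norm (\<lambda>n. apply_bcontfun (u t) n - \<epsilon> * g 0 (\<epsilon> * (of_int n + t)) (\<epsilon>^3 * t))
             + l2norm (\<lambda>n. apply_bcontfun (du t) n - \<epsilon>^2 * g 1 (\<epsilon> * (of_int n + t)) (\<epsilon>^3 * t))
               \<le> (sqrt C1 + sqrt C2) * \<epsilon> powr (5/2 - r)))"
      if v: "(v0 has_sum (\<epsilon> * (fp - \<epsilon>\<^sup>2 / 12 * fp^3) - k)) UNIV"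
        and u2: "in_l2 (\<lambda>n. u0 n - \<epsilon> * g 0 (\<epsilon> * of_int n) 0)"
        and v2: "in_l22 (\<lambda>n. v0 n - \<epsilon>\<^sup>2 * g 1 (\<epsilon> * of_int n) 0)"
        and uv: "l2norm (\<lambda>n. u0 n - \<epsilon> * g 0 (\<epsilon> * of_int n) 0)
          + l22norm (\<lambda>n. v0 n - \<epsilon>\<^sup>2 * g 1 (\<epsilon> * of_int n) 0) \<le> \<epsilon> powr (5/2)"
    proof -
      have lim: "((\<lambda>x. g 0 x 0) \<longlongrightarrow> fp) at_top" "((\<lambda>x. g 0 x 0) \<longlongrightarrow> fm) at_bot"
        using limp limm by (simp_all add: f_g)
      obtain u q du dq where s: "FPUT_sol t0 u0 q0 u q du dq"
        and su: "\<And>t F. t \<in> {-t0..t0} \<Longrightarrow> finite F \<Longrightarrow> (\<Sum>n\<in>F. (apply_bcontfun (u t) n - \<epsilon> * g 0 (\<epsilon> * (of_int n + t)) (\<epsilon>^3 * t))\<^sup>2) \<le> C1 * \<epsilon>^5 * E"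
        and sv: "\<And>t F. t \<in> {-t0..t0} \<Longrightarrow> finite F \<Longrightarrow> (\<Sum>n\<in>F. (apply_bcontfun (du t) n - \<epsilon>\<^sup>2 * g 1 (\<epsilon> * (of_int n + t)) (\<epsilon>^3 * t))\<^sup>2)
           \<le> C2 * \<epsilon>^5 * E"
        unfolding q0_def C2_def
        by (rule fput_approximation[OF _ A(1) lim k_def v u2 v2 uv small t0 C1_def growth close])
           (use A(2) in blast)+
      have unique: "u1 t = u2 t \<and> q1 t = q2 t"
        if "FPUT_sol t0 u0 q0 u1 q1 du1 dq1" "FPUT_sol t0 u0 q0 u2 q2 du2 dq2" "t \<in> {-t0..t0}"
        for u1 q1 du1 dq1 u2 q2 du2 dq2 t
        using FPUT_sol_unique[OF that] by simp
      have est: "in_l2 (\<lambda>n. apply_bcontfun (u' t) n - \<epsilon> * g 0 (\<epsilon> * (of_int n + t)) (\<epsilon>^3 * t)) \<and>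
             in_l2 (\<lambda>n. apply_bcontfun (du' t) n - \<epsilon>^2 * g 1 (\<epsilon> * (of_int n + t)) (\<epsilon>^3 * t)) \<and>
             l2norm (\<lambda>n. apply_bcontfun (u' t) n - \<epsilon> * g 0 (\<epsilon> * (of_int n + t)) (\<epsilon>^3 * t))
             + l2norm (\<lambda>n. apply_bcontfun (du' t) n - \<epsilon>^2 * g 1 (\<epsilon> * (of_int n + t)) (\<epsilon>^3 * t))
               \<le> (sqrt C1 + sqrt C2) * \<epsilon> powr (5/2 - r)"
        if s': "FPUT_sol t0 u0 q0 u' q' du' dq'" and t: "t \<in> {-t0..t0}" for u' q' du' dq' t
      proof -
        \<comment> \<open>The estimate is claimed for every solution. Uniqueness identifies u and q
          with the constructed ones, and the first lattice equation then identifies the velocities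
          as well.\<close>
        have uq: "u' t = u t" "q' t = q t" using unique[OF s' s t] by auto
        have "apply_bcontfun (du' t) n = apply_bcontfun (du t) n" for n
        proof -
          have "apply_bcontfun (du' t) n = apply_bcontfun (q' t) (n + 1) - apply_bcontfun (q' t) n"
            "apply_bcontfun (du t) n = apply_bcontfun (q t) (n + 1) - apply_bcontfun (q t) n"
            using s s' t unfolding FPUT_sol_def by blast+
          then show ?thesis using uq by simp
        qed
        then have du: "apply_bcontfun (du' t) = apply_bcontfun (du t)" by blast
        note lu = l2norm_le_sqrt[OF su[OF t]] and lv = l2norm_le_sqrt[OF sv[OF t]]
        show ?thesis
          unfolding uq du using lu lv root[OF C1] root[OF C2] by (auto simp: distrib_right)
      qed
      show ?thesis using s unique est by blast
    qed
    then show "let Fp = fp - \<epsilon>^2 / 12 * fp^3; Fm = fm - \<epsilon>^2 / 12 * fm^3;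
           t0 = r / K * \<epsilon> powr (-3) * \<bar>ln \<epsilon>\<bar>;
           q0 = (\<lambda>n::int. \<Sum>\<^sub>\<infinity>k\<in>{..<n}. v0 k) in
       (v0 has_sum (\<epsilon> * Fp - \<epsilon> * Fm)) UNIV \<and>
       in_l2 (\<lambda>n. u0 n - \<epsilon> * f (\<epsilon> * of_int n) 0) \<and>
       in_l22 (\<lambda>n. v0 n - \<epsilon>^2 * d1 f (\<epsilon> * of_int n) 0) \<and>
       l2norm (\<lambda>n. u0 n - \<epsilon> * f (\<epsilon> * of_int n) 0)
         + l22norm (\<lambda>n. v0 n - \<epsilon>^2 * d1 f (\<epsilon> * of_int n) 0) \<le> \<epsilon> powr (5/2)
       \<longrightarrow>
       (\<exists>u q du dq. FPUT_sol t0 u0 q0 u q du dq) \<and>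
       (\<forall>u q du dq u' q' du' dq'. FPUT_sol t0 u0 q0 u q du dq \<and> FPUT_sol t0 u0 q0 u' q' du' dq'
          \<longrightarrow> (\<forall>t\<in>{-t0..t0}. u t = u' t \<and> q t = q' t)) \<and>
       (\<forall>u q du dq. FPUT_sol t0 u0 q0 u q du dq \<longrightarrow>
          (\<forall>t\<in>{-t0..t0}.
             in_l2 (\<lambda>n. apply_bcontfun (u t) n - \<epsilon> * f (\<epsilon> * (of_int n + t)) (\<epsilon>^3 * t)) \<and>
             in_l2 (\<lambda>n. apply_bcontfun (du t) n - \<epsilon>^2 * d1 f (\<epsilon> * (of_int n + t)) (\<epsilon>^3 * t)) \<and>
             l2norm (\<lambda>n. apply_bcontfun (u t) n - \<epsilon> * f (\<epsilon> * (of_int n + t)) (\<epsilon>^3 * t))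
             + l2norm (\<lambda>n. apply_bcontfun (du t) n - \<epsilon>^2 * d1 f (\<epsilon> * (of_int n + t)) (\<epsilon>^3 * t))
               \<le> (sqrt C1 + sqrt C2) * \<epsilon> powr (5/2 - r)))"
      unfolding Let_def f_g d1_g t0_def[symmetric] q0_def[symmetric] k_def[symmetric] by blast
  qed
qed

end
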